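(* Let $\nu\in\mathbb{N}^*$ and $h\in(0,1/2)$, and let $\boldsymbol{B}$ be the multiparameter fractional Brownian motion of parameter $h$ on $\mathbb{R}_+^\nu$. There are constants $\kappa_1>0$ and $\kappa_2>0$ such that for any fixed $r\in(0,1)$ and any $\varepsilon>0$ small enough (compared to $r$), $$\exp\left\{-\kappa_2\frac{r^{\nu^2}}{\varepsilon^{\nu/h}}\right\}\leq\mathbb{P}\left(\sup_{t\in[0,r]^\nu}|\boldsymbol{B}_t|\leq\varepsilon\right)\leq\exp\left\{-\kappa_1\frac{r^{\nu^2}}{\varepsilon^{\nu/h}}\right\}.$$
   Context: The multiparameter fractional Brownian motion $\boldsymbol{B}$ of Hurst parameter $h$ is the centred real Gaussian process on $\mathbb{R}_+^\nu$ (taken with continuous sample paths) with covariance $$k^{(\nu)}(s,t)=\tfrac12\left(\lambda([0,s])^{2h}+\lambda([0,t])^{2h}-\lambda([0,s]\bigtriangleup[0,t])^{2h}\right),$$ where $\lambda$ is Lebesgue measure on $\mathbb{R}^\nu$, $[0,t]=\prod_i[0,t_i]$, and $\bigtriangleup$ is the symmetric difference. The constants $\kappa_1,\kappa_2$ do not depend on $r$ or $\varepsilon$. *)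

theory Defs
  imports "HOL-Probability.Probability"
begin

(* The library's normal_density is a probability density only for positive standard deviation;
   the almost surely constant case is the degenerate normal law. *)
definition gaussian_variable :: "'w measure \<Rightarrow> ('w \<Rightarrow> real) \<Rightarrow> bool" where
  "gaussian_variable M X \<longleftrightarrow>
     X \<in> borel_measurable M \<and>
     ((\<exists>c. AE \<omega> in M. X \<omega> = c) \<or>
      (\<exists>\<mu> \<sigma>. \<sigma> > 0 \<and> distributed M lborel X (\<lambda>x. ennreal (normal_density \<mu> \<sigma> x))))"

definition centred_gaussian_process ::
    "'w measure \<Rightarrow> 't set \<Rightarrow> ('t \<Rightarrow> 'w \<Rightarrow> real) \<Rightarrow> bool" where
  "centred_gaussian_process M T X \<longleftrightarrow>
     prob_space M \<and>
     (\<forall>S a. finite S \<and> S \<subseteq> T \<longrightarrow> gaussian_variable M (\<lambda>\<omega>. \<Sum>t\<in>S. a t * X t \<omega>)) \<and>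
     (\<forall>t\<in>T. integral\<^sup>L M (X t) = 0)"

definition nonneg_orthant :: "(real ^ 'n) set" where
  "nonneg_orthant = {t. \<forall>i. 0 \<le> t $ i}"

definition mfbm_kernel :: "real \<Rightarrow> real ^ 'n \<Rightarrow> real ^ 'n \<Rightarrow> real" where
  "mfbm_kernel h s t =
     (measure lborel (cbox 0 s) powr (2 * h) + measure lborel (cbox 0 t) powr (2 * h)
      - measure lborel (sym_diff (cbox 0 s) (cbox 0 t)) powr (2 * h)) / 2"

(* The values of B outside the nonnegative orthant are irrelevant. As the process is centred,
   its covariance is the expectation of the product. *)
definition multiparameter_fbm ::
    "'w measure \<Rightarrow> real \<Rightarrow> (real ^ 'n \<Rightarrow> 'w \<Rightarrow> real) \<Rightarrow> bool" where
  "multiparameter_fbm M h B \<longleftrightarrow>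
     centred_gaussian_process M nonneg_orthant B \<and>
     (\<forall>s\<in>nonneg_orthant. \<forall>t\<in>nonneg_orthant.
        integral\<^sup>L M (\<lambda>\<omega>. B s \<omega> * B t \<omega>) = mfbm_kernel h s t) \<and>
     (\<forall>\<omega>\<in>space M. continuous_on nonneg_orthant (\<lambda>t. B t \<omega>))"

end

theory Submission
  imports Defs
begin

text \<open>Upper bound: on a grid of \<open>m ^ CARD('n)\<close> points of \<open>[r / 2, r] ^ CARD('n)\<close> the covariance matrix has
  smallest eigenvalue of order \<open>(r ^ CARD('n) / m) powr (2 * h)\<close>. Indeed \<open>x powr (2 * h)\<close> is a mixture of the functions
  \<open>1 - exp (- (u * x))\<close>, the kernels \<open>exp (- (u * measure (sym_diff A B)))\<close> are positive semidefinite, and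
  they are diagonally dominant on the grid once \<open>u\<close> exceeds the inverse of the grid separation.
  Choosing \<open>m\<close> so that this eigenvalue is a large multiple of \<open>\<epsilon>\<^sup>2\<close>, each grid point contributes a
  fixed factor smaller than \<open>1\<close>.

  Lower bound: round the increments of \<open>B\<close> along the links of a dyadic tree. The code so obtained
  has entropy of order \<open>r ^ (CARD('n)\<^sup>2) / \<epsilon> powr (CARD('n) / h)\<close>, hence two independent copies
  \<open>B\<close> and \<open>B'\<close> share their code, and are therefore uniformly close, with at least the
  probability claimed; and \<open>(B - B') / sqrt 2\<close> has the same law as \<open>B\<close>.\<close>

section \<open>Gaussian variables and the Cramer-Wold principle\<close>

text \<open>One volume fixes the exponents. Away from the faces through the origin, neighbouring
  points of a grid of mesh \<open>r / m\<close> have corner boxes that differ by a volume of order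
  \<open>r ^ CARD('n) / m\<close>. Setting \<open>(r ^ CARD('n) / m) powr (2 * h)\<close> equal to
  \<open>\<epsilon>\<^sup>2\<close> gives \<open>m\<close> of order
  \<open>r ^ CARD('n) / \<epsilon> powr (1 / h)\<close>, and \<open>m ^ CARD('n)\<close> is the
  exponent in both bounds.

  The covariance is anchored at the origin. Adjoining the empty box, with the coefficient that makes
  all coefficients sum to zero, turns it into a form of negative type in which the constant part of
  the mixture cancels. The mixture converges near zero because \<open>2 * h < 1\<close>.

  For the lower bound the obstacle is the dependence between the links. The expected length of the
  code is a sum of contributions of single links whatever their joint law, so only the variances of
  the links matter. The total is dominated by the level at which a link has deviation of order
  \<open>\<epsilon>\<close>, provided the cost of a link grows slowly above this level of the tree
  and decays fast below it.\<close>

lemma centred_gaussian_variable: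
  assumes "prob_space M" and "gaussian_variable M X" and "integral\<^sup>L M X = 0"
  shows gaussian_variable_moment: "integrable M (\<lambda>\<omega>. X \<omega> ^ k)"
    and gaussian_variable_even_moment:
      "integral\<^sup>L M (\<lambda>\<omega>. X \<omega> ^ (2 * k)) =
        fact (2 * k) / (2 ^ k * fact k) * (integral\<^sup>L M (\<lambda>\<omega>. (X \<omega>)\<^sup>2)) ^ k"
    and gaussian_variable_cos:
      "integral\<^sup>L M (\<lambda>\<omega>. cos (\<theta> + X \<omega>)) = exp (- integral\<^sup>L M (\<lambda>\<omega>. (X \<omega>)\<^sup>2) / 2) * cos \<theta>"
proof -
  interpret prob_space M by fact
  have [measurable]: "X \<in> borel_measurable M"
    using assms(2) by (simp add: gaussian_variable_def)
  consider c where "AE \<omega> in M. X \<omega> = c"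
    | \<mu> \<sigma> where "\<sigma> > 0" "distributed M lborel X (\<lambda>x. ennreal (normal_density \<mu> \<sigma> x))"
    using assms(2) unfolding gaussian_variable_def by blast
  then have "integrable M (\<lambda>\<omega>. X \<omega> ^ k) \<and>
    integral\<^sup>L M (\<lambda>\<omega>. X \<omega> ^ (2 * k)) =
        fact (2 * k) / (2 ^ k * fact k) * (integral\<^sup>L M (\<lambda>\<omega>. (X \<omega>)\<^sup>2)) ^ k \<and>
    integral\<^sup>L M (\<lambda>\<omega>. cos (\<theta> + X \<omega>)) = exp (- integral\<^sup>L M (\<lambda>\<omega>. (X \<omega>)\<^sup>2) / 2) * cos \<theta>"
  proof cases
    \<comment> \<open>Mean zero forces the constant to be \<open>0\<close>, so each expectation is
      the integrand at \<open>0\<close>. The moment formula must still cover \<open>k = 0\<close>,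
      where \<open>0 ^ 0 = 1\<close>.\<close>
    case 1
    have "integral\<^sup>L M X = integral\<^sup>L M (\<lambda>_. c)"
      using 1 by (intro integral_cong_AE) auto
    then have "c = 0"
      using assms(3) by (simp add: prob_space)
    with 1 have ae: "AE \<omega> in M. X \<omega> = 0" by simp
    have eq: "integral\<^sup>L M (\<lambda>\<omega>. g (X \<omega>)) = g 0" if [measurable]: "g \<in> borel_measurable borel" for g :: "real \<Rightarrow> real"
    proof -
      have "integral\<^sup>L M (\<lambda>\<omega>. g (X \<omega>)) = integral\<^sup>L M (\<lambda>_. g 0)"
        using ae by (intro integral_cong_AE) auto
      then show ?thesis by (simp add: prob_space)
    qed
    have "integrable M (\<lambda>\<omega>. X \<omega> ^ k)"
    proof (rule integrable_const_bound)
      show "AE \<omega> in M. norm (X \<omega> ^ k) \<le> norm ((0::real) ^ k)"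
        using ae by eventually_elim simp
    qed simp
    then show ?thesis
      using eq[of "\<lambda>x. x ^ (2 * k)"] eq[of "\<lambda>x. x\<^sup>2"] eq[of "\<lambda>x. cos (\<theta> + x)"]
      by (cases "k = 0") (auto simp: power_0_left)
  next
    case 2
    have "\<mu> = 0"
      using distributed_integral[OF 2(2), of "\<lambda>x. x"] integral_normal_moment_nz_1[OF 2(1), of \<mu>]
        assms(3) by simp
    note D = 2(2)[unfolded \<open>\<mu> = 0\<close>]
    have int: "integrable M (\<lambda>\<omega>. X \<omega> ^ k)" for k
      using distributed_integrable[OF D, of "\<lambda>x. x ^ k"] integrable_normal_moment[OF 2(1), of 0 k] by simp
    have even: "integral\<^sup>L M (\<lambda>\<omega>. X \<omega> ^ (2 * k)) = fact (2 * k) / (2 ^ k * fact k) * (\<sigma>\<^sup>2) ^ k" for k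
      using distributed_integral[OF D, of "\<lambda>x. x ^ (2 * k)"] integral_normal_moment_even[OF 2(1), of 0 k]
      by (simp add: field_simps power_divide)
    have var: "integral\<^sup>L M (\<lambda>\<omega>. (X \<omega>)\<^sup>2) = \<sigma>\<^sup>2"
      using even[of 1] by simp
    have "distributed M lborel (\<lambda>\<omega>. 0 + (1 / \<sigma>) * X \<omega>) (normal_density (0 + (1 / \<sigma>) * 0) (\<bar>1 / \<sigma>\<bar> * \<sigma>))"
      using 2(1) by (intro normal_density_affine[OF D]) auto
    then have D': "distributed M lborel (\<lambda>\<omega>. X \<omega> / \<sigma>) std_normal_density"
      using 2(1) by simp
    have "(CLINT \<omega>|M. iexp (\<sigma> * (X \<omega> / \<sigma>))) = (CLINT x|distr M lborel (\<lambda>\<omega>. X \<omega> / \<sigma>). iexp (\<sigma> * x))"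
      by (subst integral_distr) auto
    also have "\<dots> = char std_normal_distribution \<sigma>"
      using distributed_distr_eq_density[OF D'] by (simp add: char_def)
    finally have ch: "(CLINT \<omega>|M. iexp (X \<omega>)) = of_real (exp (- \<sigma>\<^sup>2 / 2))"
      using 2(1) by (simp add: char_std_normal_distribution)
    have ii: "integrable M (\<lambda>\<omega>. iexp (X \<omega>))"
      by (rule integrable_iexp) simp_all
    \<comment> \<open>The phase is a constant factor \<open>iexp \<theta>\<close>; the real part of
      the rotated characteristic function is the integral of the shifted cosine.\<close>
    have "(CLINT \<omega>|M. iexp \<theta> * iexp (X \<omega>)) = iexp \<theta> * of_real (exp (- \<sigma>\<^sup>2 / 2))"
      using ch by simp
    then have "Re (CLINT \<omega>|M. iexp \<theta> * iexp (X \<omega>)) = Re (iexp \<theta> * of_real (exp (- \<sigma>\<^sup>2 / 2)))"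
      by simp
    moreover have "Re (CLINT \<omega>|M. iexp \<theta> * iexp (X \<omega>)) = integral\<^sup>L M (\<lambda>\<omega>. Re (iexp \<theta> * iexp (X \<omega>)))"
      by (rule integral_Re[symmetric]) (use ii in \<open>auto intro!: integrable_mult_right\<close>)
    ultimately show ?thesis
      using int even var
      by (simp add: exp_add[symmetric] cis_conv_exp[symmetric] distrib_left[symmetric] cis_mult mult.commute)
  qed
  then show "integrable M (\<lambda>\<omega>. X \<omega> ^ k)"
    and "integral\<^sup>L M (\<lambda>\<omega>. X \<omega> ^ (2 * k)) =
        fact (2 * k) / (2 ^ k * fact k) * (integral\<^sup>L M (\<lambda>\<omega>. (X \<omega>)\<^sup>2)) ^ k"
    and "integral\<^sup>L M (\<lambda>\<omega>. cos (\<theta> + X \<omega>)) = exp (- integral\<^sup>L M (\<lambda>\<omega>. (X \<omega>)\<^sup>2) / 2) * cos \<theta>"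
    by blast+
qed

section \<open>Uniqueness of finite-dimensional laws\<close>

text \<open>Divided by their common total mass the weights become probability densities. Cosines
  with phases \<open>0\<close> and \<open>- (pi / 2)\<close> are the real and imaginary parts of the
  characteristic functions of \<open>Z\<close> and \<open>Z'\<close> under these densities, so
  Levy's uniqueness theorem applies.\<close>

lemma weighted_integral_indicator_eq:
  fixes Z :: "'a \<Rightarrow> real" and Z' :: "'b \<Rightarrow> real"
  assumes "prob_space M" and "prob_space N"
    and [measurable]: "Z \<in> borel_measurable M" "W \<in> borel_measurable M"
      "Z' \<in> borel_measurable N" "W' \<in> borel_measurable N"
    and W: "\<And>\<omega>. 0 \<le> W \<omega>" "\<And>\<omega>. W \<omega> \<le> (C::real)"
    and W': "\<And>\<omega>. 0 \<le> W' \<omega>" "\<And>\<omega>. W' \<omega> \<le> C"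
    and eq: "\<And>s \<phi>. integral\<^sup>L M (\<lambda>\<omega>. W \<omega> * cos (\<phi> + s * Z \<omega>)) = integral\<^sup>L N (\<lambda>\<omega>. W' \<omega> * cos (\<phi> + s * Z' \<omega>))"
    and A[measurable]: "A \<in> sets borel"
  shows "integral\<^sup>L M (\<lambda>\<omega>. W \<omega> * indicator A (Z \<omega>)) = integral\<^sup>L N (\<lambda>\<omega>. W' \<omega> * indicator A (Z' \<omega>))"
proof -
  interpret M: prob_space M by fact
  interpret N: prob_space N by fact
  define c where "c = integral\<^sup>L M W"
  have c': "c = integral\<^sup>L N W'"
    using eq[of 0 0] by (simp add: c_def)
  have intM: "integrable M (\<lambda>\<omega>. W \<omega> * f \<omega>)" if [measurable]: "f \<in> borel_measurable M" and "\<And>\<omega>. \<bar>f \<omega>\<bar> \<le> 1" for f :: "'a \<Rightarrow> real"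
    using W that(2) by (intro M.integrable_const_bound[where B=C])
      (auto simp: abs_mult intro!: always_eventually mult_mono[of _ C _ 1, simplified] order_trans[OF W(1) W(2)])
  have intN: "integrable N (\<lambda>\<omega>. W' \<omega> * f \<omega>)" if [measurable]: "f \<in> borel_measurable N" and "\<And>\<omega>. \<bar>f \<omega>\<bar> \<le> 1" for f :: "'b \<Rightarrow> real"
    using W' that(2) by (intro N.integrable_const_bound[where B=C])
      (auto simp: abs_mult intro!: always_eventually mult_mono[of _ C _ 1, simplified] order_trans[OF W'(1) W'(2)])
  have le: "0 \<le> integral\<^sup>L M (\<lambda>\<omega>. W \<omega> * indicator A (Z \<omega>))" "integral\<^sup>L M (\<lambda>\<omega>. W \<omega> * indicator A (Z \<omega>)) \<le> c"
    unfolding c_def using W intM[of "\<lambda>_. 1"] intM[of "\<lambda>\<omega>. indicator A (Z \<omega>)"]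
    by (auto intro!: integral_nonneg integral_mono simp: indicator_def)
  have le': "0 \<le> integral\<^sup>L N (\<lambda>\<omega>. W' \<omega> * indicator A (Z' \<omega>))" "integral\<^sup>L N (\<lambda>\<omega>. W' \<omega> * indicator A (Z' \<omega>)) \<le> c"
    unfolding c' using W' intN[of "\<lambda>_. 1"] intN[of "\<lambda>\<omega>. indicator A (Z' \<omega>)"]
    by (auto intro!: integral_nonneg integral_mono simp: indicator_def)
  have "c \<ge> 0"
    unfolding c_def using W by (auto intro!: integral_nonneg)
  show ?thesis
  \<comment> \<open>With total mass zero there is no density to normalise, but both integrals lie
    between \<open>0\<close> and \<open>c\<close>.\<close>
  proof (cases "c = 0")
    case True
    then show ?thesis using le le' by simp
  next
    case False
    with \<open>c \<ge> 0\<close> have "c > 0" by simp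
    \<comment> \<open>Stated for a generic space so that it serves both sides; its right-hand sides
      are integrals that \<open>eq\<close> identifies.\<close>
    have key: "real_distribution (distr (density Q (\<lambda>\<omega>. ennreal (V \<omega> / c))) borel T) \<and>
        (\<forall>s. char (distr (density Q (\<lambda>\<omega>. ennreal (V \<omega> / c))) borel T) s =
          Complex (integral\<^sup>L Q (\<lambda>\<omega>. V \<omega> * cos (0 + s * T \<omega>)) / c) (integral\<^sup>L Q (\<lambda>\<omega>. V \<omega> * cos (- (pi / 2) + s * T \<omega>)) / c)) \<and>
        measure (distr (density Q (\<lambda>\<omega>. ennreal (V \<omega> / c))) borel T) A = integral\<^sup>L Q (\<lambda>\<omega>. V \<omega> * indicator A (T \<omega>)) / c"
      if "prob_space Q" and [measurable]: "T \<in> borel_measurable Q" "V \<in> borel_measurable Q"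
        and V: "\<And>\<omega>. 0 \<le> V \<omega>" and cV: "c = integral\<^sup>L Q V" and
        int: "\<And>f. f \<in> borel_measurable Q \<Longrightarrow> (\<And>\<omega>. \<bar>f \<omega>\<bar> \<le> 1) \<Longrightarrow> integrable Q (\<lambda>\<omega>. V \<omega> * f \<omega>)"
      for Q :: "'c measure" and V T :: "'c \<Rightarrow> real"
    proof -
      let ?D = "density Q (\<lambda>\<omega>. ennreal (V \<omega> / c))"
      have intV: "integrable Q V" using int[of "\<lambda>_. 1"] by simp
      have "emeasure ?D (space ?D) = (\<integral>\<^sup>+\<omega>. ennreal (V \<omega> / c) \<partial>Q)"
        by (simp add: emeasure_density)
      also have "\<dots> = ennreal (integral\<^sup>L Q (\<lambda>\<omega>. V \<omega> / c))"
        using V \<open>c > 0\<close> intV by (intro nn_integral_eq_integral) auto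
      also have "\<dots> = 1" using cV False by simp
      finally have D: "prob_space ?D" by (rule prob_spaceI)
      interpret D: prob_space ?D by (rule D)
      have rd: "real_distribution (distr ?D borel T)"
        by (simp add: real_distribution_def real_distribution_axioms_def D.prob_space_distr)
      interpret R: real_distribution "distr ?D borel T" by (rule rd)
      have dens: "integral\<^sup>L ?D f = integral\<^sup>L Q (\<lambda>\<omega>. V \<omega> * f \<omega>) / c" if [measurable]: "f \<in> borel_measurable Q" for f :: "'c \<Rightarrow> real"
        using V \<open>c > 0\<close> by (subst integral_density) auto
      have ch: "char (distr ?D borel T) s =
          Complex (integral\<^sup>L Q (\<lambda>\<omega>. V \<omega> * cos (0 + s * T \<omega>)) / c) (integral\<^sup>L Q (\<lambda>\<omega>. V \<omega> * cos (- (pi / 2) + s * T \<omega>)) / c)" for s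
      proof -
        have "char (distr ?D borel T) s = (CLINT \<omega>|?D. iexp (s * T \<omega>))"
          unfolding char_def by (subst integral_distr) auto
        moreover have "integrable ?D (\<lambda>\<omega>. iexp (s * T \<omega>))"
          by (rule D.integrable_iexp) simp_all
        ultimately have "Re (char (distr ?D borel T) s) = integral\<^sup>L ?D (\<lambda>\<omega>. cos (s * T \<omega>))"
          "Im (char (distr ?D borel T) s) = integral\<^sup>L ?D (\<lambda>\<omega>. sin (s * T \<omega>))"
          by (simp_all add: integral_Re[symmetric] integral_Im[symmetric] cis_conv_exp[symmetric] del: of_real_mult)
        moreover have "cos (- (pi / 2) + x) = sin x" for x :: real
          by (simp add: cos_diff)
        ultimately show ?thesis
          by (intro complex_eqI) (simp_all add: dens)
      qed
      have "measure (distr ?D borel T) A = integral\<^sup>L (distr ?D borel T) (indicator A)"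
        by simp
      also have "\<dots> = integral\<^sup>L ?D (\<lambda>\<omega>. indicator A (T \<omega>))"
        by (subst integral_distr) auto
      finally show ?thesis using rd ch by (simp add: dens)
    qed
    note kM = key[OF \<open>prob_space M\<close> \<open>Z \<in> borel_measurable M\<close> \<open>W \<in> borel_measurable M\<close> W(1) c_def intM]
    note kN = key[OF \<open>prob_space N\<close> \<open>Z' \<in> borel_measurable N\<close> \<open>W' \<in> borel_measurable N\<close> W'(1) c' intN]
    have "distr (density M (\<lambda>\<omega>. ennreal (W \<omega> / c))) borel Z = distr (density N (\<lambda>\<omega>. ennreal (W' \<omega> / c))) borel Z'"
      using kM kN by (intro Levy_uniqueness ext) (auto simp only: eq)
    then show ?thesis
      using kM kN \<open>c > 0\<close> by simp
  qed
qed

text \<open>The coordinates are converted from cosines to indicators one at a time. The induction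
  over the converted set \<open>J\<close> keeps an arbitrary linear phase in all coordinates as an
  extra factor, since this phase is what isolates the next coordinate.\<close>

lemma measure_box_eq_of_integral_cos_eq:
  fixes X :: "'i \<Rightarrow> 'a \<Rightarrow> real" and Y :: "'i \<Rightarrow> 'b \<Rightarrow> real"
  assumes "prob_space M" and "prob_space N" and I: "finite I"
    and X: "\<And>i. i \<in> I \<Longrightarrow> X i \<in> borel_measurable M"
    and Y: "\<And>i. i \<in> I \<Longrightarrow> Y i \<in> borel_measurable N"
    and eq: "\<And>a \<theta>. integral\<^sup>L M (\<lambda>\<omega>. cos (\<theta> + (\<Sum>i\<in>I. a i * X i \<omega>))) =
      integral\<^sup>L N (\<lambda>\<omega>. cos (\<theta> + (\<Sum>i\<in>I. a i * Y i \<omega>)))"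
    and A: "\<And>i. i \<in> I \<Longrightarrow> A i \<in> sets borel"
  shows "measure M {\<omega> \<in> space M. \<forall>i\<in>I. X i \<omega> \<in> A i} = measure N {\<omega> \<in> space N. \<forall>i\<in>I. Y i \<omega> \<in> A i}"
proof -
  interpret M: prob_space M by fact
  interpret N: prob_space N by fact
  note [measurable] = X Y A
  let ?P = "\<lambda>J \<omega>. \<Prod>i\<in>J. indicator (A i) (X i \<omega>) :: real"
  let ?Q = "\<lambda>J \<omega>. \<Prod>i\<in>J. indicator (A i) (Y i \<omega>) :: real"
  have P01: "0 \<le> ?P J \<omega>" "?P J \<omega> \<le> 1" and Q01: "0 \<le> ?Q J \<omega>'" "?Q J \<omega>' \<le> 1" for J \<omega> \<omega>'
    by (auto intro!: prod_nonneg prod_le_1)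
  have main: "\<forall>a \<theta>. integral\<^sup>L M (\<lambda>\<omega>. ?P J \<omega> * cos (\<theta> + (\<Sum>i\<in>I. a i * X i \<omega>))) =
      integral\<^sup>L N (\<lambda>\<omega>. ?Q J \<omega> * cos (\<theta> + (\<Sum>i\<in>I. a i * Y i \<omega>)))" if "finite J" "J \<subseteq> I" for J
    using that
  proof (induction J rule: finite_induct)
    case empty
    then show ?case using eq by simp
  next
    case (insert j J)
    then have IH: "\<And>a \<theta>. integral\<^sup>L M (\<lambda>\<omega>. ?P J \<omega> * cos (\<theta> + (\<Sum>i\<in>I. a i * X i \<omega>))) =
      integral\<^sup>L N (\<lambda>\<omega>. ?Q J \<omega> * cos (\<theta> + (\<Sum>i\<in>I. a i * Y i \<omega>)))"
      and j[measurable]: "j \<in> I" and J: "J \<subseteq> I" by auto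
    have [measurable]: "X j \<in> borel_measurable M" "Y j \<in> borel_measurable N" "A j \<in> sets borel"
      using j by auto
    have [measurable]: "?P J \<in> borel_measurable M" "?Q J \<in> borel_measurable N"
      using J by (auto intro!: borel_measurable_prod simp: subset_iff)
    have iP: "integrable M (\<lambda>\<omega>. ?P J \<omega> * f \<omega>)" if [measurable]: "f \<in> borel_measurable M" and "\<And>\<omega>. \<bar>f \<omega>\<bar> \<le> 1" for f :: "'a \<Rightarrow> real"
      using P01 that(2) by (intro M.integrable_const_bound[where B=1])
        (auto simp: abs_mult intro!: always_eventually mult_le_one)
    have iQ: "integrable N (\<lambda>\<omega>. ?Q J \<omega> * f \<omega>)" if [measurable]: "f \<in> borel_measurable N" and "\<And>\<omega>. \<bar>f \<omega>\<bar> \<le> 1" for f :: "'b \<Rightarrow> real"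
      using Q01 that(2) by (intro N.integrable_const_bound[where B=1])
        (auto simp: abs_mult intro!: always_eventually mult_le_one)
    \<comment> \<open>Moves the test frequency \<open>s\<close> of coordinate \<open>j\<close> into
      the coefficients, so that \<open>IH\<close> covers the shifted phase.\<close>
    have upd: "(\<Sum>i\<in>I. (a(j := a j + s)) i * x i) = (\<Sum>i\<in>I. a i * x i) + s * x j" for a s and x :: "'i \<Rightarrow> real"
    proof -
      have "(\<Sum>i\<in>I. (a(j := a j + s)) i * x i) = (\<Sum>i\<in>I. a i * x i + (if i = j then s * x j else 0))"
        by (intro sum.cong) (auto simp: algebra_simps)
      also have "\<dots> = (\<Sum>i\<in>I. a i * x i) + s * x j"
        using I j by (simp add: sum.distrib)
      finally show ?thesis .
    qed
    have one: "integral\<^sup>L M (\<lambda>\<omega>. ?P J \<omega> * cos (\<phi> + s * X j \<omega>)) = integral\<^sup>L N (\<lambda>\<omega>. ?Q J \<omega> * cos (\<phi> + s * Y j \<omega>))" for \<phi> s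
      using IH[of \<phi> "(\<lambda>_. 0)(j := 0 + s)"] unfolding upd[of "\<lambda>_. 0", simplified] upd[of "\<lambda>_. 0"] by simp
    \<comment> \<open>The contribution of the constant \<open>1\<close> in the weight
      \<open>1 + cos\<close> used below; subtracting it leaves the cosine alone.\<close>
    have S1: "integral\<^sup>L M (\<lambda>\<omega>. ?P J \<omega> * indicator (A j) (X j \<omega>)) = integral\<^sup>L N (\<lambda>\<omega>. ?Q J \<omega> * indicator (A j) (Y j \<omega>))"
      by (rule weighted_integral_indicator_eq[where C=1]) (use P01 Q01 one M.prob_space_axioms N.prob_space_axioms in auto)
    \<comment> \<open>A cosine is signed and cannot serve as a weight, but \<open>1 + cos\<close>
      can. The product formula then reduces everything to single cosines of linear phases.\<close>
    have cc: "p * (1 + cos (\<theta> + S)) * cos (\<phi> + s * x) = p * cos (\<phi> + s * x) +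
        (p * cos ((\<theta> + \<phi>) + (S + s * x)) / 2 + p * cos ((\<theta> - \<phi>) + (S + - s * x)) / 2)" for p \<theta> S \<phi> s x :: real
    proof -
      have c: "cos (\<theta> + S) * cos (\<phi> + s * x) = (cos ((\<theta> + \<phi>) + (S + s * x)) + cos ((\<theta> - \<phi>) + (S + - s * x))) / 2"
        by (simp add: cos_times_cos algebra_simps)
      have "p * (1 + cos (\<theta> + S)) * cos (\<phi> + s * x) = p * cos (\<phi> + s * x) + p * (cos (\<theta> + S) * cos (\<phi> + s * x))"
        by (simp add: distrib_left distrib_right mult.assoc)
      then show ?thesis
        unfolding c by (simp add: distrib_left add_divide_distrib)
    qed
    show ?case
    proof (intro allI)
      fix a \<theta>
      let ?S = "\<lambda>\<omega>. \<Sum>i\<in>I. a i * X i \<omega>" and ?T = "\<lambda>\<omega>. \<Sum>i\<in>I. a i * Y i \<omega>"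
      have [measurable]: "?S \<in> borel_measurable M" "?T \<in> borel_measurable N"
        by (auto intro!: borel_measurable_sum)
      have two: "integral\<^sup>L M (\<lambda>\<omega>. ?P J \<omega> * (1 + cos (\<theta> + ?S \<omega>)) * cos (\<phi> + s * X j \<omega>)) =
          integral\<^sup>L N (\<lambda>\<omega>. ?Q J \<omega> * (1 + cos (\<theta> + ?T \<omega>)) * cos (\<phi> + s * Y j \<omega>))" for \<phi> s
      proof -
        have "integral\<^sup>L M (\<lambda>\<omega>. ?P J \<omega> * (1 + cos (\<theta> + ?S \<omega>)) * cos (\<phi> + s * X j \<omega>)) =
          integral\<^sup>L M (\<lambda>\<omega>. ?P J \<omega> * cos (\<phi> + s * X j \<omega>) +
            (?P J \<omega> * cos ((\<theta> + \<phi>) + (?S \<omega> + s * X j \<omega>)) / 2 + ?P J \<omega> * cos ((\<theta> - \<phi>) + (?S \<omega> + - s * X j \<omega>)) / 2))"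
          by (simp only: cc)
        also have "\<dots> = integral\<^sup>L M (\<lambda>\<omega>. ?P J \<omega> * cos (\<phi> + s * X j \<omega>)) +
            (integral\<^sup>L M (\<lambda>\<omega>. ?P J \<omega> * cos ((\<theta> + \<phi>) + (?S \<omega> + s * X j \<omega>))) / 2 +
             integral\<^sup>L M (\<lambda>\<omega>. ?P J \<omega> * cos ((\<theta> - \<phi>) + (?S \<omega> + - s * X j \<omega>))) / 2)"
          using iP by (subst Bochner_Integration.integral_add; simp)+
        also have "\<dots> = integral\<^sup>L N (\<lambda>\<omega>. ?Q J \<omega> * cos (\<phi> + s * Y j \<omega>)) +
            (integral\<^sup>L N (\<lambda>\<omega>. ?Q J \<omega> * cos ((\<theta> + \<phi>) + (?T \<omega> + s * Y j \<omega>))) / 2 +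
             integral\<^sup>L N (\<lambda>\<omega>. ?Q J \<omega> * cos ((\<theta> - \<phi>) + (?T \<omega> + - s * Y j \<omega>))) / 2)"
          using IH[of "\<theta> + \<phi>" "a(j := a j + s)"] IH[of "\<theta> - \<phi>" "a(j := a j + - s)"] one[of \<phi> s]
          unfolding upd[of a s] upd[of a "- s"] by simp
        also have "\<dots> = integral\<^sup>L N (\<lambda>\<omega>. ?Q J \<omega> * cos (\<phi> + s * Y j \<omega>) +
            (?Q J \<omega> * cos ((\<theta> + \<phi>) + (?T \<omega> + s * Y j \<omega>)) / 2 + ?Q J \<omega> * cos ((\<theta> - \<phi>) + (?T \<omega> + - s * Y j \<omega>)) / 2))"
          using iQ by (subst Bochner_Integration.integral_add; simp)+
        also have "\<dots> = integral\<^sup>L N (\<lambda>\<omega>. ?Q J \<omega> * (1 + cos (\<theta> + ?T \<omega>)) * cos (\<phi> + s * Y j \<omega>))"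
          by (simp only: cc)
        finally show ?thesis .
      qed
      have c2: "0 \<le> p * (1 + cos x)" "p * (1 + cos x) \<le> 2" if "0 \<le> p" "p \<le> 1" for p x :: real
      proof -
        have "0 \<le> 1 + cos x" "1 + cos x \<le> 2"
          using cos_ge_minus_one[of x] cos_le_one[of x] by linarith+
        then show "0 \<le> p * (1 + cos x)" "p * (1 + cos x) \<le> 2"
          using that mult_mono[of p 1 "1 + cos x" 2] by auto
      qed
      have "integral\<^sup>L M (\<lambda>\<omega>. ?P J \<omega> * (1 + cos (\<theta> + ?S \<omega>)) * indicator (A j) (X j \<omega>)) =
          integral\<^sup>L N (\<lambda>\<omega>. ?Q J \<omega> * (1 + cos (\<theta> + ?T \<omega>)) * indicator (A j) (Y j \<omega>))"
        by (rule weighted_integral_indicator_eq[where C=2])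
          (use P01 Q01 two M.prob_space_axioms N.prob_space_axioms in \<open>auto intro!: c2\<close>)
      moreover have "integral\<^sup>L M (\<lambda>\<omega>. ?P J \<omega> * (1 + cos (\<theta> + ?S \<omega>)) * indicator (A j) (X j \<omega>)) =
         integral\<^sup>L M (\<lambda>\<omega>. ?P J \<omega> * indicator (A j) (X j \<omega>)) + integral\<^sup>L M (\<lambda>\<omega>. ?P J \<omega> * (indicator (A j) (X j \<omega>) * cos (\<theta> + ?S \<omega>)))"
        by (subst Bochner_Integration.integral_add[symmetric, OF iP iP])
          (auto simp: algebra_simps abs_mult split: split_indicator)
      moreover have "integral\<^sup>L N (\<lambda>\<omega>. ?Q J \<omega> * (1 + cos (\<theta> + ?T \<omega>)) * indicator (A j) (Y j \<omega>)) =
         integral\<^sup>L N (\<lambda>\<omega>. ?Q J \<omega> * indicator (A j) (Y j \<omega>)) + integral\<^sup>L N (\<lambda>\<omega>. ?Q J \<omega> * (indicator (A j) (Y j \<omega>) * cos (\<theta> + ?T \<omega>)))"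
        by (subst Bochner_Integration.integral_add[symmetric, OF iQ iQ])
          (auto simp: algebra_simps abs_mult split: split_indicator)
      ultimately show "integral\<^sup>L M (\<lambda>\<omega>. ?P (insert j J) \<omega> * cos (\<theta> + ?S \<omega>)) = integral\<^sup>L N (\<lambda>\<omega>. ?Q (insert j J) \<omega> * cos (\<theta> + ?T \<omega>))"
        using S1 insert.hyps by (simp add: mult_ac)
    qed
  qed
  have "measure M {\<omega> \<in> space M. \<forall>i\<in>I. X i \<omega> \<in> A i} = integral\<^sup>L M (\<lambda>\<omega>. ?P I \<omega>)"
  proof -
    have "integral\<^sup>L M (\<lambda>\<omega>. ?P I \<omega>) = integral\<^sup>L M (indicator {\<omega> \<in> space M. \<forall>i\<in>I. X i \<omega> \<in> A i})"
      using I by (intro Bochner_Integration.integral_cong) (auto simp: indicator_def)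
    then show ?thesis using I by simp
  qed
  moreover have "measure N {\<omega> \<in> space N. \<forall>i\<in>I. Y i \<omega> \<in> A i} = integral\<^sup>L N (\<lambda>\<omega>. ?Q I \<omega>)"
  proof -
    have "integral\<^sup>L N (\<lambda>\<omega>. ?Q I \<omega>) = integral\<^sup>L N (indicator {\<omega> \<in> space N. \<forall>i\<in>I. Y i \<omega> \<in> A i})"
      using I by (intro Bochner_Integration.integral_cong) (auto simp: indicator_def)
    then show ?thesis using I by simp
  qed
  ultimately show ?thesis
    using main[OF I order_refl, rule_format, of 0 "\<lambda>_. 0"] by simp
qed

section \<open>Upper bound for small ball probabilities of Gaussian vectors\<close>

lemma std_normal_integral_exp_square:
  assumes "b \<ge> 0"
  shows "integral\<^sup>L std_normal_distribution (\<lambda>x. exp (- b * x\<^sup>2 / 2)) = 1 / sqrt (1 + b)"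
proof -
  \<comment> \<open>The exponential factor raises the precision of the standard normal density from
    \<open>1\<close> to \<open>1 + b\<close>.\<close>
  define s where "s = 1 / sqrt (1 + b)"
  have s: "s > 0" "s\<^sup>2 = 1 / (1 + b)"
    using assms by (auto simp: s_def power_divide)
  have "integral\<^sup>L std_normal_distribution (\<lambda>x. exp (- b * x\<^sup>2 / 2)) =
      integral\<^sup>L lborel (\<lambda>x. std_normal_density x * exp (- b * x\<^sup>2 / 2))"
    by (subst integral_density) auto
  also have "\<dots> = integral\<^sup>L lborel (\<lambda>x. s * normal_density 0 s x)"
  proof (rule Bochner_Integration.integral_cong[OF refl])
    fix x :: real
    have "- x\<^sup>2 / 2 + - b * x\<^sup>2 / 2 = - x\<^sup>2 / (2 * s\<^sup>2)"
      using assms by (simp add: s(2) field_simps)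
    then have "exp (- x\<^sup>2 / 2) * exp (- b * x\<^sup>2 / 2) = exp (- x\<^sup>2 / (2 * s\<^sup>2))"
      by (simp add: exp_add[symmetric])
    moreover have "sqrt (2 * pi * s\<^sup>2) = sqrt (2 * pi) * s"
      using s(1) by (simp add: real_sqrt_mult)
    ultimately show "std_normal_density x * exp (- b * x\<^sup>2 / 2) = s * normal_density 0 s x"
      using s(1) by (simp add: normal_density_def)
  qed
  also have "\<dots> = s"
    using s(1) by simp
  finally show ?thesis by (simp add: s_def)
qed

text \<open>The Gaussian weights are themselves characteristic functions of a standard normal vector,
  so by Fubini the characteristic function bound suffices and no density of the vector
  \<open>X\<close> is needed.\<close>

lemma small_ball_upper_bound:
  fixes X :: "'i \<Rightarrow> 'a \<Rightarrow> real"
  assumes "prob_space M" and I: "finite I"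
    and X[measurable]: "\<And>i. i \<in> I \<Longrightarrow> X i \<in> borel_measurable M"
    and c: "c \<ge> 0" and \<epsilon>: "\<epsilon> > 0"
    and ch: "\<And>a. integral\<^sup>L M (\<lambda>\<omega>. cos (\<Sum>i\<in>I. a i * X i \<omega>)) \<le> exp (- c * (\<Sum>i\<in>I. (a i)\<^sup>2) / 2)"
  shows "measure M {\<omega> \<in> space M. \<forall>i\<in>I. \<bar>X i \<omega>\<bar> \<le> \<epsilon>} \<le> (exp (1 / 2) / sqrt (1 + c / \<epsilon>\<^sup>2)) ^ card I"
proof -
  interpret M: prob_space M by fact
  define S where "S = (\<lambda>_::'i. std_normal_distribution)"
  interpret S1: prob_space std_normal_distribution
    using real_dist_normal_dist by (simp add: real_distribution_def)
  interpret S: product_sigma_finite S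
    unfolding S_def by unfold_locales
  let ?G = "PiM I S"
  interpret G: prob_space ?G
    by (rule prob_space_PiM) (simp add: S_def S1.prob_space_axioms)
  interpret MG: pair_prob_space M ?G ..
  have [measurable]: "(\<lambda>g. g i) \<in> borel_measurable ?G" if "i \<in> I" for i
    using measurable_component_singleton[OF that, of S] by (simp add: S_def)
  let ?f = "\<lambda>\<omega> g. cos (\<Sum>i\<in>I. g i / \<epsilon> * X i \<omega>)"
  have fm[measurable]: "case_prod ?f \<in> borel_measurable (M \<Otimes>\<^sub>M ?G)"
    by (auto simp: split_beta' intro!: borel_measurable_cos borel_measurable_sum borel_measurable_times borel_measurable_divide
        measurable_compose[OF measurable_fst X] measurable_compose[OF measurable_snd])
  have fint: "integrable (M \<Otimes>\<^sub>M ?G) (case_prod ?f)"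
    by (rule MG.integrable_const_bound[where B=1]) (use fm in auto)
  have inner: "integral\<^sup>L ?G (?f \<omega>) = (\<Prod>i\<in>I. exp (- (X i \<omega> / \<epsilon>)\<^sup>2 / 2))" for \<omega>
  proof -
    have int: "integrable (S i) (\<lambda>x. iexp (X i \<omega> / \<epsilon> * x))" for i
      unfolding S_def by (rule S1.integrable_iexp) simp_all
    have pr: "(\<Prod>i\<in>I. iexp (X i \<omega> / \<epsilon> * g i)) = iexp (\<Sum>i\<in>I. g i / \<epsilon> * X i \<omega>)" for g
      using I by (simp add: exp_sum[symmetric] sum_distrib_left mult_ac)
    have "(CLINT g|?G. iexp (\<Sum>i\<in>I. g i / \<epsilon> * X i \<omega>)) = (\<Prod>i\<in>I. CLINT x|S i. iexp (X i \<omega> / \<epsilon> * x))"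
      unfolding pr[symmetric] by (rule S.product_integral_prod[OF I int])
    also have "\<dots> = (\<Prod>i\<in>I. char std_normal_distribution (X i \<omega> / \<epsilon>))"
      by (simp add: S_def char_def)
    also have "\<dots> = of_real (\<Prod>i\<in>I. exp (- (X i \<omega> / \<epsilon>)\<^sup>2 / 2))"
      by (simp add: char_std_normal_distribution)
    finally have "Re (CLINT g|?G. iexp (\<Sum>i\<in>I. g i / \<epsilon> * X i \<omega>)) = (\<Prod>i\<in>I. exp (- (X i \<omega> / \<epsilon>)\<^sup>2 / 2))"
      by (simp only: Re_complex_of_real)
    moreover have "Re (CLINT g|?G. iexp (\<Sum>i\<in>I. g i / \<epsilon> * X i \<omega>)) = integral\<^sup>L ?G (\<lambda>g. Re (iexp (\<Sum>i\<in>I. g i / \<epsilon> * X i \<omega>)))"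
      by (intro integral_Re[symmetric] G.integrable_iexp) (auto intro!: borel_measurable_sum)
    ultimately show ?thesis
      by (simp add: cis_conv_exp[symmetric] del: of_real_sum)
  qed
  \<comment> \<open>A Markov bound: on the event every Gaussian weight is at least
    \<open>exp (- (1 / 2))\<close>.\<close>
  have "exp (- (1 / 2)) ^ card I * measure M {\<omega> \<in> space M. \<forall>i\<in>I. \<bar>X i \<omega>\<bar> \<le> \<epsilon>} =
      integral\<^sup>L M (\<lambda>\<omega>. exp (- (1 / 2)) ^ card I * indicator {\<omega> \<in> space M. \<forall>i\<in>I. \<bar>X i \<omega>\<bar> \<le> \<epsilon>} \<omega>)"
    using I by simp
  also have "\<dots> \<le> integral\<^sup>L M (\<lambda>\<omega>. \<Prod>i\<in>I. exp (- (X i \<omega> / \<epsilon>)\<^sup>2 / 2))"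
  proof (rule integral_mono)
    show "integrable M (\<lambda>\<omega>. \<Prod>i\<in>I. exp (- (X i \<omega> / \<epsilon>)\<^sup>2 / 2))"
      by (rule M.integrable_const_bound[where B=1])
        (auto simp: abs_prod intro!: always_eventually prod_le_1 borel_measurable_prod)
    show "integrable M (\<lambda>\<omega>. exp (- (1 / 2) :: real) ^ card I * indicator {\<omega> \<in> space M. \<forall>i\<in>I. \<bar>X i \<omega>\<bar> \<le> \<epsilon>} \<omega>)"
      using I by (intro M.integrable_const_bound[where B=1])
        (auto simp: abs_mult indicator_def intro!: always_eventually power_le_one)
  next
    fix \<omega> assume "\<omega> \<in> space M"
    have "exp (- (1 / 2)) ^ card I \<le> (\<Prod>i\<in>I. exp (- (X i \<omega> / \<epsilon>)\<^sup>2 / 2))" if "\<forall>i\<in>I. \<bar>X i \<omega>\<bar> \<le> \<epsilon>"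
    proof -
      have "(\<Prod>i\<in>I. exp (- (1 / 2))) \<le> (\<Prod>i\<in>I. exp (- (X i \<omega> / \<epsilon>)\<^sup>2 / 2))"
      proof (rule prod_mono)
        fix i assume "i \<in> I"
        then have "\<bar>X i \<omega> / \<epsilon>\<bar> \<le> 1" using that \<epsilon> by auto
        then have "(X i \<omega> / \<epsilon>)\<^sup>2 \<le> 1" by (simp add: abs_square_le_1)
        then show "0 \<le> exp (- (1 / 2)::real) \<and> exp (- (1 / 2)) \<le> exp (- (X i \<omega> / \<epsilon>)\<^sup>2 / 2)" by simp
      qed
      then show ?thesis by simp
    qed
    then show "exp (- (1 / 2)) ^ card I * indicator {\<omega> \<in> space M. \<forall>i\<in>I. \<bar>X i \<omega>\<bar> \<le> \<epsilon>} \<omega> \<le> (\<Prod>i\<in>I. exp (- (X i \<omega> / \<epsilon>)\<^sup>2 / 2))"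
      by (auto simp: indicator_def intro!: prod_nonneg)
  qed
  also have "\<dots> = integral\<^sup>L M (\<lambda>\<omega>. integral\<^sup>L ?G (?f \<omega>))"
    by (simp only: inner)
  also have "\<dots> = integral\<^sup>L ?G (\<lambda>g. integral\<^sup>L M (\<lambda>\<omega>. ?f \<omega> g))"
    by (rule MG.Fubini_integral[OF fint, symmetric])
  also have "\<dots> \<le> integral\<^sup>L ?G (\<lambda>g. \<Prod>i\<in>I. exp (- (c / \<epsilon>\<^sup>2) * (g i)\<^sup>2 / 2))"
  proof (rule integral_mono)
    show "integrable ?G (\<lambda>g. integral\<^sup>L M (\<lambda>\<omega>. ?f \<omega> g))"
      by (rule MG.integrable_snd[OF fint])
    show "integrable ?G (\<lambda>g. \<Prod>i\<in>I. exp (- (c / \<epsilon>\<^sup>2) * (g i)\<^sup>2 / 2))"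
      using c by (intro G.integrable_const_bound[where B=1])
        (auto simp: abs_prod intro!: always_eventually prod_le_1 borel_measurable_prod)
    \<comment> \<open>For fixed \<open>g\<close> the hypothesis \<open>ch\<close> is used with
      coefficients \<open>g i / \<epsilon>\<close>, which turns \<open>c\<close> into
      \<open>c / \<epsilon>\<^sup>2\<close>.\<close>
    fix g
    have "integral\<^sup>L M (\<lambda>\<omega>. ?f \<omega> g) \<le> exp (- c * (\<Sum>i\<in>I. (g i / \<epsilon>)\<^sup>2) / 2)"
      by (rule ch)
    also have "\<dots> = (\<Prod>i\<in>I. exp (- (c / \<epsilon>\<^sup>2) * (g i)\<^sup>2 / 2))"
      using I by (simp add: exp_sum[symmetric] sum_distrib_left sum_divide_distrib power_divide sum_negf)
    finally show "integral\<^sup>L M (\<lambda>\<omega>. ?f \<omega> g) \<le> (\<Prod>i\<in>I. exp (- (c / \<epsilon>\<^sup>2) * (g i)\<^sup>2 / 2))" .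
  qed
  also have "\<dots> = (\<Prod>i\<in>I. integral\<^sup>L (S i) (\<lambda>x. exp (- (c / \<epsilon>\<^sup>2) * x\<^sup>2 / 2)))"
    using c by (intro S.product_integral_prod[OF I])
      (auto simp: S_def intro!: S1.integrable_const_bound[where B=1])
  also have "\<dots> = (1 / sqrt (1 + c / \<epsilon>\<^sup>2)) ^ card I"
    unfolding S_def using c by (subst std_normal_integral_exp_square) auto
  finally have "exp (1 / 2) ^ card I * (exp (- (1 / 2)) ^ card I * measure M {\<omega> \<in> space M. \<forall>i\<in>I. \<bar>X i \<omega>\<bar> \<le> \<epsilon>})
      \<le> exp (1 / 2) ^ card I * (1 / sqrt (1 + c / \<epsilon>\<^sup>2)) ^ card I"
    by (intro mult_left_mono) auto
  then show ?thesis
    by (simp add: mult.assoc[symmetric] power_mult_distrib[symmetric] exp_add[symmetric] power_divide)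
qed

section \<open>Lower bound by coding\<close>

lemma abs_round_le: "\<bar>real_of_int (round y)\<bar> \<le> 2 * \<bar>y\<bar>" for y :: real
proof (cases "\<bar>y\<bar> < 1 / 2")
  case True
  then have "round y = 0"
    unfolding round_def by (intro floor_unique) auto
  then show ?thesis by simp
next
  case False
  then show ?thesis using of_int_round_abs_le[of y] by linarith
qed

text \<open>The right-hand side is the whole two-sided geometric series, hence uniform in the
  window. It normalises the code law here, and later controls the grid row sums and the link
  tolerances.\<close>

lemma sum_exp_abs_le:
  assumes "\<theta> > 0"
  shows "(\<Sum>k\<in>{- int n..int n}. exp (- \<theta> * \<bar>real_of_int k\<bar>)) \<le> 1 + 2 / (exp \<theta> - 1)"
proof -
  have eq: "(\<Sum>k\<in>{- int n..int n}. exp (- \<theta> * \<bar>real_of_int k\<bar>)) = 1 + 2 * (\<Sum>j<n. exp (- \<theta>) ^ Suc j)"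
  proof (induction n)
    case (Suc n)
    have "{- int (Suc n)..int (Suc n)} = insert (- int (Suc n)) (insert (int (Suc n)) {- int n..int n})"
      by auto
    then show ?case
      using Suc by (simp add: exp_of_nat_mult[symmetric] algebra_simps del: power_Suc)
  qed simp
  have x: "0 < exp (- \<theta>)" "exp (- \<theta>) < 1" using assms by auto
  have "(\<Sum>j<n. exp (- \<theta>) ^ Suc j) = exp (- \<theta>) * (\<Sum>j<n. exp (- \<theta>) ^ j)"
    by (simp add: sum_distrib_left)
  also have "\<dots> \<le> exp (- \<theta>) * (\<Sum>j. exp (- \<theta>) ^ j)"
    using x by (intro mult_left_mono sum_le_suminf) (auto intro!: summable_geometric)
  also have "\<dots> = exp (- \<theta>) / (1 - exp (- \<theta>))"
    using x by (simp add: suminf_geometric)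
  also have "\<dots> = 1 / (exp \<theta> - 1)"
    using assms by (simp add: exp_minus field_simps)
  finally show ?thesis unfolding eq by simp
qed

text \<open>The vector is discretised to its rounded multiples of \<open>e\<close>. If \<open>p\<close> is the law of the code and \<open>q\<close> a
  product of geometric laws, then two independent copies share their code with probability
  \<open>\<Sum>p\<^sup>2 \<ge> (\<Sum>p \<surd>q)\<^sup>2\<close>, to which Jensen's inequality applies.\<close>

lemma coincidence_lower_bound:
  fixes X :: "'i \<Rightarrow> 'a \<Rightarrow> real"
  assumes "prob_space M" and L: "finite L"
    and X[measurable]: "\<And>l. l \<in> L \<Longrightarrow> X l \<in> borel_measurable M"
    and int: "\<And>l. l \<in> L \<Longrightarrow> integrable M (X l)"
    and e: "\<And>l. l \<in> L \<Longrightarrow> e l > 0" and \<theta>: "\<And>l. l \<in> L \<Longrightarrow> \<theta> l > 0"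
  shows "exp (- (\<Sum>l\<in>L. ln (1 + 2 / (exp (\<theta> l) - 1)) + \<theta> l * integral\<^sup>L M (\<lambda>\<omega>. \<bar>real_of_int (round (X l \<omega> / e l))\<bar>)))
    \<le> measure (M \<Otimes>\<^sub>M M) {z \<in> space (M \<Otimes>\<^sub>M M). \<forall>l\<in>L. \<bar>X l (fst z) - X l (snd z)\<bar> \<le> e l}"
proof -
  interpret M: prob_space M by fact
  interpret MM: pair_prob_space M M ..
  define k where "k = (\<lambda>l \<omega>. round (X l \<omega> / e l))"
  have k[measurable]: "k l \<in> measurable M (count_space UNIV)" if "l \<in> L" for l
    using X[OF that] unfolding k_def round_def by measurable
  define Z where "Z = (\<lambda>l. 1 + 2 / (exp (\<theta> l) - 1))"
  have Z: "Z l \<ge> 1" if "l \<in> L" for l using \<theta>[OF that] by (auto simp: Z_def)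
  define cost where "cost = (\<lambda>c :: 'i \<Rightarrow> int. \<Sum>l\<in>L. ln (Z l) + \<theta> l * \<bar>real_of_int (c l)\<bar>)"
  have cost0: "cost c \<ge> 0" for c
    unfolding cost_def using Z \<theta> by (intro sum_nonneg add_nonneg_nonneg mult_nonneg_nonneg) (auto simp: less_imp_le)
  \<comment> \<open>\<open>w c\<close> is the square root of the mass of \<open>c\<close> under the
    product of the geometric laws with normalisers \<open>Z l\<close>.\<close>
  define w where "w = (\<lambda>c. exp (- (cost c) / 2))"
  have w01: "0 < w c" "w c \<le> 1" for c
    using cost0[of c] by (auto simp: w_def)
  define E where "E = (\<lambda>c. {\<omega> \<in> space M. \<forall>l\<in>L. k l \<omega> = c l})"
  have E[measurable]: "E c \<in> sets M" for c
    unfolding E_def using L by measurable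
  define p where "p = (\<lambda>c. measure M (E c))"
  \<comment> \<open>Finite windows of codes keep all sums finite; they exhaust the space as
    \<open>n\<close> grows, and dominated convergence removes the cut-off.\<close>
  define F where "F = (\<lambda>n. PiE L (\<lambda>_. {- int n..int n}))"
  have F: "finite (F n)" for n
    unfolding F_def using L by (intro finite_PiE) auto
  define g where "g = (\<lambda>\<omega>. w (\<lambda>l. k l \<omega>))"
  have costm: "(\<lambda>\<omega>. cost (\<lambda>l. k l \<omega>)) \<in> borel_measurable M"
    unfolding cost_def by (intro borel_measurable_sum borel_measurable_add borel_measurable_times borel_measurable_abs
      measurable_compose[OF k]) auto
  then have gm[measurable]: "g \<in> borel_measurable M"
    unfolding g_def w_def by (intro measurable_compose[OF _ borel_measurable_exp] borel_measurable_divide borel_measurable_uminus) auto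
  let ?S = "{z \<in> space (M \<Otimes>\<^sub>M M). \<forall>l\<in>L. \<bar>X l (fst z) - X l (snd z)\<bar> \<le> e l}"
  have Sm: "?S \<in> sets (M \<Otimes>\<^sub>M M)"
    using L by measurable
  \<comment> \<open>Codes in \<open>F n\<close> are extensional on \<open>L\<close> while
    \<open>\<lambda>l. k l \<omega>\<close> is not, so the two are compared on \<open>L\<close>
    only.\<close>
  have cong_cost: "cost c = cost d" if "\<And>l. l \<in> L \<Longrightarrow> c l = d l" for c d
    unfolding cost_def using that by (intro sum.cong) auto
  have disj: "c = d" if "c \<in> F n" "d \<in> F n" "\<omega> \<in> E c" "\<omega> \<in> E d" for c d n \<omega>
    using that unfolding F_def E_def by (intro PiE_ext[of c L _ d]) auto
  let ?A = "\<lambda>n. integral\<^sup>L M (\<lambda>\<omega>. g \<omega> * indicator (\<Union>c\<in>F n. E c) \<omega>)"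
  have step: "(?A n)\<^sup>2 \<le> measure (M \<Otimes>\<^sub>M M) ?S" for n
  proof -
    have A: "?A n = (\<Sum>c\<in>F n. w c * p c)"
    proof -
      have "g \<omega> * indicator (\<Union>c\<in>F n. E c) \<omega> = (\<Sum>c\<in>F n. w c * indicator (E c) \<omega>)" if "\<omega> \<in> space M" for \<omega>
      proof (cases "\<exists>c\<in>F n. \<omega> \<in> E c")
        case True
        then obtain c where c: "c \<in> F n" "\<omega> \<in> E c" by blast
        have "(\<Sum>d\<in>F n. w d * indicator (E d) \<omega>) = (\<Sum>d\<in>F n. if d = c then w c else 0)"
          using disj c by (intro sum.cong) (auto simp: indicator_def)
        also have "\<dots> = w c" using F c by simp
        also have "w c = g \<omega>"
          using c(2) unfolding g_def w_def E_def by (simp add: cong_cost[of c "\<lambda>l. k l \<omega>"])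
        finally show ?thesis using c by (auto simp: indicator_def)
      qed (auto simp: indicator_def)
      then have "?A n = integral\<^sup>L M (\<lambda>\<omega>. \<Sum>c\<in>F n. w c * indicator (E c) \<omega>)"
        by (intro Bochner_Integration.integral_cong) auto
      also have "\<dots> = (\<Sum>c\<in>F n. w c * p c)"
        by (subst Bochner_Integration.integral_sum) (auto simp: p_def M.emeasure_finite less_top[symmetric])
      finally show ?thesis .
    qed
    have q: "(\<Sum>c\<in>F n. (w c)\<^sup>2) \<le> 1"
    proof -
      have "(w c)\<^sup>2 = (\<Prod>l\<in>L. exp (- \<theta> l * \<bar>real_of_int (c l)\<bar>) / Z l)" for c
      proof -
        have "(w c)\<^sup>2 = exp (\<Sum>l\<in>L. - (ln (Z l) + \<theta> l * \<bar>real_of_int (c l)\<bar>))"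
          unfolding w_def cost_def sum_negf by (simp add: exp_double[symmetric])
        also have "\<dots> = (\<Prod>l\<in>L. exp (- (ln (Z l) + \<theta> l * \<bar>real_of_int (c l)\<bar>)))"
          using L by (simp add: exp_sum)
        also have "\<dots> = (\<Prod>l\<in>L. exp (- \<theta> l * \<bar>real_of_int (c l)\<bar>) / Z l)"
        proof (rule prod.cong[OF refl])
          fix l assume "l \<in> L"
          from Z[OF this] show "exp (- (ln (Z l) + \<theta> l * \<bar>real_of_int (c l)\<bar>)) = exp (- \<theta> l * \<bar>real_of_int (c l)\<bar>) / Z l"
            by (simp add: exp_diff exp_minus divide_inverse mult_ac)
        qed
        finally show ?thesis .
      qed
      then have "(\<Sum>c\<in>F n. (w c)\<^sup>2) = (\<Prod>l\<in>L. \<Sum>j\<in>{- int n..int n}. exp (- \<theta> l * \<bar>real_of_int j\<bar>) / Z l)"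
        unfolding F_def using L by (simp add: prod_sum_PiE)
      also have "\<dots> \<le> 1"
      proof (rule prod_le_1)
        fix l assume l: "l \<in> L"
        have "(\<Sum>j\<in>{- int n..int n}. exp (- \<theta> l * \<bar>real_of_int j\<bar>)) \<le> Z l"
          unfolding Z_def by (rule sum_exp_abs_le[OF \<theta>[OF l]])
        then show "0 \<le> (\<Sum>j\<in>{- int n..int n}. exp (- \<theta> l * \<bar>real_of_int j\<bar>) / Z l) \<and>
            (\<Sum>j\<in>{- int n..int n}. exp (- \<theta> l * \<bar>real_of_int j\<bar>) / Z l) \<le> 1"
          using Z[OF l] by (auto simp: sum_divide_distrib[symmetric] intro!: sum_nonneg divide_nonneg_nonneg)
      qed
      finally show ?thesis .
    qed
    define A where "A = ?A n"
    have "A\<^sup>2 \<le> (\<Sum>c\<in>F n. (p c)\<^sup>2)"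
    proof -
      \<comment> \<open>Cauchy-Schwarz as the nonnegativity of one square: \<open>A\<close> is the
        inner product of \<open>p\<close> and \<open>w\<close>, and \<open>w\<close> has norm at
        most \<open>1\<close> by \<open>q\<close>.\<close>
      have "0 \<le> (\<Sum>c\<in>F n. (p c - A * w c)\<^sup>2)" by (intro sum_nonneg) auto
      also have "\<dots> = (\<Sum>c\<in>F n. (p c)\<^sup>2) - 2 * A * (\<Sum>c\<in>F n. w c * p c) + A\<^sup>2 * (\<Sum>c\<in>F n. (w c)\<^sup>2)"
        by (simp add: power2_diff sum.distrib sum_subtractf sum_distrib_left algebra_simps)
      also have "\<dots> \<le> (\<Sum>c\<in>F n. (p c)\<^sup>2) - 2 * A * A + A\<^sup>2 * 1"
        using q by (intro add_mono mult_left_mono) (auto simp: A[symmetric] A_def)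
      finally show ?thesis by (simp add: power2_eq_square)
    qed
    also have "(\<Sum>c\<in>F n. (p c)\<^sup>2) = (\<Sum>c\<in>F n. measure (M \<Otimes>\<^sub>M M) (E c \<times> E c))"
      by (intro sum.cong) (auto simp: p_def measure_def M.emeasure_pair_measure_Times enn2real_mult power2_eq_square)
    also have "\<dots> = measure (M \<Otimes>\<^sub>M M) (\<Union>c\<in>F n. E c \<times> E c)"
      using F disj by (intro MM.finite_measure_finite_Union[symmetric]) (auto simp: disjoint_family_on_def)
    also have "\<dots> \<le> measure (M \<Otimes>\<^sub>M M) ?S"
    proof (rule MM.finite_measure_mono[OF _ Sm], safe)
      fix c \<omega> \<omega>' assume *: "c \<in> F n" "\<omega> \<in> E c" "\<omega>' \<in> E c"
      then show "(\<omega>, \<omega>') \<in> space (M \<Otimes>\<^sub>M M)" by (auto simp: E_def space_pair_measure)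
      fix l assume l: "l \<in> L"
      have "round (X l \<omega> / e l) = round (X l \<omega>' / e l)"
        using * l by (auto simp: E_def k_def)
      then have "\<bar>X l \<omega> / e l - X l \<omega>' / e l\<bar> \<le> 1"
        using of_int_round_abs_le[of "X l \<omega> / e l"] of_int_round_abs_le[of "X l \<omega>' / e l"] by linarith
      then have "\<bar>X l \<omega> - X l \<omega>'\<bar> / e l \<le> 1"
        using e[OF l] by (simp add: diff_divide_distrib[symmetric] abs_divide)
      then show "\<bar>X l (fst (\<omega>, \<omega>')) - X l (snd (\<omega>, \<omega>'))\<bar> \<le> e l"
        using e[OF l] by (simp add: divide_le_eq)
    qed
    finally show ?thesis by (simp add: A_def)
  qed
  have "?A \<longlonglongrightarrow> integral\<^sup>L M g"
  proof (rule integral_dominated_convergence[where w="\<lambda>_. 1"])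
    show "AE \<omega> in M. (\<lambda>n. g \<omega> * indicator (\<Union>c\<in>F n. E c) \<omega>) \<longlonglongrightarrow> g \<omega>"
    proof (rule AE_I2)
      fix \<omega> assume \<omega>: "\<omega> \<in> space M"
      define N where "N = (\<Sum>l\<in>L. nat \<bar>k l \<omega>\<bar>)"
      have "\<omega> \<in> (\<Union>c\<in>F n. E c)" if "n \<ge> N" for n
      proof
        show "restrict (\<lambda>l. k l \<omega>) L \<in> F n"
        proof -
          have "nat \<bar>k l \<omega>\<bar> \<le> n" if "l \<in> L" for l
            using member_le_sum[OF that, of "\<lambda>l. nat \<bar>k l \<omega>\<bar>"] L \<open>n \<ge> N\<close> by (simp add: N_def)
          then have "- int n \<le> k l \<omega> \<and> k l \<omega> \<le> int n" if "l \<in> L" for l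
            using that by fastforce
          then show ?thesis by (auto simp: F_def)
        qed
        show "\<omega> \<in> E (restrict (\<lambda>l. k l \<omega>) L)" using \<omega> by (auto simp: E_def)
      qed
      then have "eventually (\<lambda>n. g \<omega> * indicator (\<Union>c\<in>F n. E c) \<omega> = g \<omega>) sequentially"
        by (auto simp: eventually_sequentially intro!: exI[of _ N])
      then show "(\<lambda>n. g \<omega> * indicator (\<Union>c\<in>F n. E c) \<omega>) \<longlonglongrightarrow> g \<omega>"
        by (rule tendsto_eventually)
    qed
  next
    fix n
    show "AE \<omega> in M. norm (g \<omega> * indicator (\<Union>c\<in>F n. E c) \<omega>) \<le> 1"
      using w01 by (auto simp: g_def indicator_def less_imp_le)
    show "(\<lambda>\<omega>. g \<omega> * indicator (\<Union>c\<in>F n. E c) \<omega>) \<in> borel_measurable M"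
      using F by (intro borel_measurable_times gm borel_measurable_indicator sets.finite_UN) auto
  qed auto
  then have "(\<lambda>n. (?A n)\<^sup>2) \<longlonglongrightarrow> (integral\<^sup>L M g)\<^sup>2" by (intro tendsto_power)
  then have sq: "(integral\<^sup>L M g)\<^sup>2 \<le> measure (M \<Otimes>\<^sub>M M) ?S"
    by (rule LIMSEQ_le_const2) (use step in auto)
  have intk: "integrable M (\<lambda>\<omega>. \<bar>real_of_int (k l \<omega>)\<bar>)" if l: "l \<in> L" for l
  proof (rule Bochner_Integration.integrable_bound)
    show "integrable M (\<lambda>\<omega>. 2 * \<bar>X l \<omega> / e l\<bar>)"
      using int[OF l] by (intro integrable_mult_right integrable_abs integrable_divide) auto
    show "AE \<omega> in M. norm \<bar>real_of_int (k l \<omega>)\<bar> \<le> norm (2 * \<bar>X l \<omega> / e l\<bar>)"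
      using abs_round_le by (auto simp: k_def simp del: abs_divide)
    show "(\<lambda>\<omega>. \<bar>real_of_int (k l \<omega>)\<bar>) \<in> borel_measurable M"
      by (intro borel_measurable_abs measurable_compose[OF k[OF l]]) auto
  qed
  have intcost: "integrable M (\<lambda>\<omega>. cost (\<lambda>l. k l \<omega>))"
    unfolding cost_def using intk by (intro Bochner_Integration.integrable_sum) auto
  define m where "m = integral\<^sup>L M (\<lambda>\<omega>. cost (\<lambda>l. k l \<omega>))"
  have m: "m = (\<Sum>l\<in>L. ln (Z l) + \<theta> l * integral\<^sup>L M (\<lambda>\<omega>. \<bar>real_of_int (k l \<omega>)\<bar>))"
    unfolding m_def cost_def using intk
    by (subst Bochner_Integration.integral_sum) (auto simp: M.prob_space intro!: sum.cong)
  \<comment> \<open>Jensen's inequality by integrating the tangent line of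
    \<open>\<lambda>x. exp (- x / 2)\<close> at the mean cost \<open>m\<close>.\<close>
  have "exp (- m / 2) = integral\<^sup>L M (\<lambda>\<omega>. exp (- m / 2) * (1 + m / 2 - cost (\<lambda>l. k l \<omega>) / 2))"
    using intcost by (simp add: m_def M.prob_space)
  also have "\<dots> \<le> integral\<^sup>L M g"
  proof (rule integral_mono)
    show "integrable M (\<lambda>\<omega>. exp (- m / 2) * (1 + m / 2 - cost (\<lambda>l. k l \<omega>) / 2))"
      using intcost by auto
    show "integrable M g"
      by (rule M.integrable_const_bound[where B=1]) (use w01 gm in \<open>auto simp: g_def less_imp_le\<close>)
    fix \<omega>
    let ?c = "cost (\<lambda>l. k l \<omega>)"
    have "exp (- m / 2) * (1 + m / 2 - ?c / 2) \<le> exp (- m / 2) * exp (m / 2 - ?c / 2)"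
      using exp_ge_add_one_self[of "m / 2 - ?c / 2"] by (intro mult_left_mono) (linarith, simp)
    also have "\<dots> = g \<omega>" by (simp add: g_def w_def exp_add[symmetric])
    finally show "exp (- m / 2) * (1 + m / 2 - ?c / 2) \<le> g \<omega>" .
  qed
  finally have "(exp (- m / 2))\<^sup>2 \<le> (integral\<^sup>L M g)\<^sup>2"
    by (intro power_mono) auto
  moreover have "(exp (- m / 2))\<^sup>2 = exp (- m)"
    by (simp add: exp_double[symmetric])
  ultimately have "exp (- m) \<le> measure (M \<Otimes>\<^sub>M M) ?S" using sq by linarith
  then show ?thesis by (simp add: m Z_def k_def)
qed

text \<open>By Fubini, each of the two copies contributes half of the variance, that is a factor
  \<open>exp (- v / 4)\<close>.\<close>

lemma integral_cos_independent_difference: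
  fixes S :: "'a \<Rightarrow> real"
  assumes "prob_space M" and [measurable]: "S \<in> borel_measurable M"
    and ch: "\<And>c \<theta>. integral\<^sup>L M (\<lambda>\<omega>. cos (\<theta> + c * S \<omega>)) = exp (- c\<^sup>2 * v / 2) * cos \<theta>"
  shows "integral\<^sup>L (M \<Otimes>\<^sub>M M) (\<lambda>z. cos (\<theta> + (S (fst z) - S (snd z)) / sqrt 2)) = exp (- v / 2) * cos \<theta>"
proof -
  interpret M: prob_space M by fact
  interpret MM: pair_prob_space M M ..
  have int: "integrable (M \<Otimes>\<^sub>M M) (\<lambda>(\<omega>, \<omega>'). cos (\<theta> + (S \<omega> - S \<omega>') / sqrt 2))"
    by (rule MM.integrable_const_bound[where B=1]) auto
  have "integral\<^sup>L (M \<Otimes>\<^sub>M M) (\<lambda>z. cos (\<theta> + (S (fst z) - S (snd z)) / sqrt 2)) =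
      integral\<^sup>L (M \<Otimes>\<^sub>M M) (\<lambda>(\<omega>, \<omega>'). cos (\<theta> + (S \<omega> - S \<omega>') / sqrt 2))"
    by (simp add: split_beta')
  also have "\<dots> = integral\<^sup>L M (\<lambda>\<omega>. integral\<^sup>L M (\<lambda>\<omega>'. cos (\<theta> + (S \<omega> - S \<omega>') / sqrt 2)))"
    using MM.integral_fst'[OF int] by simp
  also have "\<dots> = integral\<^sup>L M (\<lambda>\<omega>. exp (- v / 4) * cos (\<theta> + (1 / sqrt 2) * S \<omega>))"
  proof (rule Bochner_Integration.integral_cong[OF refl])
    fix \<omega>
    show "integral\<^sup>L M (\<lambda>\<omega>'. cos (\<theta> + (S \<omega> - S \<omega>') / sqrt 2)) = exp (- v / 4) * cos (\<theta> + (1 / sqrt 2) * S \<omega>)"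
      using ch[of "\<theta> + S \<omega> / sqrt 2" "- (1 / sqrt 2)"] by (simp add: diff_divide_distrib power_divide add_diff_eq)
  qed
  also have "\<dots> = exp (- v / 4) * (exp (- v / 4) * cos \<theta>)"
    using ch[of \<theta> "1 / sqrt 2"] by (simp add: power_divide)
  also have "\<dots> = exp (- v / 2) * cos \<theta>"
    by (simp add: exp_add[symmetric] mult.assoc[symmetric])
  finally show ?thesis .
qed

text \<open>Dividing the difference of two copies by \<open>sqrt 2\<close> restores the law of
  \<open>X\<close> and only shrinks the difference, so the tolerances can stay as they are.\<close>

lemma gaussian_box_ge_coincidence:
  fixes X :: "'i \<Rightarrow> 'a \<Rightarrow> real"
  assumes "prob_space M" and L: "finite L"
    and X: "\<And>l. l \<in> L \<Longrightarrow> X l \<in> borel_measurable M"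
    and ch: "\<And>a \<theta>. integral\<^sup>L M (\<lambda>\<omega>. cos (\<theta> + (\<Sum>l\<in>L. a l * X l \<omega>))) =
      exp (- integral\<^sup>L M (\<lambda>\<omega>. (\<Sum>l\<in>L. a l * X l \<omega>)\<^sup>2) / 2) * cos \<theta>"
  shows "measure (M \<Otimes>\<^sub>M M) {z \<in> space (M \<Otimes>\<^sub>M M). \<forall>l\<in>L. \<bar>X l (fst z) - X l (snd z)\<bar> \<le> e l}
    \<le> measure M {\<omega> \<in> space M. \<forall>l\<in>L. \<bar>X l \<omega>\<bar> \<le> e l}"
proof -
  interpret M: prob_space M by fact
  interpret MM: pair_prob_space M M ..
  note [measurable] = X
  let ?Y = "\<lambda>l z. (X l (fst z) - X l (snd z)) / sqrt 2"
  have Y[measurable]: "?Y l \<in> borel_measurable (M \<Otimes>\<^sub>M M)" if "l \<in> L" for l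
    using that by measurable
  have "measure (M \<Otimes>\<^sub>M M) {z \<in> space (M \<Otimes>\<^sub>M M). \<forall>l\<in>L. \<bar>X l (fst z) - X l (snd z)\<bar> \<le> e l}
      \<le> measure (M \<Otimes>\<^sub>M M) {z \<in> space (M \<Otimes>\<^sub>M M). \<forall>l\<in>L. ?Y l z \<in> {- e l..e l}}"
  proof (rule MM.finite_measure_mono)
    show "{z \<in> space (M \<Otimes>\<^sub>M M). \<forall>l\<in>L. ?Y l z \<in> {- e l..e l}} \<in> sets (M \<Otimes>\<^sub>M M)"
      using L by (auto intro!: sets.sets_Collect_finite_All)
    have "\<bar>x / sqrt 2\<bar> \<le> y" if "\<bar>x\<bar> \<le> y" for x y :: real
    proof -
      have "\<bar>x\<bar> \<le> \<bar>x\<bar> * sqrt 2" using mult_left_mono[of 1 "sqrt 2" "\<bar>x\<bar>"] by simp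
      then have "\<bar>x / sqrt 2\<bar> \<le> \<bar>x\<bar>" by (simp add: divide_le_eq)
      then show ?thesis using that by linarith
    qed
    then have "x / sqrt 2 \<le> y \<and> - y \<le> x / sqrt 2" if "\<bar>x\<bar> \<le> y" for x y :: real
      using that by (smt (verit))
    then show "{z \<in> space (M \<Otimes>\<^sub>M M). \<forall>l\<in>L. \<bar>X l (fst z) - X l (snd z)\<bar> \<le> e l} \<subseteq> {z \<in> space (M \<Otimes>\<^sub>M M). \<forall>l\<in>L. ?Y l z \<in> {- e l..e l}}"
      by auto
  qed
  also have "\<dots> = measure M {\<omega> \<in> space M. \<forall>l\<in>L. X l \<omega> \<in> {- e l..e l}}"
  proof (rule measure_box_eq_of_integral_cos_eq[OF MM.prob_space_axioms M.prob_space_axioms L Y X])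
    fix a \<theta>
    let ?S = "\<lambda>\<omega>. \<Sum>l\<in>L. a l * X l \<omega>"
    let ?v = "integral\<^sup>L M (\<lambda>\<omega>. (?S \<omega>)\<^sup>2)"
    have S: "?S \<in> borel_measurable M" by (intro borel_measurable_sum borel_measurable_times) auto
    have ch': "integral\<^sup>L M (\<lambda>\<omega>. cos (\<theta> + c * ?S \<omega>)) = exp (- c\<^sup>2 * ?v / 2) * cos \<theta>" for c \<theta>
      using ch[of \<theta> "\<lambda>l. c * a l"] by (simp add: mult.assoc sum_distrib_left[symmetric] power_mult_distrib)
    have "(\<Sum>l\<in>L. a l * ?Y l z) = (?S (fst z) - ?S (snd z)) / sqrt 2" for z
      by (simp add: sum_subtractf[symmetric] sum_divide_distrib algebra_simps)
    then have "integral\<^sup>L (M \<Otimes>\<^sub>M M) (\<lambda>z. cos (\<theta> + (\<Sum>l\<in>L. a l * ?Y l z))) = exp (- ?v / 2) * cos \<theta>"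
      using integral_cos_independent_difference[OF M.prob_space_axioms S ch', of \<theta>] by simp
    also have "\<dots> = integral\<^sup>L M (\<lambda>\<omega>. cos (\<theta> + (\<Sum>l\<in>L. a l * X l \<omega>)))"
      by (rule ch[symmetric])
    finally show "integral\<^sup>L (M \<Otimes>\<^sub>M M) (\<lambda>z. cos (\<theta> + (\<Sum>l\<in>L. a l * ?Y l z))) = integral\<^sup>L M (\<lambda>\<omega>. cos (\<theta> + (\<Sum>l\<in>L. a l * X l \<omega>)))" .
  qed auto
  also have "{\<omega> \<in> space M. \<forall>l\<in>L. X l \<omega> \<in> {- e l..e l}} = {\<omega> \<in> space M. \<forall>l\<in>L. \<bar>X l \<omega>\<bar> \<le> e l}"
    by (auto simp: abs_le_iff minus_le_iff)
  finally show ?thesis .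
qed

text \<open>Only the terms \<open>0\<close> and \<open>n\<close> of the exponential series are kept;
  \<open>n > 0\<close> makes them distinct.\<close>

lemma exp_minus_one_ge_power:
  fixes x :: real
  assumes "x \<ge> 0" "n > 0"
  shows "x ^ n / fact n \<le> exp x - 1"
proof -
  have "(\<Sum>i\<in>{0, n}. x ^ i / fact i) \<le> (\<Sum>i. x ^ i / fact i)"
    using assms summable_exp[of x] by (intro sum_le_suminf) (auto simp: field_simps)
  then show ?thesis
    using assms by (simp add: exp_def field_simps)
qed

text \<open>The first summand comes from the normaliser of the geometric law, the second from the
  Gaussian moment of order \<open>2 * p\<close>, with \<open>4 ^ p\<close> from the factor
  \<open>2\<close> lost in rounding.\<close>

definition gaussian_code_constant :: "nat \<Rightarrow> real" where
  "gaussian_code_constant p = 2 * fact (2 * p - 1) + 4 ^ p * (fact (2 * p) / (2 ^ p * fact p))"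

text \<open>The coding bound with \<open>\<theta> = 1 / \<rho>\<close>, the scale on which the code
  fluctuates. The minimum covers two regimes: a linear cost suffices when the deviation exceeds the
  tolerance, while for small \<open>\<rho>\<close> the code is mostly \<open>0\<close> and a moment
  of high order makes the cost decay as fast as desired.\<close>

lemma gaussian_box_lower_bound:
  fixes X :: "'i \<Rightarrow> 'a \<Rightarrow> real"
  assumes "prob_space M" and L: "finite L" and p: "p > 0"
    and g: "\<And>a. gaussian_variable M (\<lambda>\<omega>. \<Sum>l\<in>L. a l * X l \<omega>)"
    and g0: "\<And>l. l \<in> L \<Longrightarrow> gaussian_variable M (X l)"
    and mean: "\<And>l. l \<in> L \<Longrightarrow> integral\<^sup>L M (X l) = 0"
    and var: "\<And>l. l \<in> L \<Longrightarrow> integral\<^sup>L M (\<lambda>\<omega>. (X l \<omega>)\<^sup>2) \<le> (\<rho> l * e l)\<^sup>2"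
    and e: "\<And>l. l \<in> L \<Longrightarrow> e l > 0" and \<rho>: "\<And>l. l \<in> L \<Longrightarrow> \<rho> l > 0"
  shows "exp (- (\<Sum>l\<in>L. min (2 + 2 * \<rho> l) (gaussian_code_constant p * \<rho> l ^ (2 * p - 1))))
    \<le> measure M {\<omega> \<in> space M. \<forall>l\<in>L. \<bar>X l \<omega>\<bar> \<le> e l}"
proof -
  interpret M: prob_space M by fact
  have X[measurable]: "X l \<in> borel_measurable M" if "l \<in> L" for l
    using g0[OF that] by (simp add: gaussian_variable_def)
  have int: "integrable M (\<lambda>\<omega>. X l \<omega> ^ k)" if "l \<in> L" for l k
    using gaussian_variable_moment[OF M.prob_space_axioms g0 mean] that by auto
  have int1: "integrable M (X l)" if "l \<in> L" for l
    using int[OF that, of 1] by simp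
  have cost: "ln (1 + 2 / (exp (1 / \<rho> l) - 1)) + (1 / \<rho> l) * integral\<^sup>L M (\<lambda>\<omega>. \<bar>real_of_int (round (X l \<omega> / e l))\<bar>)
      \<le> min (2 + 2 * \<rho> l) (gaussian_code_constant p * \<rho> l ^ (2 * p - 1))" if l: "l \<in> L" for l
  proof -
    note pos = e[OF l] \<rho>[OF l]
    have young: "2 * \<bar>y\<bar> \<le> 1 + y\<^sup>2" for y :: real
      using zero_le_power2[of "\<bar>y\<bar> - 1"] unfolding power2_diff by simp
    let ?R = "\<lambda>\<omega>. \<bar>real_of_int (round (X l \<omega> / e l))\<bar>"
    have Rm: "?R \<in> borel_measurable M"
      using X[OF l] unfolding round_def by measurable
    have lnle: "ln (1 + 2 / (exp (1 / \<rho> l) - 1)) \<le> 2 / (exp (1 / \<rho> l) - 1)"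
      using pos by (intro ln_add_one_self_le_self) auto
    \<comment> \<open>Used with \<open>n = 1\<close> for the linear entry of the minimum and with
      \<open>n = 2 * p - 1\<close> for the other one.\<close>
    have c1: "2 / (exp (1 / \<rho> l) - 1) \<le> 2 * fact n * \<rho> l ^ n" if "n > 0" for n
    proof -
      have "2 / (exp (1 / \<rho> l) - 1) \<le> 2 / ((1 / \<rho> l) ^ n / fact n)"
        using pos that by (intro divide_left_mono exp_minus_one_ge_power mult_pos_pos) auto
      then show ?thesis using pos by (simp add: power_divide mult_ac)
    qed
    have var': "integral\<^sup>L M (\<lambda>\<omega>. (X l \<omega>)\<^sup>2) \<le> (\<rho> l * e l)\<^sup>2" by (rule var[OF l])
    have "(1 / \<rho> l) * integral\<^sup>L M ?R = integral\<^sup>L M (\<lambda>\<omega>. (1 / \<rho> l) * ?R \<omega>)" by simp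
    also have "\<dots> \<le> integral\<^sup>L M (\<lambda>\<omega>. 1 + (X l \<omega>)\<^sup>2 / (\<rho> l * e l)\<^sup>2)"
    proof (rule integral_mono_AE')
      show "integrable M (\<lambda>\<omega>. 1 + (X l \<omega>)\<^sup>2 / (\<rho> l * e l)\<^sup>2)" using int[OF l, of 2] by auto
      have "(1 / \<rho> l) * ?R \<omega> \<le> 1 + (X l \<omega>)\<^sup>2 / (\<rho> l * e l)\<^sup>2" for \<omega>
      proof -
        have "(1 / \<rho> l) * ?R \<omega> \<le> (1 / \<rho> l) * (2 * \<bar>X l \<omega> / e l\<bar>)"
          using pos by (intro mult_left_mono abs_round_le) auto
        also have "\<dots> = 2 * \<bar>X l \<omega> / (\<rho> l * e l)\<bar>"
          using pos by (simp add: abs_divide abs_mult)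
        also have "\<dots> \<le> 1 + (X l \<omega> / (\<rho> l * e l))\<^sup>2"
          by (rule young)
        finally show ?thesis by (simp add: power_divide)
      qed
      then show "AE \<omega> in M. (1 / \<rho> l) * ?R \<omega> \<le> 1 + (X l \<omega>)\<^sup>2 / (\<rho> l * e l)\<^sup>2" by simp
    qed simp
    also have "\<dots> = 1 + integral\<^sup>L M (\<lambda>\<omega>. (X l \<omega>)\<^sup>2) / (\<rho> l * e l)\<^sup>2"
      using int[OF l, of 2] by (simp add: M.prob_space)
    also have "\<dots> \<le> 2"
      using var' pos by (simp add: divide_le_eq)
    finally have b1: "(1 / \<rho> l) * integral\<^sup>L M ?R \<le> 2" .
    have "integral\<^sup>L M ?R \<le> integral\<^sup>L M (\<lambda>\<omega>. (2 / e l) ^ (2 * p) * X l \<omega> ^ (2 * p))"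
    proof (rule integral_mono_AE')
      show "integrable M (\<lambda>\<omega>. (2 / e l) ^ (2 * p) * X l \<omega> ^ (2 * p))" using int[OF l] by auto
      have "?R \<omega> \<le> (2 / e l) ^ (2 * p) * X l \<omega> ^ (2 * p)" for \<omega>
      proof -
        \<comment> \<open>The rounded value is an integer, so it is either \<open>0\<close> or at
          least \<open>1\<close> in modulus and is dominated by its powers.\<close>
        have "?R \<omega> \<le> ?R \<omega> ^ (2 * p)"
        proof (cases "round (X l \<omega> / e l) = 0")
          case False
          then have "1 \<le> ?R \<omega>" by linarith
          then show ?thesis using p self_le_power by force
        qed simp
        also have "\<dots> \<le> (2 * \<bar>X l \<omega> / e l\<bar>) ^ (2 * p)"
          by (intro power_mono abs_round_le) auto
        also have "2 * \<bar>X l \<omega> / e l\<bar> = \<bar>2 / e l * X l \<omega>\<bar>"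
          by (simp add: abs_mult)
        also have "\<bar>2 / e l * X l \<omega>\<bar> ^ (2 * p) = (2 / e l) ^ (2 * p) * X l \<omega> ^ (2 * p)"
          by (subst power_even_abs) (simp, rule power_mult_distrib)
        finally show ?thesis .
      qed
      then show "AE \<omega> in M. ?R \<omega> \<le> (2 / e l) ^ (2 * p) * X l \<omega> ^ (2 * p)" by simp
    qed simp
    also have "\<dots> = (2 / e l) ^ (2 * p) * (fact (2 * p) / (2 ^ p * fact p) * (integral\<^sup>L M (\<lambda>\<omega>. (X l \<omega>)\<^sup>2)) ^ p)"
      using gaussian_variable_even_moment[OF M.prob_space_axioms g0[OF l] mean[OF l], of p] by simp
    also have "\<dots> \<le> (2 / e l) ^ (2 * p) * (fact (2 * p) / (2 ^ p * fact p) * ((\<rho> l * e l)\<^sup>2) ^ p)"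
      using var' pos by (intro mult_left_mono power_mono) auto
    also have "\<dots> = 4 ^ p * (fact (2 * p) / (2 ^ p * fact p)) * \<rho> l ^ (2 * p)"
    proof -
      have "(2 / e l) ^ (2 * p) * ((\<rho> l * e l)\<^sup>2) ^ p = ((2 / e l) * (\<rho> l * e l)) ^ (2 * p)"
        by (simp only: power_mult power_mult_distrib)
      also have "(2 / e l) * (\<rho> l * e l) = 2 * \<rho> l"
        using pos by simp
      also have "(2 * \<rho> l) ^ (2 * p) = 4 ^ p * \<rho> l ^ (2 * p)"
        unfolding power_mult_distrib by (simp add: power_mult)
      finally show ?thesis by (simp add: mult_ac)
    qed
    finally have "(1 / \<rho> l) * integral\<^sup>L M ?R \<le> (1 / \<rho> l) * (4 ^ p * (fact (2 * p) / (2 ^ p * fact p)) * \<rho> l ^ (2 * p))"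
      using pos by (intro mult_left_mono) auto
    also have "\<rho> l ^ (2 * p) = \<rho> l * \<rho> l ^ (2 * p - 1)"
      using p by (simp add: power_eq_if)
    also have "(1 / \<rho> l) * (4 ^ p * (fact (2 * p) / (2 ^ p * fact p)) * (\<rho> l * \<rho> l ^ (2 * p - 1))) =
        4 ^ p * (fact (2 * p) / (2 ^ p * fact p)) * \<rho> l ^ (2 * p - 1)"
      using pos by simp
    finally have b2: "(1 / \<rho> l) * integral\<^sup>L M ?R \<le> 4 ^ p * (fact (2 * p) / (2 ^ p * fact p)) * \<rho> l ^ (2 * p - 1)" .
    show ?thesis
      unfolding gaussian_code_constant_def distrib_right
      using lnle b1 b2 c1[of 1] c1[of "2 * p - 1"] p by (intro min.boundedI) (simp_all add: add_mono)
  qed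
  have ch: "integral\<^sup>L M (\<lambda>\<omega>. cos (\<theta> + (\<Sum>l\<in>L. a l * X l \<omega>))) =
      exp (- integral\<^sup>L M (\<lambda>\<omega>. (\<Sum>l\<in>L. a l * X l \<omega>)\<^sup>2) / 2) * cos \<theta>" for a \<theta>
    using int1 mean by (intro gaussian_variable_cos[OF M.prob_space_axioms g])
      (subst Bochner_Integration.integral_sum; auto)
  have "exp (- (\<Sum>l\<in>L. min (2 + 2 * \<rho> l) (gaussian_code_constant p * \<rho> l ^ (2 * p - 1)))) \<le>
      exp (- (\<Sum>l\<in>L. ln (1 + 2 / (exp (1 / \<rho> l) - 1)) + (1 / \<rho> l) * integral\<^sup>L M (\<lambda>\<omega>. \<bar>real_of_int (round (X l \<omega> / e l))\<bar>)))"
    using cost by (simp add: sum_mono)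
  also have "\<dots> \<le> measure (M \<Otimes>\<^sub>M M) {z \<in> space (M \<Otimes>\<^sub>M M). \<forall>l\<in>L. \<bar>X l (fst z) - X l (snd z)\<bar> \<le> e l}"
    using \<rho> by (intro coincidence_lower_bound[OF M.prob_space_axioms L X int1 e]) auto
  also have "\<dots> \<le> measure M {\<omega> \<in> space M. \<forall>l\<in>L. \<bar>X l \<omega>\<bar> \<le> e l}"
    by (rule gaussian_box_ge_coincidence[OF M.prob_space_axioms L X ch])
  finally show ?thesis .
qed

section \<open>The covariance on a grid\<close>

text \<open>\<open>u powr (- 1 - \<alpha>)\<close> is, up to a constant, the density of the Levy
  measure of the stable subordinator of index \<open>\<alpha>\<close>, whose Laplace exponent is a
  multiple of \<open>x powr \<alpha>\<close>.\<close>

definition levy_integrand :: "real \<Rightarrow> real \<Rightarrow> real \<Rightarrow> real" where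
  "levy_integrand \<alpha> x u = indicator {0<..} u * ((1 - exp (- (x * u))) * u powr (- 1 - \<alpha>))"

lemma mult_of_bool_iff: "of_bool P * x = (if P then x else 0 :: real)"
  by simp

lemma levy_integrand_measurable [measurable]: "levy_integrand \<alpha> x \<in> borel_measurable borel"
  unfolding levy_integrand_def by measurable

lemma has_bochner_integral_powr_tail:
  fixes a \<alpha> :: real
  assumes "a > 0" "\<alpha> > 0"
  shows "has_bochner_integral lborel (\<lambda>u. indicator {a..} u * u powr (- 1 - \<alpha>)) (a powr (- \<alpha>) / \<alpha>)"
proof (rule has_bochner_integral_nn_integral)
  have "((\<lambda>u. u powr (- 1 - \<alpha>)) has_integral - (a powr (- 1 - \<alpha> + 1)) / (- 1 - \<alpha> + 1)) {a..}"
    using assms by (intro has_integral_powr_to_inf) auto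
  then have "((\<lambda>u. indicator {a..} u * u powr (- 1 - \<alpha>)) has_integral (a powr (- \<alpha>) / \<alpha>)) UNIV"
    using assms has_integral_restrict_UNIV[of "{a..}" "\<lambda>u. u powr (- 1 - \<alpha>)"]
    by (simp add: indicator_def mult_of_bool_iff cong: if_cong)
  then show "(\<integral>\<^sup>+u. ennreal (indicator {a..} u * u powr (- 1 - \<alpha>)) \<partial>lborel) = ennreal (a powr (- \<alpha>) / \<alpha>)"
    by (intro nn_integral_has_integral_lborel) auto
qed (use assms in auto)

lemma integrable_powr_near_0:
  fixes \<alpha> :: real
  assumes "\<alpha> < 1"
  shows "integrable lborel (\<lambda>u. indicator {0..1} u * u powr (- \<alpha>))"
proof (rule integrableI_nonneg)
  have "((\<lambda>u. u powr (- \<alpha>)) has_integral (1 powr (- \<alpha> + 1) / (- \<alpha> + 1))) {0..1}"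
    using assms by (intro has_integral_powr_from_0) auto
  then have "((\<lambda>u. indicator {0..1} u * u powr (- \<alpha>)) has_integral (1 / (1 - \<alpha>))) UNIV"
    using assms has_integral_restrict_UNIV[of "{0..1}" "\<lambda>u. u powr (- \<alpha>)"]
    by (simp add: indicator_def mult_of_bool_iff cong: if_cong)
  then have "(\<integral>\<^sup>+u. ennreal (indicator {0..1} u * u powr (- \<alpha>)) \<partial>lborel) = ennreal (1 / (1 - \<alpha>))"
    by (intro nn_integral_has_integral_lborel) auto
  then show "(\<integral>\<^sup>+u. ennreal (indicator {0..1} u * u powr (- \<alpha>)) \<partial>lborel) < \<infinity>" by simp
qed auto

text \<open>Near zero the integrand is at most \<open>x * u powr (- \<alpha>)\<close>, which needs
  \<open>\<alpha> < 1\<close>; at infinity it is at most \<open>u powr (- 1 - \<alpha>)\<close>,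
  which needs \<open>\<alpha> > 0\<close>. With \<open>\<alpha> = 2 * h\<close> the first condition
  is \<open>h < 1 / 2\<close>.\<close>

lemma levy_integrand_integrable:
  assumes "0 < \<alpha>" "\<alpha> < 1" "x \<ge> 0"
  shows "integrable lborel (levy_integrand \<alpha> x)"
proof (rule Bochner_Integration.integrable_bound)
  show "integrable lborel (\<lambda>u. x * (indicator {0..1} u * u powr (- \<alpha>)) + indicator {1..} u * u powr (- 1 - \<alpha>))"
    using has_bochner_integral_powr_tail[of 1 \<alpha>] integrable_powr_near_0[of \<alpha>] assms
    by (auto simp: has_bochner_integral_iff)
  have "norm (levy_integrand \<alpha> x u) \<le> norm (x * (indicator {0..1} u * u powr (- \<alpha>)) + indicator {1..} u * u powr (- 1 - \<alpha>))" for u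
  proof (cases "u > 0")
    case True
    have e: "0 \<le> 1 - exp (- (x * u))" "1 - exp (- (x * u)) \<le> x * u" "1 - exp (- (x * u)) \<le> 1"
      using exp_ge_add_one_self[of "- (x * u)"] assms True by auto
    have "u * u powr (- 1 - \<alpha>) = u powr (- \<alpha>)"
      using True powr_add[of u 1 "- 1 - \<alpha>"] by simp
    then have "(1 - exp (- (x * u))) * u powr (- 1 - \<alpha>) \<le> x * u powr (- \<alpha>)"
      using mult_right_mono[OF e(2), of "u powr (- 1 - \<alpha>)"] by (simp add: mult.assoc)
    moreover have "(1 - exp (- (x * u))) * u powr (- 1 - \<alpha>) \<le> u powr (- 1 - \<alpha>)"
      using mult_right_mono[OF e(3), of "u powr (- 1 - \<alpha>)"] by simp
    moreover have "0 \<le> (1 - exp (- (x * u))) * u powr (- 1 - \<alpha>)" "0 \<le> x * u powr (- \<alpha>)" "0 \<le> u powr (- 1 - \<alpha>)"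
      using e assms by auto
    ultimately show ?thesis
      using True by (auto simp: levy_integrand_def indicator_def)
  qed (auto simp: levy_integrand_def)
  then show "AE u in lborel. norm (levy_integrand \<alpha> x u) \<le> norm (x * (indicator {0..1} u * u powr (- \<alpha>)) + indicator {1..} u * u powr (- 1 - \<alpha>))"
    by simp
qed simp

definition levy_constant :: "real \<Rightarrow> real" where
  "levy_constant \<alpha> = integral\<^sup>L lborel (levy_integrand \<alpha> 1)"

lemma levy_integral:
  assumes "0 < \<alpha>" "x \<ge> 0"
  shows "integral\<^sup>L lborel (levy_integrand \<alpha> x) = levy_constant \<alpha> * x powr \<alpha>"
proof (cases "x = 0")
  case True
  then show ?thesis by (simp add: levy_integrand_def[abs_def])
next
  case False
  with assms have x: "x > 0" by simp
  \<comment> \<open>Scaling the mixing variable by \<open>x\<close> extracts the power of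
    \<open>x\<close> and leaves the constant.\<close>
  have "levy_constant \<alpha> = \<bar>x\<bar> *\<^sub>R integral\<^sup>L lborel (\<lambda>u. levy_integrand \<alpha> 1 (0 + x * u))"
    unfolding levy_constant_def using x by (intro lborel_integral_real_affine) auto
  also have "(\<lambda>u. levy_integrand \<alpha> 1 (0 + x * u)) = (\<lambda>u. x powr (- 1 - \<alpha>) * levy_integrand \<alpha> x u)"
    using x by (auto simp: levy_integrand_def powr_mult indicator_def zero_less_mult_iff fun_eq_iff)
  finally have "levy_constant \<alpha> = x * x powr (- 1 - \<alpha>) * integral\<^sup>L lborel (levy_integrand \<alpha> x)"
    using x by simp
  also have "x * x powr (- 1 - \<alpha>) = x powr (- \<alpha>)"
    using x powr_add[of x 1 "- 1 - \<alpha>"] by simp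
  finally show ?thesis
    using x by (simp add: powr_minus field_simps)
qed

lemma levy_constant_pos:
  assumes "0 < \<alpha>" "\<alpha> < 1"
  shows "levy_constant \<alpha> > 0"
proof -
  let ?g = "\<lambda>u. (1 - exp (- 1)) * (indicator {1..} u * u powr (- 1 - \<alpha>)) :: real"
  have "has_bochner_integral lborel ?g ((1 - exp (- 1)) * (1 powr (- \<alpha>) / \<alpha>))"
    using assms by (intro has_bochner_integral_mult_right has_bochner_integral_powr_tail) auto
  then have g: "integrable lborel ?g" "integral\<^sup>L lborel ?g = (1 - exp (- 1)) * (1 / \<alpha>)"
    by (simp_all add: has_bochner_integral_iff)
  have "integral\<^sup>L lborel ?g \<le> levy_constant \<alpha>"
    unfolding levy_constant_def
    using g(1) levy_integrand_integrable[OF assms, of 1]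
  proof (intro integral_mono)
    fix u :: real
    show "?g u \<le> levy_integrand \<alpha> 1 u"
      by (auto simp: levy_integrand_def indicator_def intro!: mult_right_mono)
  qed auto
  moreover have "0 < (1 - exp (- 1)) * (1 / \<alpha>)"
    using assms by simp
  ultimately show ?thesis using g(2) by linarith
qed

text \<open>A Schur product argument: each point \<open>c\<close> of the universe multiplies the kernel by
  \<open>(1 + x) / 2 + (1 - x) / 2 * s i * s j\<close> with \<open>x = exp (- u)\<close> and signs \<open>s\<close>.\<close>

lemma exp_card_sym_diff_psd:
  fixes S :: "'i \<Rightarrow> 'c set" and a :: "'i \<Rightarrow> real" and u :: real
  assumes "finite U" "u \<ge> 0"
  shows "0 \<le> (\<Sum>i\<in>J. \<Sum>j\<in>J. a i * a j * exp (- (u * card (U \<inter> sym_diff (S i) (S j)))))"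
  using assms(1)
proof (induction U arbitrary: a rule: finite_induct)
  case empty
  have "(\<Sum>i\<in>J. \<Sum>j\<in>J. a i * a j) = (\<Sum>i\<in>J. a i)\<^sup>2"
    by (simp add: power2_eq_square sum_product)
  then show ?case by simp
next
  case (insert c U)
  define x where "x = exp (- u)"
  have x: "0 < x" "x \<le> 1" using assms(2) by (auto simp: x_def)
  define s where "s = (\<lambda>i. if c \<in> S i then 1 else - 1 :: real)"
  have eq: "exp (- (u * card (insert c U \<inter> sym_diff (S i) (S j)))) =
      ((1 + x) / 2 + (1 - x) / 2 * (s i * s j)) * exp (- (u * card (U \<inter> sym_diff (S i) (S j))))" for i j
  proof (cases "c \<in> sym_diff (S i) (S j)")
    case True
    then have "insert c U \<inter> sym_diff (S i) (S j) = insert c (U \<inter> sym_diff (S i) (S j))" by blast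
    then have "card (insert c U \<inter> sym_diff (S i) (S j)) = Suc (card (U \<inter> sym_diff (S i) (S j)))"
      using insert.hyps by simp
    moreover have "s i * s j = - 1" using True by (auto simp: s_def)
    moreover have "exp (- (u * real (Suc n))) = x * exp (- (u * real n))" for n
      by (simp add: x_def exp_add[symmetric] distrib_left)
    moreover have "(1 + x) / 2 + (1 - x) / 2 * - 1 = x" by (simp add: field_simps)
    ultimately show ?thesis by (simp only:)
  next
    case False
    then have "insert c U \<inter> sym_diff (S i) (S j) = U \<inter> sym_diff (S i) (S j)" by blast
    moreover have "s i * s j = 1" using False by (auto simp: s_def)
    moreover have "(1 + x) / 2 + (1 - x) / 2 * 1 = 1" by (simp add: field_simps)
    ultimately show ?thesis by simp
  qed
  \<comment> \<open>The second sum is the form for \<open>U\<close> with coefficients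
    \<open>a i * s i\<close>; this is why the induction is over arbitrary \<open>a\<close>.\<close>
  have "(\<Sum>i\<in>J. \<Sum>j\<in>J. a i * a j * exp (- (u * card (insert c U \<inter> sym_diff (S i) (S j))))) =
      (1 + x) / 2 * (\<Sum>i\<in>J. \<Sum>j\<in>J. a i * a j * exp (- (u * card (U \<inter> sym_diff (S i) (S j))))) +
      (1 - x) / 2 * (\<Sum>i\<in>J. \<Sum>j\<in>J. (a i * s i) * (a j * s j) * exp (- (u * card (U \<inter> sym_diff (S i) (S j)))))"
    unfolding eq sum_distrib_left sum.distrib[symmetric]
    by (intro sum.cong refl) (simp add: algebra_simps)
  also have "\<dots> \<ge> 0"
    using x insert.IH[of a] insert.IH[of "\<lambda>i. a i * s i"] by (intro add_nonneg_nonneg mult_nonneg_nonneg) auto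
  finally show ?case .
qed

text \<open>Gershgorin's argument: the off-diagonal part of each row has mass at most
  \<open>1 / 2\<close>, so by the arithmetic-geometric mean inequality it takes away at most half of
  the diagonal.\<close>

lemma diagonally_dominant_quadratic_form:
  fixes E :: "'i \<Rightarrow> 'i \<Rightarrow> real"
  assumes "finite J" and "\<And>i. i \<in> J \<Longrightarrow> E i i = 1" and sym: "\<And>i j. E i j = E j i" and nn: "\<And>i j. E i j \<ge> 0"
    and row: "\<And>i. i \<in> J \<Longrightarrow> (\<Sum>j\<in>J. E i j) \<le> 3 / 2"
  shows "(\<Sum>i\<in>J. (a i)\<^sup>2) / 2 \<le> (\<Sum>i\<in>J. \<Sum>j\<in>J. a i * a j * E i j)"
proof -
  \<comment> \<open>The doubled diagonal compensates for the diagonal entry contained in the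
    subtracted term, so that complete row sums can be formed.\<close>
  have pt: "(if i = j then 2 * (a i)\<^sup>2 else 0) - ((a i)\<^sup>2 * E i j + (a j)\<^sup>2 * E j i) / 2 \<le> a i * a j * E i j"
    if "i \<in> J" "j \<in> J" for i j
  proof (cases "i = j")
    case True
    then show ?thesis using assms(2)[OF that(1)] by (simp add: power2_eq_square)
  next
    case False
    have "0 \<le> (a i + a j)\<^sup>2 * E i j" using nn by simp
    then have "0 \<le> (a i)\<^sup>2 * E i j + (a j)\<^sup>2 * E i j + 2 * (a i * a j * E i j)"
      by (simp add: power2_sum algebra_simps)
    moreover have "- ((x + y) / 2) \<le> z" if "0 \<le> x + y + 2 * z" for x y z :: real
      using that by (simp add: field_simps)
    ultimately show ?thesis using False sym[of j i] by simp
  qed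
  have "(\<Sum>i\<in>J. (a i)\<^sup>2) / 2 \<le> 2 * (\<Sum>i\<in>J. (a i)\<^sup>2) - (\<Sum>i\<in>J. (a i)\<^sup>2 * (\<Sum>j\<in>J. E i j))"
  proof -
    have "(\<Sum>i\<in>J. (a i)\<^sup>2 * (\<Sum>j\<in>J. E i j)) \<le> (\<Sum>i\<in>J. (a i)\<^sup>2 * (3 / 2))"
      using row by (intro sum_mono mult_left_mono) auto
    also have "\<dots> = (\<Sum>i\<in>J. (a i)\<^sup>2) * (3 / 2)"
      by (rule sum_distrib_right[symmetric])
    finally show ?thesis by linarith
  qed
  also have "\<dots> = (\<Sum>i\<in>J. \<Sum>j\<in>J. (if i = j then 2 * (a i)\<^sup>2 else 0) - ((a i)\<^sup>2 * E i j + (a j)\<^sup>2 * E j i) / 2)"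
  proof -
    have "(\<Sum>i\<in>J. \<Sum>j\<in>J. (a j)\<^sup>2 * E j i) = (\<Sum>i\<in>J. \<Sum>j\<in>J. (a i)\<^sup>2 * E i j)"
      by (rule sum.swap)
    then show ?thesis
      using assms(1) by (simp add: sum_subtractf sum.distrib sum_divide_distrib[symmetric] sum_distrib_left add_divide_distrib)
  qed
  also have "\<dots> \<le> (\<Sum>i\<in>J. \<Sum>j\<in>J. a i * a j * E i j)"
    using pt by (intro sum_mono)
  finally show ?thesis .
qed

text \<open>Writing the power as a mixture, \<open>a0\<close> removes the constant \<open>1\<close>
  and leaves minus a positive semidefinite form for every \<open>u\<close>. The range below
  \<open>u0\<close> is discarded; from \<open>u0\<close> on the form is diagonally dominant, and the
  tail integral of the mixing density produces
  \<open>u0 powr (- \<alpha>) / \<alpha>\<close>.\<close>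

lemma card_sym_diff_powr_negative_type:
  fixes S :: "'i \<Rightarrow> 'c set" and a :: "'i \<Rightarrow> real" and u0 :: real
  assumes J: "finite J" and S: "\<And>i. i \<in> J \<Longrightarrow> finite (S i)" and \<alpha>: "0 < \<alpha>" "\<alpha> < 1" and u0: "u0 > 0"
    and a0: "(\<Sum>i\<in>J. a i) = 0"
    and row: "\<And>i. i \<in> J \<Longrightarrow> (\<Sum>j\<in>J. exp (- (u0 * card (sym_diff (S i) (S j))))) \<le> 3 / 2"
  shows "u0 powr (- \<alpha>) / (2 * \<alpha> * levy_constant \<alpha>) * (\<Sum>i\<in>J. (a i)\<^sup>2)
    \<le> - (\<Sum>i\<in>J. \<Sum>j\<in>J. a i * a j * card (sym_diff (S i) (S j)) powr \<alpha>)"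
proof -
  define d where "d = (\<lambda>i j. real (card (sym_diff (S i) (S j))))"
  let ?E = "\<lambda>u. \<Sum>i\<in>J. \<Sum>j\<in>J. a i * a j * exp (- (u * d i j))"
  define U where "U = (\<Union>i\<in>J. S i)"
  have U: "finite U" unfolding U_def using J S by auto
  have dU: "d i j = card (U \<inter> sym_diff (S i) (S j))" if "i \<in> J" "j \<in> J" for i j
  proof -
    have "U \<inter> sym_diff (S i) (S j) = sym_diff (S i) (S j)" using that by (auto simp: U_def)
    then show ?thesis by (simp add: d_def)
  qed
  have E0: "?E u \<ge> 0" if "u \<ge> 0" for u
    using exp_card_sym_diff_psd[OF U that, where J=J and a=a and S=S] by (simp add: dU)
  have dsym: "d i j = d j i" for i j
    unfolding d_def by (simp add: Un_commute)
  have E1: "(\<Sum>i\<in>J. (a i)\<^sup>2) / 2 \<le> ?E u" if "u \<ge> u0" for u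
  proof (rule diagonally_dominant_quadratic_form[OF J])
    fix i assume i: "i \<in> J"
    have "(\<Sum>j\<in>J. exp (- (u * d i j))) \<le> (\<Sum>j\<in>J. exp (- (u0 * d i j)))"
      using that by (intro sum_mono) (auto simp: d_def intro!: mult_right_mono)
    then show "(\<Sum>j\<in>J. exp (- (u * d i j))) \<le> 3 / 2"
      using row[OF i] by (simp add: d_def)
  qed (auto simp: dsym, simp add: d_def)
  have int: "integrable lborel (levy_integrand \<alpha> (d i j))" for i j
    using levy_integrand_integrable[OF \<alpha>] by (simp add: d_def)
  have sumeq: "- (\<Sum>i\<in>J. \<Sum>j\<in>J. a i * a j * levy_integrand \<alpha> (d i j) u) =
      indicator {0<..} u * u powr (- 1 - \<alpha>) * ?E u" for u
  proof -
    have "(\<Sum>i\<in>J. \<Sum>j\<in>J. a i * a j) = 0"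
      using a0 by (simp add: sum_product[symmetric])
    then have "?E u = - (\<Sum>i\<in>J. \<Sum>j\<in>J. a i * a j * (1 - exp (- (u * d i j))))"
      by (simp add: right_diff_distrib sum_subtractf)
    then show ?thesis
      unfolding levy_integrand_def
      by (simp add: sum_distrib_left mult_ac)
  qed
  have "has_bochner_integral lborel (\<lambda>u. (\<Sum>i\<in>J. (a i)\<^sup>2) / 2 * (indicator {u0..} u * u powr (- 1 - \<alpha>)))
      ((\<Sum>i\<in>J. (a i)\<^sup>2) / 2 * (u0 powr (- \<alpha>) / \<alpha>))"
    using u0 \<alpha> by (intro has_bochner_integral_mult_right has_bochner_integral_powr_tail)
  then have lo: "integrable lborel (\<lambda>u. (\<Sum>i\<in>J. (a i)\<^sup>2) / 2 * (indicator {u0..} u * u powr (- 1 - \<alpha>)))"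
    "integral\<^sup>L lborel (\<lambda>u. (\<Sum>i\<in>J. (a i)\<^sup>2) / 2 * (indicator {u0..} u * u powr (- 1 - \<alpha>))) = (\<Sum>i\<in>J. (a i)\<^sup>2) / 2 * (u0 powr (- \<alpha>) / \<alpha>)"
    unfolding has_bochner_integral_iff by blast+
  have "(\<Sum>i\<in>J. (a i)\<^sup>2) / 2 * (u0 powr (- \<alpha>) / \<alpha>) \<le> integral\<^sup>L lborel (\<lambda>u. - (\<Sum>i\<in>J. \<Sum>j\<in>J. a i * a j * levy_integrand \<alpha> (d i j) u))"
    unfolding lo(2)[symmetric]
  proof (rule integral_mono[OF lo(1)])
    show "integrable lborel (\<lambda>u. - (\<Sum>i\<in>J. \<Sum>j\<in>J. a i * a j * levy_integrand \<alpha> (d i j) u))"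
      using int by (intro integrable_minus Bochner_Integration.integrable_sum integrable_mult_right) auto
    fix u :: real
    show "(\<Sum>i\<in>J. (a i)\<^sup>2) / 2 * (indicator {u0..} u * u powr (- 1 - \<alpha>)) \<le> - (\<Sum>i\<in>J. \<Sum>j\<in>J. a i * a j * levy_integrand \<alpha> (d i j) u)"
      unfolding sumeq
      using E1[of u] E0[of u] u0 mult_right_mono[OF E1[of u], of "u powr (- 1 - \<alpha>)"]
      by (cases "u \<ge> u0"; cases "u > 0") (auto simp: mult_ac)
  qed
  also have "\<dots> = - (\<Sum>i\<in>J. \<Sum>j\<in>J. a i * a j * (levy_constant \<alpha> * d i j powr \<alpha>))"
    using int \<alpha> by (simp add: Bochner_Integration.integral_sum levy_integral d_def)
  also have "\<dots> = levy_constant \<alpha> * - (\<Sum>i\<in>J. \<Sum>j\<in>J. a i * a j * d i j powr \<alpha>)"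
    by (simp add: sum_distrib_left mult_ac)
  finally show ?thesis
    using levy_constant_pos[OF \<alpha>] \<alpha> by (simp add: d_def field_simps)
qed

section \<open>Separation of corner boxes\<close>

text \<open>The cells of the grid contained in the box from the origin to grid point
  \<open>i\<close>: Lebesgue measure becomes a cell count, to which the finite results on symmetric
  differences apply.\<close>

abbreviation corner_box :: "('n \<Rightarrow> nat) \<Rightarrow> ('n \<Rightarrow> nat) set" where
  "corner_box i \<equiv> {c. \<forall>k. c k < i k}"

lemma finite_corner_box [simp]: "finite (corner_box (i :: 'n::finite \<Rightarrow> nat))"
  and card_corner_box: "card (corner_box i) = (\<Prod>k\<in>UNIV. i k)"
proof -
  have "corner_box i = PiE UNIV (\<lambda>k. {..<i k})" by auto
  then show "finite (corner_box i)" "card (corner_box i) = (\<Prod>k\<in>UNIV. i k)"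
    by (simp_all add: finite_PiE card_PiE)
qed

text \<open>Truncating \<open>j\<close> at \<open>m\<close> makes the bound cover the empty box, which behaves like the corner
  \<open>(m, \<dots>, m)\<close> of the grid.\<close>

lemma card_sym_diff_corner_box_ge:
  fixes i j :: "'n::finite \<Rightarrow> nat"
  assumes "\<And>l. m \<le> i l" "j k \<le> i k"
  shows "(i k - max m (j k)) * m ^ (CARD('n) - 1) \<le> card (sym_diff (corner_box i) (corner_box j))"
proof -
  have fin: "finite (sym_diff (corner_box i) (corner_box j))" by simp
  \<comment> \<open>A slab in direction \<open>k\<close>: its cells lie beyond the
    \<open>k\<close>-th side of the box of \<open>j\<close>, and stay below \<open>m\<close> in the
    other directions, hence inside the box of \<open>i\<close>.\<close>
  let ?T = "PiE UNIV (\<lambda>l. if l = k then {max m (j k)..<i k} else {..<m})"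
  have "?T \<subseteq> sym_diff (corner_box i) (corner_box j)"
  proof
    fix c assume "c \<in> ?T"
    then have "c l \<in> (if l = k then {max m (j k)..<i k} else {..<m})" for l by (auto simp: PiE_iff)
    then have c: "c k < i k" "j k \<le> c k" "\<And>l. l \<noteq> k \<Longrightarrow> c l < m"
      by (metis atLeastLessThan_iff max.bounded_iff lessThan_iff)+
    have "c l < i l" for l
      using c(1) c(3)[of l] assms(1)[of l] by (cases "l = k") auto
    moreover have "\<not> c k < j k" using c(2) by simp
    ultimately show "c \<in> sym_diff (corner_box i) (corner_box j)" by blast
  qed
  then have "card ?T \<le> card (sym_diff (corner_box i) (corner_box j))"
    using fin by (rule card_mono[rotated])
  moreover have "card ?T = (i k - max m (j k)) * m ^ (CARD('n) - 1)"
  proof -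
    have "card ?T = (\<Prod>l\<in>UNIV. if l = k then i k - max m (j k) else m)"
      by (subst card_PiE) (auto intro!: prod.cong)
    also have "\<dots> = (i k - max m (j k)) * (\<Prod>l\<in>UNIV - {k}. m)"
      by (subst prod.remove[of UNIV k]) auto
    finally show ?thesis by simp
  qed
  ultimately show ?thesis by simp
qed

lemma sum_exp_dist_le:
  fixes \<theta> :: real and c :: nat
  assumes "\<theta> > 0" "finite Y"
  shows "(\<Sum>y\<in>Y. exp (- \<theta> * \<bar>real c - real y\<bar>)) \<le> 1 + 2 / (exp \<theta> - 1)"
proof -
  define N where "N = c + Max (insert 0 Y)"
  have N: "c \<le> N" "\<And>y. y \<in> Y \<Longrightarrow> y \<le> N"
    using assms(2) by (auto simp: N_def intro: trans_le_add2)
  have "(\<Sum>y\<in>Y. exp (- \<theta> * \<bar>real c - real y\<bar>)) = (\<Sum>x\<in>(\<lambda>y. int c - int y) ` Y. exp (- \<theta> * \<bar>real_of_int x\<bar>))"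
    by (subst sum.reindex) (auto simp: inj_on_def)
  also have "\<dots> \<le> (\<Sum>x\<in>{- int N..int N}. exp (- \<theta> * \<bar>real_of_int x\<bar>))"
  proof (rule sum_mono2)
    show "(\<lambda>y. int c - int y) ` Y \<subseteq> {- int N..int N}" using N by fastforce
  qed auto
  also have "\<dots> \<le> 1 + 2 / (exp \<theta> - 1)" by (rule sum_exp_abs_le[OF assms(1)])
  finally show ?thesis .
qed

text \<open>For the l1 distance the exponential factors over the coordinates, and so does the sum
  once \<open>G\<close> is enlarged to a full cube.\<close>

lemma grid_exp_sum_le:
  fixes c :: "'n::finite \<Rightarrow> nat" and \<theta> :: real
  assumes "\<theta> > 0" "finite G" "\<And>g k. g \<in> G \<Longrightarrow> g k \<le> N"
  shows "(\<Sum>g\<in>G. exp (- \<theta> * (\<Sum>k\<in>UNIV. \<bar>real (c k) - real (g k)\<bar>))) \<le> (1 + 2 / (exp \<theta> - 1)) ^ CARD('n)"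
proof -
  have one: "(\<Sum>y\<in>{..N}. exp (- \<theta> * \<bar>real (c k) - real y\<bar>)) \<le> 1 + 2 / (exp \<theta> - 1)" for k
    by (rule sum_exp_dist_le[OF assms(1)]) simp
  have "(\<Sum>g\<in>G. exp (- \<theta> * (\<Sum>k\<in>UNIV. \<bar>real (c k) - real (g k)\<bar>))) \<le>
      (\<Sum>g\<in>PiE UNIV (\<lambda>_. {..N}). exp (- \<theta> * (\<Sum>k\<in>UNIV. \<bar>real (c k) - real (g k)\<bar>)))"
    using assms(3) by (intro sum_mono2) (auto intro: finite_PiE)
  also have "\<dots> = (\<Sum>g\<in>PiE UNIV (\<lambda>_. {..N}). \<Prod>k\<in>UNIV. exp (- \<theta> * \<bar>real (c k) - real (g k)\<bar>))"
    by (simp add: exp_sum[symmetric] sum_distrib_left sum_negf)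
  also have "\<dots> = (\<Prod>k\<in>UNIV. \<Sum>y\<in>{..N}. exp (- \<theta> * \<bar>real (c k) - real y\<bar>))"
    by (rule prod_sum_PiE[symmetric]) auto
  also have "\<dots> \<le> (\<Prod>k\<in>(UNIV :: 'n set). 1 + 2 / (exp \<theta> - 1))"
    using one by (intro prod_mono) (auto intro!: sum_nonneg)
  also have "\<dots> = (1 + 2 / (exp \<theta> - 1)) ^ CARD('n)" by simp
  finally show ?thesis .
qed

text \<open>Boxes of grid points differ by at least \<open>m ^ (CARD('n) - 1)\<close> cells per unit
  step in a coordinate, so cell counts dominate a multiple of the l1 distance and the row is
  compared with a product of geometric series. Index \<open>\<lambda>_. 0\<close>, the empty box,
  takes part because the origin is adjoined to the grid later.\<close>

lemma corner_box_row_sum_le: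
  fixes i :: "'n::finite \<Rightarrow> nat" and I :: "('n \<Rightarrow> nat) set" and m :: nat
  defines "I \<equiv> {i. \<forall>k. i k \<in> {Suc m..2 * m}}"
  assumes m: "m > 0" and i: "i \<in> insert (\<lambda>_. 0) I"
  shows "(\<Sum>j\<in>insert (\<lambda>_. 0) I. exp (- (CARD('n) * ln (1 + 8 * CARD('n)) / m ^ (CARD('n) - 1) *
      card (sym_diff (corner_box i) (corner_box j))))) \<le> 3 / 2"
proof -
  define \<nu> where "\<nu> = real CARD('n)"
  have \<nu>: "\<nu> \<ge> 1" by (simp add: \<nu>_def Suc_le_eq)
  \<comment> \<open>Chosen so that one coordinate contributes \<open>1 + 1 / (4 * \<nu>)\<close>;
    the product over all coordinates is then at most \<open>exp (1 / 4)\<close>, uniformly in the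
    dimension.\<close>
  define \<theta> where "\<theta> = ln (1 + 8 * \<nu>)"
  have \<theta>: "\<theta> > 0" "exp \<theta> - 1 = 8 * \<nu>" using \<nu> by (auto simp: \<theta>_def)
  define M where "M = real (m ^ (CARD('n) - 1))"
  have M: "M > 0" using m by (simp add: M_def)
  let ?J = "insert (\<lambda>_. 0) I"
  let ?d = "\<lambda>i j :: 'n \<Rightarrow> nat. real (card (sym_diff (corner_box i) (corner_box j)))"
  have fI: "finite I"
  proof -
    have "I \<subseteq> corner_box (\<lambda>_. Suc (2 * m))" by (auto simp: I_def less_Suc_eq_le)
    then show ?thesis by (rule finite_subset) simp
  qed
  \<comment> \<open>Truncation sends the empty box to the corner \<open>(m, ..., m)\<close> and
    fixes \<open>I\<close>. As indices in \<open>I\<close> start at \<open>Suc m\<close>, the image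
    of the origin is a new point and \<open>\<phi>\<close> is injective.\<close>
  define \<phi> where "\<phi> = (\<lambda>(i :: 'n \<Rightarrow> nat) k. max m (i k))"
  have half: "(real (\<phi> i k) - real (\<phi> j k)) * M \<le> ?d i j" if "i \<in> ?J" "j \<in> ?J" for i j k
  proof (cases "\<phi> j k < \<phi> i k")
    case True
    then have "i \<noteq> (\<lambda>_. 0)" by (auto simp: \<phi>_def)
    then have iI: "i \<in> I" using that by auto
    then have ge: "m \<le> i l" for l by (auto simp: I_def Suc_le_eq less_imp_le)
    have "(i k - max m (j k)) * m ^ (CARD('n) - 1) \<le> card (sym_diff (corner_box i) (corner_box j))"
      using True ge[of k] by (intro card_sym_diff_corner_box_ge[OF ge]) (auto simp: \<phi>_def)
    then have "real ((i k - max m (j k)) * m ^ (CARD('n) - 1)) \<le> ?d i j"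
      by (simp only: of_nat_le_iff)
    moreover have "real (i k - max m (j k)) = real (\<phi> i k) - real (\<phi> j k)"
      using True ge[of k] by (simp add: \<phi>_def of_nat_diff max_absorb2)
    ultimately show ?thesis by (simp only: of_nat_mult M_def)
  next
    case False
    then have "(real (\<phi> i k) - real (\<phi> j k)) * M \<le> 0"
      using M by (intro mult_nonpos_nonneg) auto
    then show ?thesis by (rule order_trans) simp
  qed
  \<comment> \<open>\<open>half\<close> bounds each coordinate difference separately; passing to
    their sum costs the factor \<open>\<nu>\<close>.\<close>
  have sep: "(\<Sum>k\<in>UNIV. \<bar>real (\<phi> i k) - real (\<phi> j k)\<bar>) * M \<le> \<nu> * ?d i j" if "i \<in> ?J" "j \<in> ?J" for i j
  proof -
    have "\<bar>real (\<phi> i k) - real (\<phi> j k)\<bar> * M \<le> ?d i j" for k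
      using half[OF that, of k] half[OF that(2,1), of k] by (cases "\<phi> j k \<le> \<phi> i k") (auto simp: Un_commute)
    then have "(\<Sum>k\<in>(UNIV :: 'n set). \<bar>real (\<phi> i k) - real (\<phi> j k)\<bar> * M) \<le> (\<Sum>k\<in>(UNIV :: 'n set). ?d i j)"
      by (intro sum_mono)
    then show ?thesis by (simp add: sum_distrib_right \<nu>_def)
  qed
  have inj: "inj_on \<phi> ?J"
  proof -
    have "\<phi> i = i" "\<exists>k. i k > m" if "i \<in> I" for i
      using that by (fastforce simp: I_def \<phi>_def fun_eq_iff Suc_le_eq)+
    moreover have "\<phi> (\<lambda>_. 0) = (\<lambda>_. m)" by (simp add: \<phi>_def)
    ultimately show ?thesis by (fastforce simp: inj_on_def)
  qed
  have "(\<Sum>j\<in>?J. exp (- (\<nu> * \<theta> / M * ?d i j))) \<le> (\<Sum>j\<in>?J. exp (- \<theta> * (\<Sum>k\<in>UNIV. \<bar>real (\<phi> i k) - real (\<phi> j k)\<bar>)))"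
  proof (rule sum_mono)
    fix j assume "j \<in> ?J"
    from sep[OF i this] have "\<theta> * ((\<Sum>k\<in>UNIV. \<bar>real (\<phi> i k) - real (\<phi> j k)\<bar>) * M) \<le> \<theta> * (\<nu> * ?d i j)"
      using \<theta>(1) by (intro mult_left_mono) auto
    then have "\<theta> * (\<Sum>k\<in>UNIV. \<bar>real (\<phi> i k) - real (\<phi> j k)\<bar>) \<le> \<nu> * \<theta> / M * ?d i j"
      using M by (simp add: pos_le_divide_eq mult_ac)
    then show "exp (- (\<nu> * \<theta> / M * ?d i j)) \<le> exp (- \<theta> * (\<Sum>k\<in>UNIV. \<bar>real (\<phi> i k) - real (\<phi> j k)\<bar>))"
      by simp
  qed
  also have "\<dots> = (\<Sum>g\<in>\<phi> ` ?J. exp (- \<theta> * (\<Sum>k\<in>UNIV. \<bar>real (\<phi> i k) - real (g k)\<bar>)))"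
    using inj by (simp only: sum.reindex o_def)
  also have "\<dots> \<le> (1 + 2 / (exp \<theta> - 1)) ^ CARD('n)"
    using fI i by (intro grid_exp_sum_le[where N="2 * m"] \<theta>(1)) (auto simp: \<phi>_def I_def)
  also have "\<dots> = (1 + 1 / (4 * \<nu>)) ^ CARD('n)" unfolding \<theta>(2) by simp
  also have "\<dots> \<le> exp (1 / (4 * \<nu>)) ^ CARD('n)"
    using \<nu> by (intro power_mono exp_ge_add_one_self) auto
  also have "\<dots> = exp (1 / 4)"
    by (simp add: exp_of_nat_mult[symmetric] \<nu>_def)
  also have "\<dots> \<le> 3 / 2"
    using exp_bound[of "1 / 4"] by (simp add: power2_eq_square)
  finally show ?thesis by (simp add: \<nu>_def \<theta>_def M_def)
qed

section \<open>From Lebesgue measure to cell counts\<close>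

lemma measure_corner_cbox:
  fixes x :: "real ^ 'n"
  assumes "x \<in> nonneg_orthant"
  shows "measure lborel (cbox 0 x) = (\<Prod>k\<in>UNIV. x $ k)"
proof -
  have "cbox 0 x \<noteq> {}"
    using assms by (auto simp: nonneg_orthant_def interval_ne_empty_cart)
  then show ?thesis by (simp add: content_cbox_cart)
qed

text \<open>Kept for a general measure because it is used for \<open>lborel\<close> as well as for
  the counting measure.\<close>

lemma measure_sym_diff:
  assumes "A \<in> fmeasurable M" "B \<in> fmeasurable M"
  shows "measure M (sym_diff A B) = measure M A + measure M B - 2 * measure M (A \<inter> B)"
proof -
  have A: "measure M A = measure M (A - B) + measure M (A \<inter> B)"
  proof -
    have "A = (A - B) \<union> (A \<inter> B)" by blast
    then have "measure M A = measure M ((A - B) \<union> (A \<inter> B))" by simp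
    also have "\<dots> = measure M (A - B) + measure M (A \<inter> B)"
      using assms by (intro measure_Un_AE) (auto intro: fmeasurable.Int)
    finally show ?thesis .
  qed
  have B: "measure M B = measure M (B - A) + measure M (A \<inter> B)"
  proof -
    have "B = (B - A) \<union> (A \<inter> B)" by blast
    then have "measure M B = measure M ((B - A) \<union> (A \<inter> B))" by simp
    also have "\<dots> = measure M (B - A) + measure M (A \<inter> B)"
      using assms by (intro measure_Un_AE) (auto intro: fmeasurable.Int)
    finally show ?thesis .
  qed
  have "measure M (sym_diff A B) = measure M (A - B) + measure M (B - A)"
    using assms by (intro measure_Un_AE) auto
  then show ?thesis using A B by simp
qed

lemma measure_sym_diff_corner_cbox:
  fixes x y :: "real ^ 'n"
  assumes "x \<in> nonneg_orthant" "y \<in> nonneg_orthant"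
  shows "measure lborel (sym_diff (cbox 0 x) (cbox 0 y)) =
    (\<Prod>k\<in>UNIV. x $ k) + (\<Prod>k\<in>UNIV. y $ k) - 2 * (\<Prod>k\<in>UNIV. min (x $ k) (y $ k))"
proof -
  have "cbox 0 x \<inter> cbox 0 y = cbox 0 (\<chi> k. min (x $ k) (y $ k))"
    by (auto simp: mem_box_cart)
  moreover have "(\<chi> k. min (x $ k) (y $ k)) \<in> nonneg_orthant"
    using assms by (auto simp: nonneg_orthant_def)
  ultimately show ?thesis
    using assms by (subst measure_sym_diff) (auto simp: measure_corner_cbox)
qed

definition grid_point :: "real \<Rightarrow> ('n::finite \<Rightarrow> nat) \<Rightarrow> real ^ 'n" where
  "grid_point \<delta> i = (\<chi> k. \<delta> * real (i k))"

lemma grid_point_nonneg: "\<delta> \<ge> 0 \<Longrightarrow> grid_point \<delta> i \<in> nonneg_orthant"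
  by (simp add: grid_point_def nonneg_orthant_def)

text \<open>Volume and cell count obey the same inclusion-exclusion formula, with products of side
  lengths and of minima, and each product scales by \<open>\<delta> ^ CARD('n)\<close>.\<close>

lemma measure_sym_diff_grid_point:
  fixes i j :: "'n::finite \<Rightarrow> nat"
  assumes "\<delta> \<ge> 0"
  shows "measure lborel (sym_diff (cbox 0 (grid_point \<delta> i)) (cbox 0 (grid_point \<delta> j))) =
    \<delta> ^ CARD('n) * card (sym_diff (corner_box i) (corner_box j))"
proof -
  have fm: "corner_box i \<in> fmeasurable (count_space UNIV)" for i :: "'n \<Rightarrow> nat"
    by (rule fmeasurableI) (auto simp: emeasure_count_space_finite of_nat_less_top)
  have int: "corner_box i \<inter> corner_box j = corner_box (\<lambda>k. min (i k) (j k))" by auto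
  have "real (card (sym_diff (corner_box i) (corner_box j))) =
      real (card (corner_box i)) + real (card (corner_box j)) - 2 * real (card (corner_box i \<inter> corner_box j))"
    using measure_sym_diff[OF fm fm, of i j] by (simp add: measure_count_space)
  then have "real (card (sym_diff (corner_box i) (corner_box j))) =
      (\<Prod>k\<in>UNIV. real (i k)) + (\<Prod>k\<in>UNIV. real (j k)) - 2 * (\<Prod>k\<in>UNIV. real (min (i k) (j k)))"
    unfolding int card_corner_box of_nat_prod .
  moreover have "(\<Prod>k\<in>UNIV. min (\<delta> * real (i k)) (\<delta> * real (j k))) = \<delta> ^ CARD('n) * (\<Prod>k\<in>UNIV. real (min (i k) (j k)))"
  proof -
    have "min (\<delta> * x) (\<delta> * y) = \<delta> * min x y" for x y :: real
      using assms by (auto simp: min_def mult_le_cancel_left)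
    then show ?thesis by (simp only: prod.distrib of_nat_min) simp
  qed
  ultimately show ?thesis
    unfolding measure_sym_diff_corner_cbox[OF grid_point_nonneg[OF assms] grid_point_nonneg[OF assms]]
    by (simp add: grid_point_def prod.distrib right_diff_distrib distrib_left del: of_nat_min)
qed

lemma mfbm_kernel_grid_point:
  fixes i j :: "'n::finite \<Rightarrow> nat"
  assumes "\<delta> \<ge> 0"
  shows "mfbm_kernel h (grid_point \<delta> i) (grid_point \<delta> j) = (\<delta> ^ CARD('n)) powr (2 * h) *
    (card (corner_box i) powr (2 * h) + card (corner_box j) powr (2 * h)
      - card (sym_diff (corner_box i) (corner_box j)) powr (2 * h)) / 2"
proof -
  have m: "measure lborel (cbox 0 (grid_point \<delta> i)) = \<delta> ^ CARD('n) * card (corner_box i)" for i :: "'n \<Rightarrow> nat"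
    using assms by (simp add: measure_corner_cbox grid_point_nonneg card_corner_box) (simp add: grid_point_def prod.distrib)
  show ?thesis
    unfolding mfbm_kernel_def m measure_sym_diff_grid_point[OF assms]
    using assms by (simp add: powr_mult algebra_simps)
qed

text \<open>The kernel is the negative-type form anchored at the origin: the terms that pair a box
  with the empty box supply its two volume terms. In the constant, \<open>8 * h\<close> is
  \<open>2 * \<alpha>\<close> with \<open>\<alpha> = 2 * h\<close>, doubled by the factor
  \<open>1 / 2\<close> in the kernel.\<close>

lemma mfbm_kernel_grid_quadratic_form_ge:
  fixes a :: "('n::finite \<Rightarrow> nat) \<Rightarrow> real" and I :: "('n \<Rightarrow> nat) set" and h \<delta> :: real and m :: nat
  defines "I \<equiv> {i. \<forall>k. i k \<in> {Suc m..2 * m}}"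
  assumes h: "0 < h" "h < 1 / 2" and m: "m > 0" and \<delta>: "\<delta> \<ge> 0"
  shows "(CARD('n) * ln (1 + 8 * CARD('n))) powr (- 2 * h) / (8 * h * levy_constant (2 * h)) *
      (\<delta> ^ CARD('n) * real m ^ (CARD('n) - 1)) powr (2 * h) * (\<Sum>i\<in>I. (a i)\<^sup>2)
    \<le> (\<Sum>i\<in>I. \<Sum>j\<in>I. a i * a j * mfbm_kernel h (grid_point \<delta> i) (grid_point \<delta> j))"
proof -
  define o' where "o' = (\<lambda>_ :: 'n. 0 :: nat)"
  define D where "D = (\<lambda>i j :: 'n \<Rightarrow> nat. card (sym_diff (corner_box i) (corner_box j)) powr (2 * h))"
  define P where "P = (\<lambda>i :: 'n \<Rightarrow> nat. card (corner_box i) powr (2 * h))"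
  have fI: "finite I"
  proof -
    have "I \<subseteq> corner_box (\<lambda>_. Suc (2 * m))" by (auto simp: I_def less_Suc_eq_le)
    then show ?thesis by (rule finite_subset) simp
  qed
  have oI: "o' \<notin> I" by (auto simp: I_def o'_def)
  \<comment> \<open>The origin receives the coefficient that makes the total zero, as negative type
    requires.\<close>
  define b where "b = a(o' := - (\<Sum>i\<in>I. a i))"
  have b: "b i = a i" if "i \<in> I" for i using oI that by (auto simp: b_def)
  have b0: "b o' = - (\<Sum>i\<in>I. a i)" by (simp add: b_def)
  define u0 where "u0 = CARD('n) * ln (1 + 8 * CARD('n)) / m ^ (CARD('n) - 1)"
  have u0: "u0 > 0" using m by (simp add: u0_def)
  have b_sum: "(\<Sum>i\<in>insert o' I. b i) = 0"
    using fI oI b b0 by simp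
  have *: "u0 powr (- (2 * h)) / (2 * (2 * h) * levy_constant (2 * h)) * (\<Sum>i\<in>insert o' I. (b i)\<^sup>2)
    \<le> - (\<Sum>i\<in>insert o' I. \<Sum>j\<in>insert o' I. b i * b j * D i j)"
    unfolding D_def
  proof (rule card_sym_diff_powr_negative_type)
    fix i assume "i \<in> insert o' I"
    then show "(\<Sum>j\<in>insert o' I. exp (- (u0 * card (sym_diff (corner_box i) (corner_box j))))) \<le> 3 / 2"
      using corner_box_row_sum_le[OF m, of i] unfolding u0_def o'_def I_def by simp
  qed (use h u0 fI b_sum in auto)
  have Do: "D o' j = P j" "D j o' = P j" "P o' = 0" for j
    by (auto simp: D_def P_def o'_def)
  have "(\<Sum>i\<in>insert o' I. \<Sum>j\<in>insert o' I. b i * b j * D i j) =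
      (\<Sum>j\<in>I. b o' * a j * P j) + (\<Sum>i\<in>I. b o' * a i * P i + (\<Sum>j\<in>I. a i * a j * D i j))"
    using fI oI b by (simp add: Do mult_ac)
  also have "\<dots> = (\<Sum>i\<in>I. \<Sum>j\<in>I. a i * a j * D i j) + 2 * (b o' * (\<Sum>i\<in>I. a i * P i))"
    by (simp add: sum.distrib sum_distrib_left mult_ac)
  also have "b o' * (\<Sum>i\<in>I. a i * P i) = - (\<Sum>i\<in>I. \<Sum>j\<in>I. a i * a j * P j)"
    unfolding b0 by (simp add: sum_product mult_ac)
  finally have 1: "- (\<Sum>i\<in>insert o' I. \<Sum>j\<in>insert o' I. b i * b j * D i j) =
      2 * (\<Sum>i\<in>I. \<Sum>j\<in>I. a i * a j * P j) - (\<Sum>i\<in>I. \<Sum>j\<in>I. a i * a j * D i j)" by simp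
  have "(\<Sum>i\<in>I. \<Sum>j\<in>I. a i * a j * P i) = (\<Sum>i\<in>I. \<Sum>j\<in>I. a i * a j * P j)"
    by (subst sum.swap) (simp add: mult_ac)
  then have 2: "- (\<Sum>i\<in>insert o' I. \<Sum>j\<in>insert o' I. b i * b j * D i j) = (\<Sum>i\<in>I. \<Sum>j\<in>I. a i * a j * (P i + P j - D i j))"
    unfolding 1 by (simp add: sum.distrib sum_subtractf right_diff_distrib distrib_left)
  define q where "q = (\<delta> ^ CARD('n)) powr (2 * h) / 2"
  have q: "q \<ge> 0" by (simp add: q_def)
  have kern: "(\<Sum>i\<in>I. \<Sum>j\<in>I. a i * a j * mfbm_kernel h (grid_point \<delta> i) (grid_point \<delta> j)) = q * (\<Sum>i\<in>I. \<Sum>j\<in>I. a i * a j * (P i + P j - D i j))"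
    unfolding mfbm_kernel_grid_point[OF \<delta>] by (simp add: q_def P_def D_def sum_distrib_left mult_ac)
  have "(\<Sum>i\<in>I. (a i)\<^sup>2) = (\<Sum>i\<in>I. (b i)\<^sup>2)" using b by simp
  also have "\<dots> \<le> (\<Sum>i\<in>insert o' I. (b i)\<^sup>2)" using fI by (intro sum_mono2) auto
  finally have "u0 powr (- (2 * h)) / (2 * (2 * h) * levy_constant (2 * h)) * (\<Sum>i\<in>I. (a i)\<^sup>2) \<le> (\<Sum>i\<in>I. \<Sum>j\<in>I. a i * a j * (P i + P j - D i j))"
    using * levy_constant_pos[of "2 * h"] h unfolding 2 by (elim order_trans[rotated]) (intro mult_left_mono; auto)
  then have "q * (u0 powr (- (2 * h)) / (2 * (2 * h) * levy_constant (2 * h)) * (\<Sum>i\<in>I. (a i)\<^sup>2)) \<le> q * (\<Sum>i\<in>I. \<Sum>j\<in>I. a i * a j * (P i + P j - D i j))"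
    using q by (rule mult_left_mono)
  moreover have "u0 powr (- (2 * h)) = (CARD('n) * ln (1 + 8 * CARD('n))) powr (- 2 * h) * (real m ^ (CARD('n) - 1)) powr (2 * h)"
    using m unfolding u0_def by (subst powr_divide) (auto simp: powr_minus field_simps)
  moreover have "(\<delta> ^ CARD('n) * real m ^ (CARD('n) - 1)) powr (2 * h) = 2 * q * (real m ^ (CARD('n) - 1)) powr (2 * h)"
    using \<delta> by (simp add: q_def powr_mult)
  ultimately show ?thesis
    unfolding kern by (simp add: field_simps)
qed

section \<open>Upper bound for the process\<close>

text \<open>The process is specified through sums over sets of points. Indexed families may repeat
  points, as happens when tree links share endpoints, so coefficients belonging to the same point
  are first collected.\<close>

lemma multiparameter_fbm_linear_combination:
  fixes B :: "real ^ 'n \<Rightarrow> 'w \<Rightarrow> real" and t :: "'i \<Rightarrow> real ^ 'n"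
  assumes fbm: "multiparameter_fbm M h B" and I: "finite I" and t: "\<And>i. i \<in> I \<Longrightarrow> t i \<in> nonneg_orthant"
  shows fbm_gaussian: "gaussian_variable M (\<lambda>\<omega>. \<Sum>i\<in>I. a i * B (t i) \<omega>)"
    and fbm_mean: "integral\<^sup>L M (\<lambda>\<omega>. \<Sum>i\<in>I. a i * B (t i) \<omega>) = 0"
    and fbm_variance: "integral\<^sup>L M (\<lambda>\<omega>. (\<Sum>i\<in>I. a i * B (t i) \<omega>)\<^sup>2) =
      (\<Sum>i\<in>I. \<Sum>j\<in>I. a i * a j * mfbm_kernel h (t i) (t j))"
proof -
  have cgp: "centred_gaussian_process M nonneg_orthant B"
    and cov: "\<And>s t. s \<in> nonneg_orthant \<Longrightarrow> t \<in> nonneg_orthant \<Longrightarrow> integral\<^sup>L M (\<lambda>\<omega>. B s \<omega> * B t \<omega>) = mfbm_kernel h s t"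
    using fbm by (auto simp: multiparameter_fbm_def)
  have M: "prob_space M"
    and lin: "\<And>S a. finite S \<Longrightarrow> S \<subseteq> nonneg_orthant \<Longrightarrow> gaussian_variable M (\<lambda>\<omega>. \<Sum>t\<in>S. a t * B t \<omega>)"
    and mean: "\<And>t. t \<in> nonneg_orthant \<Longrightarrow> integral\<^sup>L M (B t) = 0"
    using cgp by (auto simp: centred_gaussian_process_def)
  have single: "gaussian_variable M (B s)" if "s \<in> nonneg_orthant" for s
    using lin[of "{s}" "\<lambda>_. 1"] that by simp
  have meas: "B s \<in> borel_measurable M" if "s \<in> nonneg_orthant" for s
    using single[OF that] by (simp add: gaussian_variable_def)
  have int1: "integrable M (B s)" if "s \<in> nonneg_orthant" for s
    using gaussian_variable_moment[OF M single[OF that] mean[OF that], of 1] by simp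
  have int2: "integrable M (\<lambda>\<omega>. B s \<omega> * B u \<omega>)" if "s \<in> nonneg_orthant" "u \<in> nonneg_orthant" for s u
  proof (rule Bochner_Integration.integrable_bound)
    show "integrable M (\<lambda>\<omega>. (B s \<omega>)\<^sup>2 + (B u \<omega>)\<^sup>2)"
      using gaussian_variable_moment[OF M single[OF that(1)] mean[OF that(1)], of 2]
        gaussian_variable_moment[OF M single[OF that(2)] mean[OF that(2)], of 2] by auto
    have "\<bar>x * y\<bar> \<le> x\<^sup>2 + y\<^sup>2" for x y :: real
    proof -
      have "0 \<le> \<bar>x\<bar> * \<bar>y\<bar>" by simp
      then have "\<bar>x\<bar> * \<bar>y\<bar> \<le> \<bar>x\<bar>\<^sup>2 + \<bar>y\<bar>\<^sup>2"
        using sum_squares_bound[of "\<bar>x\<bar>" "\<bar>y\<bar>"] by linarith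
      then show ?thesis by (simp add: abs_mult)
    qed
    then show "AE \<omega> in M. norm (B s \<omega> * B u \<omega>) \<le> norm ((B s \<omega>)\<^sup>2 + (B u \<omega>)\<^sup>2)" by simp
    show "(\<lambda>\<omega>. B s \<omega> * B u \<omega>) \<in> borel_measurable M"
      using meas that by auto
  qed
  have "(\<Sum>i\<in>I. a i * B (t i) \<omega>) = (\<Sum>s\<in>t ` I. (\<Sum>i\<in>{i \<in> I. t i = s}. a i) * B s \<omega>)" for \<omega>
    by (subst sum.image_gen[OF I, of _ t]) (auto simp: sum_distrib_right intro!: sum.cong)
  then show "gaussian_variable M (\<lambda>\<omega>. \<Sum>i\<in>I. a i * B (t i) \<omega>)"
    using lin[of "t ` I" "\<lambda>s. \<Sum>i\<in>{i \<in> I. t i = s}. a i"] I t by auto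
  show "integral\<^sup>L M (\<lambda>\<omega>. \<Sum>i\<in>I. a i * B (t i) \<omega>) = 0"
    using t int1 mean by (subst Bochner_Integration.integral_sum) auto
  have "(\<Sum>i\<in>I. a i * B (t i) \<omega>)\<^sup>2 = (\<Sum>i\<in>I. \<Sum>j\<in>I. (a i * a j) * (B (t i) \<omega> * B (t j) \<omega>))" for \<omega>
    by (simp add: power2_eq_square sum_product mult_ac)
  then show "integral\<^sup>L M (\<lambda>\<omega>. (\<Sum>i\<in>I. a i * B (t i) \<omega>)\<^sup>2) =
      (\<Sum>i\<in>I. \<Sum>j\<in>I. a i * a j * mfbm_kernel h (t i) (t j))"
    using t int2 cov by (simp add: Bochner_Integration.integral_sum)
qed

text \<open>The sum type \<open>I <+> I\<close> lists starting points and end points of the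
  increments in one family.\<close>

lemma multiparameter_fbm_increments:
  fixes B :: "real ^ 'n \<Rightarrow> 'w \<Rightarrow> real" and p q :: "'i \<Rightarrow> real ^ 'n"
  assumes fbm: "multiparameter_fbm M h B" and I: "finite I"
    and p: "\<And>i. i \<in> I \<Longrightarrow> p i \<in> nonneg_orthant" and q: "\<And>i. i \<in> I \<Longrightarrow> q i \<in> nonneg_orthant"
  shows "gaussian_variable M (\<lambda>\<omega>. \<Sum>i\<in>I. a i * (B (p i) \<omega> - B (q i) \<omega>))"
proof -
  have "(\<Sum>i\<in>I. a i * (B (p i) \<omega> - B (q i) \<omega>)) = (\<Sum>i\<in>I <+> I. case_sum a (\<lambda>i. - a i) i * B (case_sum p q i) \<omega>)" for \<omega>
    using I by (simp add: sum.Plus right_diff_distrib sum_subtractf sum_negf)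
  moreover have "gaussian_variable M (\<lambda>\<omega>. \<Sum>i\<in>I <+> I. case_sum a (\<lambda>i. - a i) i * B (case_sum p q i) \<omega>)"
    by (rule fbm_gaussian[OF fbm]) (use I p q in auto)
  ultimately show ?thesis by simp
qed

lemma fbm_increment_variance:
  fixes B :: "real ^ 'n \<Rightarrow> 'w \<Rightarrow> real"
  assumes fbm: "multiparameter_fbm M h B" and "s \<in> nonneg_orthant" "t \<in> nonneg_orthant"
  shows "gaussian_variable M (\<lambda>\<omega>. B s \<omega> - B t \<omega>)"
    and "integral\<^sup>L M (\<lambda>\<omega>. B s \<omega> - B t \<omega>) = 0"
    and "integral\<^sup>L M (\<lambda>\<omega>. (B s \<omega> - B t \<omega>)\<^sup>2) = measure lborel (sym_diff (cbox 0 s) (cbox 0 t)) powr (2 * h)"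
proof -
  let ?t = "\<lambda>b. if b then s else t" and ?a = "\<lambda>b. if b then 1 else - 1 :: real"
  have t: "?t b \<in> nonneg_orthant" for b using assms by simp
  have fin: "finite (UNIV :: bool set)" by simp
  have eq: "(\<Sum>b\<in>UNIV. ?a b * B (?t b) \<omega>) = B s \<omega> - B t \<omega>" for \<omega>
    by (simp add: UNIV_bool)
  show "gaussian_variable M (\<lambda>\<omega>. B s \<omega> - B t \<omega>)"
    using fbm_gaussian[OF fbm fin, where t="?t" and a="?a", OF t] unfolding eq .
  show "integral\<^sup>L M (\<lambda>\<omega>. B s \<omega> - B t \<omega>) = 0"
    using fbm_mean[OF fbm fin, where t="?t" and a="?a", OF t] unfolding eq .
  show "integral\<^sup>L M (\<lambda>\<omega>. (B s \<omega> - B t \<omega>)\<^sup>2) = measure lborel (sym_diff (cbox 0 s) (cbox 0 t)) powr (2 * h)"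
    using fbm_variance[OF fbm fin, where t="?t" and a="?a", OF t] unfolding eq
    by (simp add: UNIV_bool mfbm_kernel_def Un_commute add_divide_distrib diff_divide_distrib)
qed

text \<open>A real supremum bounds its members only when the set is bounded; continuity on the
  compact cube provides this for each path.\<close>

lemma fbm_bdd_above:
  fixes B :: "real ^ 'n \<Rightarrow> 'w \<Rightarrow> real"
  assumes fbm: "multiparameter_fbm M h B" and "\<omega> \<in> space M"
  shows "bdd_above ((\<lambda>t. \<bar>B t \<omega>\<bar>) ` cbox 0 (\<chi> i. r))"
proof -
  have "continuous_on nonneg_orthant (\<lambda>t. B t \<omega>)"
    using assms by (simp add: multiparameter_fbm_def)
  moreover have "cbox 0 (\<chi> i. r) \<subseteq> (nonneg_orthant :: (real ^ 'n) set)"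
    by (auto simp: nonneg_orthant_def mem_box_cart)
  ultimately have "continuous_on (cbox 0 (\<chi> i. r)) (\<lambda>t. \<bar>B t \<omega>\<bar>)"
    by (intro continuous_on_rabs) (rule continuous_on_subset)
  then show ?thesis
    by (intro bounded_imp_bdd_above compact_imp_bounded compact_continuous_image) auto
qed

lemma fbm_small_ball_grid_bound:
  fixes B :: "real ^ 'n \<Rightarrow> 'w \<Rightarrow> real" and m :: nat and r \<epsilon> :: real
  assumes h: "0 < h" "h < 1 / 2" and fbm: "multiparameter_fbm M h B"
    and r: "r > 0" and m: "m > 0" and \<epsilon>: "\<epsilon> > 0"
  defines "c \<equiv> (CARD('n) * ln (1 + 8 * CARD('n))) powr (- 2 * h) / (8 * h * levy_constant (2 * h)) * (1 / 2 ^ CARD('n)) powr (2 * h)"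
  shows "measure M {\<omega> \<in> space M. (SUP t\<in>cbox 0 (\<chi> i. r). \<bar>B t \<omega>\<bar>) \<le> \<epsilon>}
    \<le> (exp (1 / 2) / sqrt (1 + c * (r ^ CARD('n) / m) powr (2 * h) / \<epsilon>\<^sup>2)) ^ (m ^ CARD('n))"
proof -
  have M: "prob_space M" using fbm by (simp add: multiparameter_fbm_def centred_gaussian_process_def)
  interpret prob_space M by fact
  define I where "I = {i :: 'n \<Rightarrow> nat. \<forall>k. i k \<in> {Suc m..2 * m}}"
  have I_PiE: "I = PiE UNIV (\<lambda>_. {Suc m..2 * m})" by (auto simp: I_def PiE_iff)
  have I: "finite I" "card I = m ^ CARD('n)"
    unfolding I_PiE by (auto simp: card_PiE intro!: finite_PiE)
  \<comment> \<open>With indices from \<open>m + 1\<close> to \<open>2 * m\<close> the grid fills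
    the upper half of each side, where box volumes change at full rate.\<close>
  define \<delta> where "\<delta> = r / (2 * m)"
  have \<delta>: "\<delta> > 0" using r m by (simp add: \<delta>_def)
  have gp: "grid_point \<delta> i \<in> nonneg_orthant" for i :: "'n \<Rightarrow> nat"
    using \<delta> by (intro grid_point_nonneg) auto
  have meas: "B (grid_point \<delta> i) \<in> borel_measurable M" for i
    using fbm_gaussian[OF fbm, of "{i}" "grid_point \<delta>" "\<lambda>_. 1"] gp by (simp add: gaussian_variable_def)
  define c' where "c' = c * (r ^ CARD('n) / m) powr (2 * h)"
  have c': "c' \<ge> 0" using h levy_constant_pos[of "2 * h"] by (simp add: c'_def c_def)
  \<comment> \<open>The volume between neighbouring points; its factor
    \<open>1 / 2 ^ CARD('n)\<close> is the one included in \<open>c\<close>.\<close>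
  have "\<delta> ^ CARD('n) * real m ^ (CARD('n) - 1) = r ^ CARD('n) / m * (1 / 2 ^ CARD('n))"
    using m power_minus_mult[of "CARD('n)" "real m"] by (simp add: \<delta>_def power_divide power_mult_distrib field_simps)
  then have "(\<delta> ^ CARD('n) * real m ^ (CARD('n) - 1)) powr (2 * h) = (r ^ CARD('n) / m) powr (2 * h) * (1 / 2 ^ CARD('n)) powr (2 * h)"
    using r by (simp only: powr_mult)
  then have low: "c' * (\<Sum>i\<in>I. (a i)\<^sup>2) \<le> (\<Sum>i\<in>I. \<Sum>j\<in>I. a i * a j * mfbm_kernel h (grid_point \<delta> i) (grid_point \<delta> j))" for a
    using mfbm_kernel_grid_quadratic_form_ge[OF h m, of \<delta> a] \<delta> unfolding c'_def c_def I_def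
    by (simp add: mult_ac)
  have "{\<omega> \<in> space M. (SUP t\<in>cbox 0 (\<chi> i. r). \<bar>B t \<omega>\<bar>) \<le> \<epsilon>} \<subseteq> {\<omega> \<in> space M. \<forall>i\<in>I. \<bar>B (grid_point \<delta> i) \<omega>\<bar> \<le> \<epsilon>}"
  proof safe
    fix \<omega> i assume \<omega>: "\<omega> \<in> space M" "(SUP t\<in>cbox 0 (\<chi> i. r). \<bar>B t \<omega>\<bar>) \<le> \<epsilon>" and i: "i \<in> I"
    have "\<delta> * real (i k) \<le> r" for k
    proof -
      have "real (i k) \<le> 2 * m" using i by (simp add: I_def) (metis of_nat_le_iff of_nat_mult of_nat_numeral)
      then have "\<delta> * real (i k) \<le> \<delta> * (2 * m)" using \<delta> by (intro mult_left_mono) auto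
      then show ?thesis using m by (simp add: \<delta>_def)
    qed
    then have "grid_point \<delta> i \<in> cbox 0 (\<chi> i. r)"
      using \<delta> by (auto simp: mem_box_cart grid_point_def)
    then have "\<bar>B (grid_point \<delta> i) \<omega>\<bar> \<le> (SUP t\<in>cbox 0 (\<chi> i. r). \<bar>B t \<omega>\<bar>)"
      by (rule cSUP_upper[OF _ fbm_bdd_above[OF fbm \<omega>(1)]])
    then show "\<bar>B (grid_point \<delta> i) \<omega>\<bar> \<le> \<epsilon>" using \<omega>(2) by linarith
  qed
  then have "measure M {\<omega> \<in> space M. (SUP t\<in>cbox 0 (\<chi> i. r). \<bar>B t \<omega>\<bar>) \<le> \<epsilon>} \<le> measure M {\<omega> \<in> space M. \<forall>i\<in>I. \<bar>B (grid_point \<delta> i) \<omega>\<bar> \<le> \<epsilon>}"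
    using meas I by (intro finite_measure_mono) measurable
  also have "\<dots> \<le> (exp (1 / 2) / sqrt (1 + c' / \<epsilon>\<^sup>2)) ^ card I"
  proof (rule small_ball_upper_bound[OF M I(1) meas c' \<epsilon>])
    fix a :: "('n \<Rightarrow> nat) \<Rightarrow> real"
    let ?S = "\<lambda>\<omega>. \<Sum>i\<in>I. a i * B (grid_point \<delta> i) \<omega>"
    have "integral\<^sup>L M (\<lambda>\<omega>. cos (0 + ?S \<omega>)) = exp (- integral\<^sup>L M (\<lambda>\<omega>. (?S \<omega>)\<^sup>2) / 2) * cos 0"
      by (rule gaussian_variable_cos[OF M fbm_gaussian[OF fbm I(1) gp] fbm_mean[OF fbm I(1) gp]])
    then show "integral\<^sup>L M (\<lambda>\<omega>. cos (?S \<omega>)) \<le> exp (- c' * (\<Sum>i\<in>I. (a i)\<^sup>2) / 2)"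
      using low[of a] fbm_variance[OF fbm I(1) gp, of a] by simp
  qed
  finally show ?thesis by (simp add: c'_def I(2))
qed

lemma fbm_small_ball_upper:
  fixes B :: "real ^ 'n \<Rightarrow> 'w \<Rightarrow> real"
  assumes h: "0 < h" "h < 1 / 2" and fbm: "multiparameter_fbm M h B"
  obtains K where "K > 0" and "\<And>(r::real) (\<epsilon>::real). r > 0 \<Longrightarrow> 0 < \<epsilon> \<Longrightarrow> \<epsilon> < (K * r ^ CARD('n)) powr h \<Longrightarrow>
    measure M {\<omega> \<in> space M. (SUP t\<in>cbox 0 (\<chi> i. r). \<bar>B t \<omega>\<bar>) \<le> \<epsilon>}
      \<le> exp (- ((K / 2) ^ CARD('n) / 2) * (r ^ (CARD('n)\<^sup>2) / \<epsilon> powr (real CARD('n) / h)))"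
proof -
  define c where "c = (CARD('n) * ln (1 + 8 * CARD('n))) powr (- 2 * h) / (8 * h * levy_constant (2 * h)) * (1 / 2 ^ CARD('n)) powr (2 * h)"
  have c: "c > 0" using h levy_constant_pos[of "2 * h"] by (simp add: c_def)
  \<comment> \<open>Makes \<open>c * (r ^ CARD('n) / y) powr (2 * h)\<close> equal to
    \<open>(exp 1)\<^sup>2 * \<epsilon>\<^sup>2\<close> for the \<open>y\<close> below, so that the
    square root beats \<open>exp (1 / 2)\<close> and each grid point contributes at most
    \<open>exp (- (1 / 2))\<close>.\<close>
  define K where "K = (c / (exp 1)\<^sup>2) powr (1 / (2 * h))"
  have K: "K > 0" using c by (simp add: K_def)
  have K2: "c * K powr (- (2 * h)) = (exp 1)\<^sup>2"
    using c h by (simp add: K_def powr_powr powr_minus_divide)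
  have "measure M {\<omega> \<in> space M. (SUP t\<in>cbox 0 (\<chi> i. r). \<bar>B t \<omega>\<bar>) \<le> \<epsilon>}
      \<le> exp (- ((K / 2) ^ CARD('n) / 2) * (r ^ (CARD('n)\<^sup>2) / \<epsilon> powr (real CARD('n) / h)))"
    if r: "r > 0" and \<epsilon>: "0 < \<epsilon>" "\<epsilon> < (K * r ^ CARD('n)) powr h" for r \<epsilon>
  proof -
    define y where "y = K * r ^ CARD('n) / \<epsilon> powr (1 / h)"
    have "\<epsilon> powr (1 / h) < ((K * r ^ CARD('n)) powr h) powr (1 / h)"
      using h \<epsilon> by (intro powr_less_mono2) auto
    then have "\<epsilon> powr (1 / h) < K * r ^ CARD('n)"
      using h K r by (simp add: powr_powr)
    then have y: "y > 1" using \<epsilon> by (simp add: y_def)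
    \<comment> \<open>The threshold on \<open>\<epsilon>\<close> says exactly that
      \<open>y > 1\<close>, so taking the integer part keeps \<open>m\<close> positive and at least
      \<open>y / 2\<close>.\<close>
    define m where "m = nat \<lfloor>y\<rfloor>"
    have m: "m > 0" "real m \<le> y" "y / 2 \<le> real m"
    proof -
      have "real m = of_int \<lfloor>y\<rfloor>" "1 \<le> \<lfloor>y\<rfloor>" using y by (simp_all add: m_def)
      then show "m > 0" "real m \<le> y" "y / 2 \<le> real m"
        using y floor_correct[of y] by linarith+
    qed
    have "(exp 1)\<^sup>2 * \<epsilon>\<^sup>2 = c * (K powr (- (2 * h)) * \<epsilon>\<^sup>2)"
      by (simp add: K2[symmetric])
    also have "K powr (- (2 * h)) * \<epsilon>\<^sup>2 = (\<epsilon> powr (1 / h) / K) powr (2 * h)"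
      using h K \<epsilon> by (simp add: powr_divide powr_powr powr_minus_divide powr_numeral)
    also have "\<epsilon> powr (1 / h) / K = r ^ CARD('n) / y"
      using K r \<epsilon> by (simp add: y_def field_simps)
    also have "c * (r ^ CARD('n) / y) powr (2 * h) \<le> c * (r ^ CARD('n) / m) powr (2 * h)"
      using c m r h y by (intro mult_left_mono powr_mono2 divide_left_mono) auto
    finally have "(exp 1)\<^sup>2 \<le> 1 + c * (r ^ CARD('n) / m) powr (2 * h) / \<epsilon>\<^sup>2"
      using \<epsilon> by (simp add: pos_le_divide_eq add_increasing)
    then have "sqrt ((exp 1)\<^sup>2) \<le> sqrt (1 + c * (r ^ CARD('n) / m) powr (2 * h) / \<epsilon>\<^sup>2)"
      by (rule real_sqrt_le_mono)
    then have "exp (1 / 2) / sqrt (1 + c * (r ^ CARD('n) / m) powr (2 * h) / \<epsilon>\<^sup>2) \<le> exp (1 / 2) / exp 1"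
      using c by (intro divide_left_mono mult_pos_pos) (auto intro!: add_pos_nonneg)
    also have "\<dots> = exp (- (1 / 2))" by (simp add: exp_diff[symmetric])
    finally have base: "exp (1 / 2) / sqrt (1 + c * (r ^ CARD('n) / m) powr (2 * h) / \<epsilon>\<^sup>2) \<le> exp (- (1 / 2))" .
    have "measure M {\<omega> \<in> space M. (SUP t\<in>cbox 0 (\<chi> i. r). \<bar>B t \<omega>\<bar>) \<le> \<epsilon>}
        \<le> (exp (1 / 2) / sqrt (1 + c * (r ^ CARD('n) / m) powr (2 * h) / \<epsilon>\<^sup>2)) ^ (m ^ CARD('n))"
      unfolding c_def by (rule fbm_small_ball_grid_bound[OF h fbm r m(1) \<epsilon>(1)])
    also have "\<dots> \<le> exp (- (1 / 2)) ^ (m ^ CARD('n))"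
      using base c by (intro power_mono) auto
    also have "\<dots> = exp (- (real m ^ CARD('n) / 2))"
      by (simp add: exp_of_nat_mult[symmetric])
    also have "\<dots> \<le> exp (- ((y / 2) ^ CARD('n) / 2))"
      using m y by (simp add: power_mono)
    also have "(y / 2) ^ CARD('n) = (K / 2) ^ CARD('n) * (r ^ (CARD('n)\<^sup>2) / \<epsilon> powr (real CARD('n) / h))"
    proof -
      have "(\<epsilon> powr (1 / h)) ^ CARD('n) = \<epsilon> powr (real CARD('n) / h)"
        using \<epsilon> by (simp add: powr_realpow[symmetric] powr_powr)
      then show ?thesis
        by (simp add: y_def power_divide power_mult_distrib power2_eq_square power_mult)
    qed
    finally show ?thesis by (simp add: mult_ac)
  qed
  with K that show thesis by blast
qed

section \<open>Lower bound by dyadic chaining\<close>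

text \<open>Dyadic points are written \<open>grid_point (r / 2 ^ n) i\<close> with \<open>i\<close> in the following index set; the
  parent of \<open>i\<close> at level \<open>n\<close> is \<open>\<lambda>k. i k div 2\<close> at level \<open>n - 1\<close>.\<close>

definition dyadic_level :: "nat \<Rightarrow> ('n::finite \<Rightarrow> nat) set" where
  "dyadic_level n = {i. \<forall>k. i k < 2 ^ n}"

lemma dyadic_level_eq_PiE: "dyadic_level n = PiE UNIV (\<lambda>_. {..<2 ^ n})"
  by (auto simp: dyadic_level_def PiE_iff)

lemma finite_dyadic_level [simp]: "finite (dyadic_level n)"
  unfolding dyadic_level_eq_PiE by (intro finite_PiE) auto

lemma card_dyadic_level: "card (dyadic_level n :: ('n::finite \<Rightarrow> nat) set) = (2 ^ n) ^ CARD('n)"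
  unfolding dyadic_level_eq_PiE by (simp add: card_PiE)

definition dyadic_link ::
    "(real ^ 'n \<Rightarrow> 'w \<Rightarrow> real) \<Rightarrow> real \<Rightarrow> nat \<times> ('n::finite \<Rightarrow> nat) \<Rightarrow> 'w \<Rightarrow> real" where
  "dyadic_link B r = (\<lambda>(n, i) \<omega>. B (grid_point (r / 2 ^ n) i) \<omega> - B (grid_point (r / 2 ^ (n - 1)) (\<lambda>k. i k div 2)) \<omega>)"

text \<open>The box of the parent is contained in that of the child, so the measure is a difference
  of two products. In units of \<open>r\<close> their factors lie in the unit interval and differ by
  at most \<open>1 / 2 ^ n\<close>; telescoping the product adds these differences up.\<close>

lemma measure_dyadic_link_le:
  fixes i :: "'n::finite \<Rightarrow> nat" and r :: real
  assumes r: "r > 0" and n: "n > 0" and i: "i \<in> dyadic_level n"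
  shows "measure lborel (sym_diff (cbox 0 (grid_point (r / 2 ^ n) i)) (cbox 0 (grid_point (r / 2 ^ (n - 1)) (\<lambda>k. i k div 2))))
    \<le> CARD('n) * r ^ CARD('n) / 2 ^ n"
proof -
  define p where "p = (\<lambda>k. real (i k) / 2 ^ n)"
  define q where "q = (\<lambda>k. real (i k div 2) / 2 ^ (n - 1))"
  have two: "(2::real) ^ n = 2 * 2 ^ (n - 1)" using n by (simp add: power_eq_if)
  have q: "q k = real (2 * (i k div 2)) / 2 ^ n" for k
    by (simp add: q_def two)
  have p01: "0 \<le> p k" "p k \<le> 1" for k
    using i by (auto simp: p_def dyadic_level_def less_imp_le)
  have "real (2 * (i k div 2)) \<le> real (i k)" "real (i k) \<le> real (2 * (i k div 2)) + 1" for k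
    by linarith+
  then have qp: "q k \<le> p k" "p k - q k \<le> 1 / 2 ^ n" for k
    unfolding q p_def diff_divide_distrib[symmetric] by (auto intro!: divide_right_mono simp del: of_nat_mult)
  have q0: "0 \<le> q k" for k by (simp add: q_def)
  have gp: "grid_point (r / 2 ^ n) i = (\<chi> k. r * p k)" "grid_point (r / 2 ^ (n - 1)) (\<lambda>k. i k div 2) = (\<chi> k. r * q k)"
    by (simp_all add: grid_point_def p_def q_def)
  have "(\<chi> k. r * p k) \<in> nonneg_orthant" "(\<chi> k. r * q k) \<in> nonneg_orthant"
    using r p01 q0 by (simp_all add: nonneg_orthant_def)
  then have "measure lborel (sym_diff (cbox 0 (grid_point (r / 2 ^ n) i)) (cbox 0 (grid_point (r / 2 ^ (n - 1)) (\<lambda>k. i k div 2)))) =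
      (\<Prod>k\<in>UNIV. r * p k) + (\<Prod>k\<in>UNIV. r * q k) - 2 * (\<Prod>k\<in>UNIV. min (r * p k) (r * q k))"
    unfolding gp by (subst measure_sym_diff_corner_cbox) auto
  also have "(\<Prod>k\<in>UNIV. min (r * p k) (r * q k)) = (\<Prod>k\<in>UNIV. r * q k)"
    using r qp by (intro prod.cong refl min_absorb2 mult_left_mono) auto
  also have "(\<Prod>k\<in>UNIV. r * p k) + (\<Prod>k\<in>UNIV. r * q k) - 2 * (\<Prod>k\<in>UNIV. r * q k) =
      r ^ CARD('n) * ((\<Prod>k\<in>UNIV. p k) - (\<Prod>k\<in>UNIV. q k))"
    by (simp add: prod.distrib right_diff_distrib)
  also have "\<dots> \<le> r ^ CARD('n) * (\<Sum>k\<in>(UNIV :: 'n set). 1 / 2 ^ n)"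
  proof (rule mult_left_mono)
    have "(\<Prod>k\<in>UNIV. p k) - (\<Prod>k\<in>UNIV. q k) \<le> norm ((\<Prod>k\<in>UNIV. p k) - (\<Prod>k\<in>UNIV. q k))" by simp
    also have "\<dots> \<le> (\<Sum>k\<in>UNIV. norm (p k - q k))"
      using p01 q0 qp(1) order_trans[OF qp(1) p01(2)] by (intro norm_prod_diff) auto
    also have "\<dots> \<le> (\<Sum>k\<in>(UNIV :: 'n set). 1 / 2 ^ n)"
      using qp by (intro sum_mono) auto
    finally show "(\<Prod>k\<in>UNIV. p k) - (\<Prod>k\<in>UNIV. q k) \<le> (\<Sum>k\<in>(UNIV :: 'n set). 1 / 2 ^ n)" .
  qed (use r in auto)
  finally show ?thesis by (simp add: mult_ac)
qed

text \<open>The tolerance at level \<open>n\<close> decays away from the critical level \<open>n0\<close>, at which the increments have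
  standard deviation of order \<open>\<epsilon>\<close>; \<open>link_ratio\<close> is the resulting ratio of deviation to tolerance.\<close>

definition link_tolerance :: "real \<Rightarrow> nat \<Rightarrow> nat \<Rightarrow> real" where
  "link_tolerance h n0 n = exp (- (h * ln 2 / 2) * \<bar>real n0 - real n\<bar>) / (1 + 2 / (exp (h * ln 2 / 2) - 1))"

definition link_ratio :: "real \<Rightarrow> nat \<Rightarrow> nat \<Rightarrow> real" where
  "link_ratio h n0 n = exp (h * ln 2 * (real n0 - real n)) / link_tolerance h n0 n"

lemma link_tolerance_pos: "h > 0 \<Longrightarrow> link_tolerance h n0 n > 0"
  by (auto simp: link_tolerance_def intro!: divide_pos_pos add_pos_pos)

lemma sum_link_tolerance_le:
  assumes "h > 0" "finite Y"
  shows "(\<Sum>n\<in>Y. link_tolerance h n0 n) \<le> 1"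
proof -
  have "(\<Sum>n\<in>Y. exp (- (h * ln 2 / 2) * \<bar>real n0 - real n\<bar>)) \<le> 1 + 2 / (exp (h * ln 2 / 2) - 1)"
    using assms by (intro sum_exp_dist_le) auto
  moreover have "0 < 1 + 2 / (exp (h * ln 2 / 2) - 1)"
    using assms by (intro add_pos_pos divide_pos_pos) auto
  ultimately show ?thesis
    unfolding link_tolerance_def sum_divide_distrib[symmetric] by (simp add: divide_le_eq)
qed

text \<open>At distance \<open>d\<close> from level \<open>n0\<close> the cost decays geometrically
  on both sides. For \<open>n \<le> n0\<close> the number of links drops by at least
  \<open>2 ^ d\<close>, while the linear cost grows only like \<open>2 powr (3 * h * d / 2)\<close>,
  and \<open>3 * h / 2 < 3 / 4\<close>. For \<open>n > n0\<close> the number of links grows like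
  \<open>2 ^ (\<nu> * d)\<close>, but the ratio decays like \<open>2 powr (- h * d / 2)\<close> and
  is raised to a large power.\<close>

lemma link_cost_sum_bound:
  fixes h :: real and \<nu> :: nat
  assumes h: "0 < h" "h < 1 / 2" and \<nu>: "\<nu> > 0"
  obtains p K where "p > 0" "K > 0" and "\<And>n0 N. (\<Sum>n\<in>{1..N}. (2 ^ n) ^ \<nu> *
      min (2 + 2 * link_ratio h n0 n) (gaussian_code_constant p * link_ratio h n0 n ^ (2 * p - 1))) \<le> K * (2 ^ n0) ^ \<nu>"
proof -
  define \<gamma> where "\<gamma> = ln (2::real)"
  have \<gamma>: "\<gamma> > 0" by (simp add: \<gamma>_def)
  define C where "C = 1 + 2 / (exp (h * \<gamma> / 2) - 1)"
  have C: "C \<ge> 1" using h \<gamma> by (simp add: C_def)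
  \<comment> \<open>Large enough that the power \<open>2 * p - 1\<close> of the ratio outweighs the
    growth in the number of links, with one spare factor \<open>2\<close> per level.\<close>
  define p where "p = nat \<lceil>2 * (real \<nu> + 1) / h\<rceil> + 1"
  have "real (2 * p - 1) = 1 + 2 * real (nat \<lceil>2 * (real \<nu> + 1) / h\<rceil>)"
    by (simp add: p_def)
  moreover have "2 * (real \<nu> + 1) / h \<le> real (nat \<lceil>2 * (real \<nu> + 1) / h\<rceil>)"
    by (rule real_nat_ceiling_ge)
  ultimately have "2 * (real \<nu> + 1) / h \<le> real (2 * p - 1)"
    by linarith
  moreover have "real \<nu> + 1 \<le> h / 2 * x" if "2 * (real \<nu> + 1) / h \<le> x" for x
    using that h by (simp add: pos_divide_le_eq mult_ac)
  ultimately have p: "real \<nu> + 1 \<le> h / 2 * real (2 * p - 1)" "p > 0"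
    by (blast, simp add: p_def)
  define G where "G = gaussian_code_constant p"
  have G: "G > 0" by (simp add: G_def gaussian_code_constant_def add_pos_pos)
  define K1 where "K1 = (2 + 2 * C) + G * C ^ (2 * p - 1)"
  have K1: "K1 > 0" unfolding K1_def using C G by (intro add_pos_nonneg) auto
  have pw: "(2 ^ n) ^ \<nu> = exp (\<gamma> * real \<nu> * real n)" for n
  proof -
    have "(2::real) ^ n = exp (real n * \<gamma>)"
      unfolding exp_of_nat_mult by (simp add: \<gamma>_def)
    then show ?thesis by (simp add: exp_of_nat_mult[symmetric] mult_ac)
  qed
  have ratio: "link_ratio h n0 n = C * exp (h * \<gamma> * (real n0 - real n) + h * \<gamma> / 2 * \<bar>real n0 - real n\<bar>)" for n0 n
  proof -
    have "exp a / (exp (- b) / C) = C * exp (a + b)" for a b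
      by (simp add: exp_add exp_minus divide_inverse)
    then show ?thesis
      by (simp only: link_ratio_def link_tolerance_def \<gamma>_def[symmetric] C_def[symmetric] mult_minus_left)
  qed
  have level: "(2 ^ n) ^ \<nu> * min (2 + 2 * link_ratio h n0 n) (G * link_ratio h n0 n ^ (2 * p - 1))
      \<le> K1 * (2 ^ n0) ^ \<nu> * exp (- (\<gamma> / 4) * \<bar>real n0 - real n\<bar>)" for n0 n
  proof (cases "n \<le> n0")
    case True
    define d where "d = real n0 - real n"
    have d: "d \<ge> 0" "\<bar>real n0 - real n\<bar> = d" "real n = real n0 - d" using True by (auto simp: d_def)
    have r: "link_ratio h n0 n = C * exp (3 / 2 * h * \<gamma> * d)"
    proof -
      have "h * \<gamma> * d + h * \<gamma> / 2 * d = 3 / 2 * h * \<gamma> * d" by simp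
      then show ?thesis unfolding ratio d_def[symmetric] using d(1) by simp
    qed
    have "3 / 2 * h * (\<gamma> * d) \<le> 3 / 4 * (\<gamma> * d)"
      using h \<gamma> d by (intro mult_right_mono) auto
    then have e: "exp (3 / 2 * h * \<gamma> * d) \<le> exp (3 / 4 * \<gamma> * d)" by simp
    have "1 \<le> exp (3 / 4 * \<gamma> * d)" using \<gamma> d by simp
    then have "2 + 2 * link_ratio h n0 n \<le> (2 + 2 * C) * exp (3 / 4 * \<gamma> * d)"
      unfolding r distrib_right using e C by (intro add_mono) auto
    also have "\<dots> \<le> K1 * exp (3 / 4 * \<gamma> * d)"
      using C G by (intro mult_right_mono) (auto simp: K1_def)
    finally have m: "min (2 + 2 * link_ratio h n0 n) (G * link_ratio h n0 n ^ (2 * p - 1)) \<le> K1 * exp (3 / 4 * \<gamma> * d)"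
      by linarith
    have "\<gamma> * d * 1 \<le> \<gamma> * d * real \<nu>"
      using \<nu> \<gamma> d by (intro mult_left_mono) auto
    then have "\<gamma> * real \<nu> * real n \<le> \<gamma> * real \<nu> * real n0 - \<gamma> * d"
      unfolding d(3) by (simp add: algebra_simps)
    then have "exp (\<gamma> * real \<nu> * real n) \<le> exp (\<gamma> * real \<nu> * real n0 - \<gamma> * d)" by simp
    then have "(2 ^ n) ^ \<nu> * min (2 + 2 * link_ratio h n0 n) (G * link_ratio h n0 n ^ (2 * p - 1))
        \<le> exp (\<gamma> * real \<nu> * real n0 - \<gamma> * d) * (K1 * exp (3 / 4 * \<gamma> * d))"
      unfolding pw using m K1
      by (intro order_trans[OF mult_left_mono[OF m] mult_right_mono]) auto
    also have "\<dots> = K1 * (2 ^ n0) ^ \<nu> * exp (- (\<gamma> / 4) * d)"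
      unfolding pw by (simp add: exp_add[symmetric] mult_ac)
    finally show ?thesis using d(2) by simp
  next
    case False
    define d where "d = real n - real n0"
    have d: "d \<ge> 0" "\<bar>real n0 - real n\<bar> = d" "real n = real n0 + d" using False by (auto simp: d_def)
    have r: "link_ratio h n0 n = C * exp (- (h / 2 * \<gamma> * d))"
      unfolding ratio d(2) by (simp add: d_def algebra_simps)
    have "G * link_ratio h n0 n ^ (2 * p - 1) = G * C ^ (2 * p - 1) * exp (- (h / 2 * real (2 * p - 1) * (\<gamma> * d)))"
      unfolding r power_mult_distrib by (simp add: exp_of_nat_mult[symmetric] mult_ac)
    also have "\<dots> \<le> K1 * exp (- ((real \<nu> + 1) * (\<gamma> * d)))"
    proof (rule mult_mono)
      show "exp (- (h / 2 * real (2 * p - 1) * (\<gamma> * d))) \<le> exp (- ((real \<nu> + 1) * (\<gamma> * d)))"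
        using mult_right_mono[OF p(1), of "\<gamma> * d"] \<gamma> d(1) by (simp del: of_nat_diff)
    qed (use C G in \<open>auto simp: K1_def\<close>)
    finally have m: "min (2 + 2 * link_ratio h n0 n) (G * link_ratio h n0 n ^ (2 * p - 1)) \<le> K1 * exp (- ((real \<nu> + 1) * (\<gamma> * d)))"
      by linarith
    have "(2 ^ n) ^ \<nu> * min (2 + 2 * link_ratio h n0 n) (G * link_ratio h n0 n ^ (2 * p - 1))
        \<le> exp (\<gamma> * real \<nu> * real n) * (K1 * exp (- ((real \<nu> + 1) * (\<gamma> * d))))"
      unfolding pw using m by (intro mult_left_mono) auto
    also have "\<dots> = K1 * (2 ^ n0) ^ \<nu> * exp (- (\<gamma> * d))"
      unfolding pw d(3) by (simp add: exp_add[symmetric] mult_ac) (simp add: algebra_simps)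
    also have "\<dots> \<le> K1 * (2 ^ n0) ^ \<nu> * exp (- (\<gamma> / 4) * d)"
      using K1 \<gamma> d by (intro mult_left_mono) (auto simp: mult_right_mono)
    finally show ?thesis using d(2) by simp
  qed
  have sum: "(\<Sum>n\<in>{1..N}. (2 ^ n) ^ \<nu> * min (2 + 2 * link_ratio h n0 n) (G * link_ratio h n0 n ^ (2 * p - 1)))
      \<le> (K1 * (1 + 2 / (exp (\<gamma> / 4) - 1))) * (2 ^ n0) ^ \<nu>" for n0 N
  proof -
    have "(\<Sum>n\<in>{1..N}. (2 ^ n) ^ \<nu> * min (2 + 2 * link_ratio h n0 n) (G * link_ratio h n0 n ^ (2 * p - 1)))
        \<le> K1 * (2 ^ n0) ^ \<nu> * (\<Sum>n\<in>{1..N}. exp (- (\<gamma> / 4) * \<bar>real n0 - real n\<bar>))"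
      unfolding sum_distrib_left by (intro sum_mono level)
    also have "\<dots> \<le> K1 * (2 ^ n0) ^ \<nu> * (1 + 2 / (exp (\<gamma> / 4) - 1))"
      using K1 \<gamma> by (intro mult_left_mono sum_exp_dist_le) auto
    finally show ?thesis by (simp add: mult_ac)
  qed
  have "K1 * (1 + 2 / (exp (\<gamma> / 4) - 1)) > 0"
    using K1 \<gamma> by (intro mult_pos_pos add_pos_pos divide_pos_pos) auto
  from that[OF p(2) this] sum show thesis by (simp add: G_def)
qed

lemma abs_dyadic_le_sum_links:
  fixes i :: "'n::finite \<Rightarrow> nat"
  assumes root: "B 0 \<omega> = 0"
    and links: "\<And>n i. n > 0 \<Longrightarrow> i \<in> dyadic_level n \<Longrightarrow> \<bar>dyadic_link B r (n, i) \<omega>\<bar> \<le> e n"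
    and i: "i \<in> dyadic_level n"
  shows "\<bar>B (grid_point (r / 2 ^ n) i) \<omega>\<bar> \<le> (\<Sum>j\<in>{1..n}. e j)"
  using i
proof (induction n arbitrary: i)
  \<comment> \<open>Indices are strictly below \<open>2 ^ n\<close>, so level \<open>0\<close>
    consists of the origin alone and the tree has a single root.\<close>
  case 0
  then have "grid_point (r / 2 ^ 0) i = 0"
    by (simp add: dyadic_level_def grid_point_def vec_eq_iff)
  then show ?case using root by simp
next
  case (Suc n)
  let ?j = "\<lambda>k. i k div 2"
  have j: "?j \<in> dyadic_level n"
    using Suc.prems by (auto simp: dyadic_level_def less_mult_imp_div_less mult.commute)
  have "\<bar>B (grid_point (r / 2 ^ Suc n) i) \<omega>\<bar> \<le> \<bar>dyadic_link B r (Suc n, i) \<omega>\<bar> + \<bar>B (grid_point (r / 2 ^ n) ?j) \<omega>\<bar>"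
    by (simp add: dyadic_link_def)
  also have "\<dots> \<le> e (Suc n) + (\<Sum>j\<in>{1..n}. e j)"
    using links[OF _ Suc.prems] Suc.IH[OF j] by (intro add_mono) auto
  finally show ?case by simp
qed

text \<open>Dyadic points are dense in the cube and the paths are continuous. Besides the chaining,
  this countable description gives the measurability of the small ball event.\<close>

lemma sup_le_iff_dyadic:
  fixes B :: "real ^ 'n \<Rightarrow> 'w \<Rightarrow> real"
  assumes fbm: "multiparameter_fbm M h B" and r: "r > 0" and \<omega>: "\<omega> \<in> space M"
  shows "(SUP t\<in>cbox 0 (\<chi> i. r). \<bar>B t \<omega>\<bar>) \<le> \<epsilon> \<longleftrightarrow>
    (\<forall>n. \<forall>i\<in>dyadic_level n. \<bar>B (grid_point (r / 2 ^ n) i) \<omega>\<bar> \<le> \<epsilon>)"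
proof
  assume sup: "(SUP t\<in>cbox 0 (\<chi> i. r). \<bar>B t \<omega>\<bar>) \<le> \<epsilon>"
  show "\<forall>n. \<forall>i\<in>dyadic_level n. \<bar>B (grid_point (r / 2 ^ n) i) \<omega>\<bar> \<le> \<epsilon>"
  proof (intro allI ballI)
    fix n and i :: "'n \<Rightarrow> nat" assume i: "i \<in> dyadic_level n"
    have "r / 2 ^ n * real (i k) \<le> r" for k
    proof -
      have "i k \<le> 2 ^ n" using i by (simp add: dyadic_level_def less_imp_le)
      then have "real (i k) \<le> 2 ^ n" by (metis of_nat_le_iff of_nat_numeral of_nat_power)
      then have "r * real (i k) \<le> r * 2 ^ n" using r by (intro mult_left_mono) auto
      then show ?thesis by (simp add: divide_le_eq)
    qed
    then have "grid_point (r / 2 ^ n) i \<in> cbox 0 (\<chi> i. r)"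
      using r by (auto simp: mem_box_cart grid_point_def)
    then have "\<bar>B (grid_point (r / 2 ^ n) i) \<omega>\<bar> \<le> (SUP t\<in>cbox 0 (\<chi> i. r). \<bar>B t \<omega>\<bar>)"
      by (rule cSUP_upper[OF _ fbm_bdd_above[OF fbm \<omega>]])
    then show "\<bar>B (grid_point (r / 2 ^ n) i) \<omega>\<bar> \<le> \<epsilon>" using sup by linarith
  qed
next
  assume dy: "\<forall>n. \<forall>i\<in>dyadic_level n. \<bar>B (grid_point (r / 2 ^ n) i) \<omega>\<bar> \<le> \<epsilon>"
  show "(SUP t\<in>cbox 0 (\<chi> i. r). \<bar>B t \<omega>\<bar>) \<le> \<epsilon>"
  proof (rule cSUP_least)
    show "cbox 0 (\<chi> i. r) \<noteq> ({} :: (real ^ 'n) set)"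
      using r by (auto simp: interval_ne_empty_cart)
    fix t :: "real ^ 'n" assume "t \<in> cbox 0 (\<chi> i. r)"
    then have t: "0 \<le> t $ k" "t $ k \<le> r" for k by (auto simp: mem_box_cart)
    then have t_nonneg: "t \<in> nonneg_orthant" by (simp add: nonneg_orthant_def)
    \<comment> \<open>The cap \<open>2 ^ n - 1\<close> matters only for \<open>t $ k = r\<close>,
      where rounding down would leave the level; the error then equals one mesh width, which still
      tends to zero.\<close>
    define i where "i = (\<lambda>n k. min (2 ^ n - 1) (nat \<lfloor>t $ k * 2 ^ n / r\<rfloor>))"
    have "\<bar>r / 2 ^ n * real (i n k) - t $ k\<bar> \<le> r / 2 ^ n" for n k
    proof -
      define x where "x = t $ k * 2 ^ n / r"
      have x: "0 \<le> x" "x \<le> 2 ^ n"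
        using t r by (auto simp: x_def divide_le_eq mult.commute[of r])
      have "real (nat \<lfloor>x\<rfloor>) \<le> x" "x \<le> real (nat \<lfloor>x\<rfloor>) + 1" using x by linarith+
      moreover have "real (2 ^ n - 1) = 2 ^ n - 1" by (simp add: of_nat_diff)
      ultimately have "\<bar>real (i n k) - x\<bar> \<le> 1"
        using x unfolding i_def x_def[symmetric] of_nat_min by linarith
      then have "r / 2 ^ n * \<bar>real (i n k) - x\<bar> \<le> r / 2 ^ n * 1"
        using r by (intro mult_left_mono) auto
      moreover have "r / 2 ^ n * real (i n k) - t $ k = r / 2 ^ n * (real (i n k) - x)"
        using r by (simp add: x_def right_diff_distrib)
      ultimately show ?thesis using r by (simp add: abs_mult)
    qed
    then have conv: "(\<lambda>n. grid_point (r / 2 ^ n) (i n)) \<longlonglongrightarrow> t"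
    proof (intro vec_tendstoI)
      fix k
      have "(\<lambda>n. r / 2 ^ n) \<longlonglongrightarrow> 0"
        by real_asymp
      then have "(\<lambda>n. grid_point (r / 2 ^ n) (i n) $ k - t $ k) \<longlonglongrightarrow> 0"
        by (rule Lim_null_comparison[rotated]) (use \<open>\<And>n k. \<bar>r / 2 ^ n * real (i n k) - t $ k\<bar> \<le> r / 2 ^ n\<close> in \<open>simp add: grid_point_def\<close>)
      then show "(\<lambda>n. grid_point (r / 2 ^ n) (i n) $ k) \<longlonglongrightarrow> t $ k"
        by (rule LIM_zero_cancel)
    qed
    have "continuous_on nonneg_orthant (\<lambda>t. B t \<omega>)"
      using fbm \<omega> by (simp add: multiparameter_fbm_def)
    then have "(\<lambda>n. B (grid_point (r / 2 ^ n) (i n)) \<omega>) \<longlonglongrightarrow> B t \<omega>"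
      by (rule continuous_on_tendsto_compose[OF _ conv])
        (use t_nonneg r in \<open>auto intro!: always_eventually grid_point_nonneg\<close>)
    then have "(\<lambda>n. \<bar>B (grid_point (r / 2 ^ n) (i n)) \<omega>\<bar>) \<longlonglongrightarrow> \<bar>B t \<omega>\<bar>"
      by (rule tendsto_rabs)
    moreover have "i n \<in> dyadic_level n" for n
      by (auto simp: i_def dyadic_level_def min_less_iff_disj)
    ultimately show "\<bar>B t \<omega>\<bar> \<le> \<epsilon>"
      using dy by (intro LIMSEQ_le_const2) auto
  qed
qed

lemma fbm_small_ball_lower:
  fixes B :: "real ^ 'n \<Rightarrow> 'w \<Rightarrow> real"
  assumes h: "0 < h" "h < 1 / 2" and fbm: "multiparameter_fbm M h B"
  obtains K where "K > 0" and "\<And>(r::real) (\<epsilon>::real). r > 0 \<Longrightarrow> 0 < \<epsilon> \<Longrightarrow> \<epsilon> < (CARD('n) * r ^ CARD('n)) powr h \<Longrightarrow>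
    exp (- K * (r ^ (CARD('n)\<^sup>2) / \<epsilon> powr (real CARD('n) / h)))
      \<le> measure M {\<omega> \<in> space M. (SUP t\<in>cbox 0 (\<chi> i. r). \<bar>B t \<omega>\<bar>) \<le> \<epsilon>}"
proof -
  have M: "prob_space M" using fbm by (simp add: multiparameter_fbm_def centred_gaussian_process_def)
  interpret prob_space M by fact
  let ?\<nu> = "CARD('n)"
  obtain p K where p: "p > 0" and K: "K > 0" and cost: "\<And>n0 N. (\<Sum>n\<in>{1..N}. (2 ^ n) ^ ?\<nu> *
      min (2 + 2 * link_ratio h n0 n) (gaussian_code_constant p * link_ratio h n0 n ^ (2 * p - 1))) \<le> K * (2 ^ n0) ^ ?\<nu>"
    using link_cost_sum_bound[OF h, of ?\<nu>] by auto
  have main: "exp (- (K * (2 * ?\<nu>) ^ ?\<nu>) * (r ^ (?\<nu>\<^sup>2) / \<epsilon> powr (real ?\<nu> / h)))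
      \<le> measure M {\<omega> \<in> space M. (SUP t\<in>cbox 0 (\<chi> i. r). \<bar>B t \<omega>\<bar>) \<le> \<epsilon>}"
    if r: "r > 0" and \<epsilon>: "0 < \<epsilon>" "\<epsilon> < (?\<nu> * r ^ ?\<nu>) powr h" for r \<epsilon> :: real
  proof -
    \<comment> \<open>\<open>A * \<epsilon> powr (1 / h)\<close> is the numerator of the volume
      bound for links.\<close>
    define A where "A = ?\<nu> * r ^ ?\<nu> / \<epsilon> powr (1 / h)"
    have "\<epsilon> powr (1 / h) < ((?\<nu> * r ^ ?\<nu>) powr h) powr (1 / h)"
      using h \<epsilon> by (intro powr_less_mono2) auto
    then have "\<epsilon> powr (1 / h) < ?\<nu> * r ^ ?\<nu>"
      using h r by (simp add: powr_powr)
    then have A: "A > 1" using \<epsilon> by (simp add: A_def)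
    \<comment> \<open>The first level at which the variance bound for a link is at most
      \<open>\<epsilon>\<^sup>2\<close>. As \<open>A > 1\<close> the logarithm is positive, so
      rounding up costs at most a factor \<open>2\<close>.\<close>
    define n0 where "n0 = nat \<lceil>log 2 A\<rceil>"
    have "log 2 A \<le> real n0" "real n0 \<le> log 2 A + 1"
      using A unfolding n0_def by (auto simp: of_nat_ceiling)
    then have n0: "A \<le> 2 ^ n0" "2 ^ n0 \<le> 2 * A"
      using A powr_le_cancel_iff[of 2 "log 2 A" "real n0"] powr_le_cancel_iff[of 2 "real n0" "log 2 A + 1"]
      by (simp_all add: powr_realpow powr_add)
    define e where "e = (\<lambda>n. \<epsilon> * link_tolerance h n0 n)"
    have e: "e n > 0" for n using \<epsilon> h by (simp add: e_def link_tolerance_pos)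
    have ratio: "link_ratio h n0 n > 0" for n
      using link_tolerance_pos[OF h(1)] by (simp add: link_ratio_def)
    have gp: "grid_point (r / 2 ^ n) i \<in> nonneg_orthant" for n and i :: "'n \<Rightarrow> nat"
      using r by (intro grid_point_nonneg) auto
    have meas: "B (grid_point (r / 2 ^ n) i) \<in> borel_measurable M" for n i
      using fbm_gaussian[OF fbm, of "{i}" "grid_point (r / 2 ^ n)" "\<lambda>_. 1"] gp by (simp add: gaussian_variable_def)
    define X where "X = dyadic_link B r"
    define L where "L = (\<lambda>N. Sigma {1..N} (\<lambda>n. dyadic_level n :: ('n \<Rightarrow> nat) set))"
    have L: "finite (L N)" for N by (simp add: L_def)
    define E where "E = (\<lambda>N. {\<omega> \<in> space M. \<forall>l\<in>L N. \<bar>X l \<omega>\<bar> \<le> e (fst l)})"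
    have Xm: "X l \<in> borel_measurable M" for l
      unfolding X_def dyadic_link_def by (cases l) (use meas in auto)
    have Em: "E N \<in> sets M" for N
      unfolding E_def using L Xm by measurable
    \<comment> \<open>The bound does not depend on the depth \<open>N\<close>, so it passes to the
      infinite tree by continuity along the decreasing events \<open>E N\<close>.\<close>
    have low: "exp (- (K * (2 ^ n0) ^ ?\<nu>)) \<le> measure M (E N)" for N
    proof -
      define F where "F = (\<lambda>n. min (2 + 2 * link_ratio h n0 n) (gaussian_code_constant p * link_ratio h n0 n ^ (2 * p - 1)))"
      have "exp (- (\<Sum>l\<in>L N. F (fst l))) \<le> measure M (E N)"
        unfolding E_def F_def
      proof (rule gaussian_box_lower_bound[OF M L p])
        fix a
        show "gaussian_variable M (\<lambda>\<omega>. \<Sum>l\<in>L N. a l * X l \<omega>)"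
          using multiparameter_fbm_increments[OF fbm L gp gp] unfolding X_def dyadic_link_def split_beta .
      next
        fix l assume l: "l \<in> L N"
        then obtain n i where l_eq: "l = (n, i)" and n: "n > 0" and i: "i \<in> dyadic_level n"
          by (auto simp: L_def)
        note inc = fbm_increment_variance[OF fbm gp[of n i] gp[of "n - 1" "\<lambda>k. i k div 2"]]
        show "gaussian_variable M (X l)" "integral\<^sup>L M (X l) = 0"
          using inc(1,2) by (simp_all add: X_def dyadic_link_def l_eq)
        have "integral\<^sup>L M (\<lambda>\<omega>. (X l \<omega>)\<^sup>2) \<le> (?\<nu> * r ^ ?\<nu> / 2 ^ n) powr (2 * h)"
          using inc(3) measure_dyadic_link_le[OF r n i] h by (simp add: X_def dyadic_link_def l_eq powr_mono2)
        also have "?\<nu> * r ^ ?\<nu> / 2 ^ n = A * \<epsilon> powr (1 / h) / 2 ^ n"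
          using \<epsilon> by (simp add: A_def)
        also have "(A * \<epsilon> powr (1 / h) / 2 ^ n) powr (2 * h) \<le> (2 ^ n0 * \<epsilon> powr (1 / h) / 2 ^ n) powr (2 * h)"
          using n0 A h by (intro powr_mono2 divide_right_mono mult_right_mono) auto
        also have "2 ^ n0 * \<epsilon> powr (1 / h) / 2 ^ n = exp (ln 2 * (real n0 - real n)) * \<epsilon> powr (1 / h)"
        proof -
          have "(2::real) ^ m = exp (ln 2 * real m)" for m
            unfolding mult.commute[of "ln 2"] exp_of_nat_mult by simp
          then show ?thesis by (simp add: right_diff_distrib exp_diff)
        qed
        also have "(exp (ln 2 * (real n0 - real n)) * \<epsilon> powr (1 / h)) powr (2 * h) = (exp (h * ln 2 * (real n0 - real n)) * \<epsilon>)\<^sup>2"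
          using \<epsilon> h by (simp add: powr_mult powr_powr power_mult_distrib powr_numeral exp_powr_real exp_double[symmetric] mult_ac)
        also have "exp (h * ln 2 * (real n0 - real n)) * \<epsilon> = link_ratio h n0 n * e n"
          using link_tolerance_pos[OF h(1), of n0 n] by (simp add: link_ratio_def e_def)
        finally show "integral\<^sup>L M (\<lambda>\<omega>. (X l \<omega>)\<^sup>2) \<le> (link_ratio h n0 (fst l) * e (fst l))\<^sup>2"
          by (simp add: l_eq)
        show "0 < e (fst l)" "0 < link_ratio h n0 (fst l)" using e ratio by auto
      qed
      also have "(\<Sum>l\<in>L N. F (fst l)) = (\<Sum>n\<in>{1..N}. (2 ^ n) ^ ?\<nu> * F n)"
      proof -
        have "(\<Sum>l\<in>L N. F (fst l)) = (\<Sum>(n, i)\<in>L N. F n)" by (simp add: split_beta)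
        also have "\<dots> = (\<Sum>n\<in>{1..N}. \<Sum>i\<in>(dyadic_level n :: ('n \<Rightarrow> nat) set). F n)"
          unfolding L_def by (rule sum.Sigma[symmetric]) auto
        finally show ?thesis by (simp add: card_dyadic_level)
      qed
      finally show ?thesis using cost[of n0 N] unfolding F_def by (elim order_trans[rotated]) simp
    qed
    have "(\<lambda>N. measure M (E N)) \<longlonglongrightarrow> measure M (\<Inter>N. E N)"
    proof (rule finite_Lim_measure_decseq)
      show "decseq E" by (auto simp: decseq_def E_def L_def)
    qed (use Em in auto)
    then have "exp (- (K * (2 ^ n0) ^ ?\<nu>)) \<le> measure M (\<Inter>N. E N)"
      by (rule LIMSEQ_le_const) (use low in auto)
    also have "\<dots> \<le> measure M {\<omega> \<in> space M. (SUP t\<in>cbox 0 (\<chi> i. r). \<bar>B t \<omega>\<bar>) \<le> \<epsilon>}"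
    \<comment> \<open>The chain starts from \<open>B 0 \<omega> = 0\<close>, which zero variance
      gives only almost surely, so the inclusion of events holds up to a null set.\<close>
    proof (rule finite_measure_mono_AE)
      have "{\<omega> \<in> space M. (SUP t\<in>cbox 0 (\<chi> i. r). \<bar>B t \<omega>\<bar>) \<le> \<epsilon>} =
          {\<omega> \<in> space M. \<forall>n. \<forall>i\<in>dyadic_level n. \<bar>B (grid_point (r / 2 ^ n) i) \<omega>\<bar> \<le> \<epsilon>}"
        using sup_le_iff_dyadic[OF fbm r] by blast
      also have "\<dots> \<in> sets M"
        using meas by measurable
      finally show "{\<omega> \<in> space M. (SUP t\<in>cbox 0 (\<chi> i. r). \<bar>B t \<omega>\<bar>) \<le> \<epsilon>} \<in> sets M" .
      have z: "(0 :: real ^ 'n) \<in> nonneg_orthant" by (simp add: nonneg_orthant_def)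
      have B0: "B 0 \<in> borel_measurable M" "integral\<^sup>L M (\<lambda>\<omega>. (B 0 \<omega>)\<^sup>2) = 0" "integrable M (\<lambda>\<omega>. (B 0 \<omega>)\<^sup>2)"
      proof -
        have g: "gaussian_variable M (B 0)" "integral\<^sup>L M (B 0) = 0"
          using fbm_gaussian[OF fbm, of "{0}" "\<lambda>t. t" "\<lambda>_. 1"] fbm_mean[OF fbm, of "{0}" "\<lambda>t. t" "\<lambda>_. 1"] z by simp_all
        show "B 0 \<in> borel_measurable M" using g by (simp add: gaussian_variable_def)
        show "integrable M (\<lambda>\<omega>. (B 0 \<omega>)\<^sup>2)" by (rule gaussian_variable_moment[OF M g])
        show "integral\<^sup>L M (\<lambda>\<omega>. (B 0 \<omega>)\<^sup>2) = 0"
          using fbm_variance[OF fbm, of "{0}" "\<lambda>t. t" "\<lambda>_. 1"] z by (simp add: mfbm_kernel_def)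
      qed
      have "AE \<omega> in M. (B 0 \<omega>)\<^sup>2 = 0"
        using integral_nonneg_eq_0_iff_AE[OF B0(3)] B0(2) by simp
      then show "AE \<omega> in M. \<omega> \<in> (\<Inter>N. E N) \<longrightarrow> \<omega> \<in> {\<omega> \<in> space M. (SUP t\<in>cbox 0 (\<chi> i. r). \<bar>B t \<omega>\<bar>) \<le> \<epsilon>}"
      proof eventually_elim
        case (elim \<omega>)
        show ?case
        proof
          assume \<omega>: "\<omega> \<in> (\<Inter>N. E N)"
          then have sp: "\<omega> \<in> space M" by (auto simp: E_def)
          have links: "\<bar>dyadic_link B r (n, i) \<omega>\<bar> \<le> e n" if "n > 0" "i \<in> dyadic_level n" for n i
          proof -
            have "\<omega> \<in> E n" using \<omega> by auto
            moreover have "(n, i) \<in> L n" using that by (auto simp: L_def)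
            ultimately show ?thesis by (auto simp: E_def X_def)
          qed
          have tot: "(\<Sum>j\<in>{1..n}. e j) \<le> \<epsilon>" for n
            using mult_left_mono[OF sum_link_tolerance_le[OF h(1), of "{1..n}" n0], of \<epsilon>] \<epsilon>
            by (simp add: e_def sum_distrib_left)
          have "\<bar>B (grid_point (r / 2 ^ n) i) \<omega>\<bar> \<le> \<epsilon>" if "i \<in> dyadic_level n" for n i
            using abs_dyadic_le_sum_links[OF _ links that] elim tot[of n] by fastforce
          then show "\<omega> \<in> {\<omega> \<in> space M. (SUP t\<in>cbox 0 (\<chi> i. r). \<bar>B t \<omega>\<bar>) \<le> \<epsilon>}"
            using sup_le_iff_dyadic[OF fbm r sp] sp by blast
        qed
      qed
    qed
    finally have "exp (- (K * (2 ^ n0) ^ ?\<nu>)) \<le> measure M {\<omega> \<in> space M. (SUP t\<in>cbox 0 (\<chi> i. r). \<bar>B t \<omega>\<bar>) \<le> \<epsilon>}" .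
    moreover have "K * (2 ^ n0) ^ ?\<nu> \<le> K * (2 * A) ^ ?\<nu>"
      using n0 K by (intro mult_left_mono power_mono) auto
    moreover have "(2 * A) ^ ?\<nu> = (2 * ?\<nu>) ^ ?\<nu> * (r ^ (?\<nu>\<^sup>2) / \<epsilon> powr (real ?\<nu> / h))"
    proof -
      have "(\<epsilon> powr (1 / h)) ^ ?\<nu> = \<epsilon> powr (real ?\<nu> / h)"
        using \<epsilon> by (simp add: powr_realpow[symmetric] powr_powr)
      then show ?thesis
        by (simp add: A_def power_divide power_mult_distrib power2_eq_square power_mult)
    qed
    ultimately show ?thesis by (simp add: mult.assoc) (meson exp_le_cancel_iff neg_le_iff_le order_trans)
  qed
  have "K * (2 * ?\<nu>) ^ ?\<nu> > 0" using K by simp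
  from that[OF this] main show thesis by simp
qed

theorem theorem2:
  fixes M :: "'w measure" and B :: "real ^ 'n \<Rightarrow> 'w \<Rightarrow> real" and h :: real
  assumes "0 < h" and "h < 1 / 2"
    and "multiparameter_fbm M h B"
  shows "\<exists>\<kappa>\<^sub>1 > 0. \<exists>\<kappa>\<^sub>2 > 0. \<forall>r::real. 0 < r \<and> r < 1 \<longrightarrow>
    (\<exists>\<epsilon>\<^sub>0 > 0. \<forall>\<epsilon>::real. 0 < \<epsilon> \<and> \<epsilon> < \<epsilon>\<^sub>0 \<longrightarrow>
      exp (- \<kappa>\<^sub>2 * (r ^ (CARD('n)\<^sup>2) / \<epsilon> powr (real CARD('n) / h)))
        \<le> measure M {\<omega> \<in> space M. (SUP t\<in>cbox 0 (\<chi> i. r). \<bar>B t \<omega>\<bar>) \<le> \<epsilon>} \<and>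
      measure M {\<omega> \<in> space M. (SUP t\<in>cbox 0 (\<chi> i. r). \<bar>B t \<omega>\<bar>) \<le> \<epsilon>}
        \<le> exp (- \<kappa>\<^sub>1 * (r ^ (CARD('n)\<^sup>2) / \<epsilon> powr (real CARD('n) / h))))"
proof -
  let ?\<nu> = "CARD('n)"
  obtain K where K: "K > 0" and upper: "\<And>(r::real) (\<epsilon>::real). r > 0 \<Longrightarrow> 0 < \<epsilon> \<Longrightarrow> \<epsilon> < (K * r ^ ?\<nu>) powr h \<Longrightarrow>
    measure M {\<omega> \<in> space M. (SUP t\<in>cbox 0 (\<chi> i. r). \<bar>B t \<omega>\<bar>) \<le> \<epsilon>}
      \<le> exp (- ((K / 2) ^ ?\<nu> / 2) * (r ^ (?\<nu>\<^sup>2) / \<epsilon> powr (real ?\<nu> / h)))"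
    using fbm_small_ball_upper[OF assms] by blast
  obtain K' where K': "K' > 0" and lower: "\<And>(r::real) (\<epsilon>::real). r > 0 \<Longrightarrow> 0 < \<epsilon> \<Longrightarrow> \<epsilon> < (?\<nu> * r ^ ?\<nu>) powr h \<Longrightarrow>
    exp (- K' * (r ^ (?\<nu>\<^sup>2) / \<epsilon> powr (real ?\<nu> / h)))
      \<le> measure M {\<omega> \<in> space M. (SUP t\<in>cbox 0 (\<chi> i. r). \<bar>B t \<omega>\<bar>) \<le> \<epsilon>}"
    using fbm_small_ball_lower[OF assms] by blast
  show ?thesis
  proof (intro exI conjI allI impI; (elim conjE)?)
    show "(K / 2) ^ ?\<nu> / 2 > 0" "K' > 0" using K K' by auto
    fix r :: real assume r: "0 < r"
    \<comment> \<open>Both thresholds shrink with \<open>r\<close>, whereas \<open>K\<close> and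
      \<open>K'\<close> were obtained before \<open>r\<close> was fixed.\<close>
    show "min ((K * r ^ ?\<nu>) powr h) ((?\<nu> * r ^ ?\<nu>) powr h) > 0"
      using r K by auto
    fix \<epsilon> :: real assume "0 < \<epsilon>" "\<epsilon> < min ((K * r ^ ?\<nu>) powr h) ((?\<nu> * r ^ ?\<nu>) powr h)"
    with r upper[of r \<epsilon>] lower[of r \<epsilon>]
    show "exp (- K' * (r ^ (?\<nu>\<^sup>2) / \<epsilon> powr (real ?\<nu> / h)))
          \<le> measure M {\<omega> \<in> space M. (SUP t\<in>cbox 0 (\<chi> i. r). \<bar>B t \<omega>\<bar>) \<le> \<epsilon>}"
      and "measure M {\<omega> \<in> space M. (SUP t\<in>cbox 0 (\<chi> i. r). \<bar>B t \<omega>\<bar>) \<le> \<epsilon>}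
          \<le> exp (- ((K / 2) ^ ?\<nu> / 2) * (r ^ (?\<nu>\<^sup>2) / \<epsilon> powr (real ?\<nu> / h)))"
      by auto
  qed
qed

end
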